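(* If $E$ is an Archimedean vector lattice over $\mathbb{R}$, then there exists a vector lattice complexification $(E_{|\mathbb{C}|},\phi)$ of $E$, and it is unique up to vector lattice isomorphism.
   Context: Let $\mathbb{K}$ be $\mathbb{R}$ or $\mathbb{C}$. A modulus on a $\mathbb{K}$-vector space $E$ is a map $m:E\to E$ with $m\circ m=m$ such that (1) $m(\alpha f)=|\alpha|m(f)$ for $\alpha\in\mathbb{K}$, $f\in E$; (2) $m\bigl(m(m(f)+m(g))-m(f+g)\bigr)=m(f)+m(g)-m(f+g)$ for $f,g\in E$; (3) $E$ is the $\mathbb{K}$-linear hull of $m(E)$. It is Archimedean if, for $f,g\in E$, $m(m(g)-nm(f))=m(g)-nm(f)$ for all $n\in\mathbb{N}$ implies $f=0$. An Archimedean vector lattice over $\mathbb{K}$ is a $\mathbb{K}$-vector space with an Archimedean modulus, written $|\cdot|$. Put $E^+=\{f\in E:|f|=f\}$ and $E_\rho=E^+-E^+$. Known facts (Mittelmeyer–Wolff): for $\mathbb{K}=\mathbb{R}$ these are exactly the usual Archimedean vector lattices with $|f|=f\vee(-f)$; for $\mathbb{K}=\mathbb{C}$, $E_\rho$ is an Archimedean real vector lattice with positive cone $E^+$, $E=E_\rho\oplus iE_\rho$, and $|f+ig|=\sup\{f\cos\theta+g\sin\theta:\theta\in[0,2\pi]\}$ (the supremum existing in $E_\rho$) for $f,g\in E_\rho$. A vector lattice $\mathbb{K}$-homomorphism between Archimedean vector lattices over $\mathbb{K}$ is a $\mathbb{K}$-linear map $T$ with $T(|f|)=|T(f)|$ for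 all $f$; a vector lattice isomorphism is a bijective one. A vector lattice complexification of an Archimedean vector lattice $E$ over $\mathbb{R}$ is a pair $(E_{|\mathbb{C}|},\phi)$ such that: (1) $E_{|\mathbb{C}|}$ is an Archimedean vector lattice over $\mathbb{C}$; (2) $\phi:E\to(E_{|\mathbb{C}|})_\rho$ is an injective vector lattice $\mathbb{R}$-homomorphism; (3) for every Archimedean vector lattice $F$ over $\mathbb{C}$ and every vector lattice $\mathbb{R}$-homomorphism $T:E\to F_\rho$ there exists a unique vector lattice $\mathbb{C}$-homomorphism $T_{|\mathbb{C}|}:E_{|\mathbb{C}|}\to F$ such that $T_{|\mathbb{C}|}\circ\phi=T$. *)

theory Defs
  imports Complex_Main "HOL-Library.FuncSet" "HOL-Algebra.Algebraic_Closure_Type"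
begin

text \<open>
  Vector spaces over \<open>\<real>\<close> or \<open>\<complex>\<close> are HOL-Algebra modules over the field \<open>ring_of_type_algebra\<close>, whose
  carrier is the whole scalar type; the ring multiplication and unit in the record of the vector
  space are never used. The scalar type is a \<open>real_normed_field\<close>, so that the two cases can be
  treated together; only its instances \<open>real\<close> and \<open>complex\<close> are used.
\<close>

record ('k, 'a) modulus_space = "('k, 'a) module" +
  modulus :: "'a \<Rightarrow> 'a"

definition linear_hull :: "('k, 'a, 'z) module_scheme \<Rightarrow> 'a set \<Rightarrow> 'a set" where
  "linear_hull E S = {(\<Oplus>\<^bsub>E\<^esub>v\<in>A. c v \<odot>\<^bsub>E\<^esub> v) | c A. finite A \<and> A \<subseteq> S}"

text \<open>The scalar \<open>|\<alpha>|\<close> is \<open>of_real (norm \<alpha>)\<close>.\<close>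

locale archimedean_vector_lattice =
  Module.module "ring_of_type_algebra :: 'k ring" E
  for E :: "('k :: real_normed_field, 'a) modulus_space" (structure) +
  assumes modulus_closed: "f \<in> carrier E \<Longrightarrow> modulus E f \<in> carrier E"
    and modulus_idem: "f \<in> carrier E \<Longrightarrow> modulus E (modulus E f) = modulus E f"
    and modulus_smult:
      "f \<in> carrier E \<Longrightarrow> modulus E (\<alpha> \<odot>\<^bsub>E\<^esub> f) = of_real (norm \<alpha>) \<odot>\<^bsub>E\<^esub> modulus E f"
    and modulus_add:
      "f \<in> carrier E \<Longrightarrow> g \<in> carrier E \<Longrightarrow>
        modulus E (modulus E (modulus E f \<oplus>\<^bsub>E\<^esub> modulus E g) \<ominus>\<^bsub>E\<^esub> modulus E (f \<oplus>\<^bsub>E\<^esub> g))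
          = (modulus E f \<oplus>\<^bsub>E\<^esub> modulus E g) \<ominus>\<^bsub>E\<^esub> modulus E (f \<oplus>\<^bsub>E\<^esub> g)"
    and modulus_hull: "linear_hull E (modulus E ` carrier E) = carrier E"
    and modulus_archimedean:
      "f \<in> carrier E \<Longrightarrow> g \<in> carrier E \<Longrightarrow>
        (\<And>n :: nat. modulus E (modulus E g \<ominus>\<^bsub>E\<^esub> of_nat n \<odot>\<^bsub>E\<^esub> modulus E f)
                     = modulus E g \<ominus>\<^bsub>E\<^esub> of_nat n \<odot>\<^bsub>E\<^esub> modulus E f) \<Longrightarrow>
        f = \<zero>\<^bsub>E\<^esub>"

definition positive_cone :: "('k, 'a) modulus_space \<Rightarrow> 'a set" where
  "positive_cone E = {f \<in> carrier E. modulus E f = f}"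

text \<open>\<open>E\<^sub>\<rho> = E\<^sup>+ - E\<^sup>+\<close> with the operations and the modulus of \<open>E\<close> and real scalars.\<close>

definition rho :: "('k :: real_normed_field, 'a) modulus_space \<Rightarrow> (real, 'a) modulus_space" where
  "rho E =
    \<lparr> carrier = {f \<ominus>\<^bsub>E\<^esub> g | f g. f \<in> positive_cone E \<and> g \<in> positive_cone E},
      monoid.mult = monoid.mult E, one = one E,
      zero = zero E, add = add E,
      module.smult = (\<lambda>r f. of_real r \<odot>\<^bsub>E\<^esub> f),
      modulus = modulus E \<rparr>"

definition vl_hom ::
    "('k, 'a) modulus_space \<Rightarrow> ('k, 'b) modulus_space \<Rightarrow> ('a \<Rightarrow> 'b) set" where
  "vl_hom E F =
    {T \<in> carrier E \<rightarrow> carrier F.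
      (\<forall>f\<in>carrier E. \<forall>g\<in>carrier E. T (f \<oplus>\<^bsub>E\<^esub> g) = T f \<oplus>\<^bsub>F\<^esub> T g) \<and>
      (\<forall>\<alpha>. \<forall>f\<in>carrier E. T (\<alpha> \<odot>\<^bsub>E\<^esub> f) = \<alpha> \<odot>\<^bsub>F\<^esub> T f) \<and>
      (\<forall>f\<in>carrier E. T (modulus E f) = modulus F (T f))}"

definition vl_iso ::
    "('k, 'a) modulus_space \<Rightarrow> ('k, 'b) modulus_space \<Rightarrow> ('a \<Rightarrow> 'b) set" where
  "vl_iso E F = {T \<in> vl_hom E F. bij_betw T (carrier E) (carrier F)}"

text \<open>
  HOL cannot quantify over types inside a formula, so the type \<open>'f\<close> that contains the carriers of
  the test spaces \<open>F\<close> is a parameter. Restricting \<open>T'\<close> to extensional functions makes \<open>\<exists>!\<close> mean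
  uniqueness on the carrier.
\<close>

definition vl_complexification ::
    "'f itself \<Rightarrow> (real, 'a) modulus_space \<Rightarrow> (complex, 'b) modulus_space \<Rightarrow> ('a \<Rightarrow> 'b) \<Rightarrow> bool"
  where
  "vl_complexification _ E EC \<phi> \<longleftrightarrow>
    archimedean_vector_lattice EC \<and>
    \<phi> \<in> vl_hom E (rho EC) \<and> inj_on \<phi> (carrier E) \<and>
    (\<forall>F :: (complex, 'f) modulus_space. archimedean_vector_lattice F \<longrightarrow>
      (\<forall>T \<in> vl_hom E (rho F).
        \<exists>!T'. T' \<in> vl_hom EC F \<inter> extensional (carrier EC) \<and>
              (\<forall>f\<in>carrier E. T' (\<phi> f) = T f)))"

end

theory Submission
  imports Defs "HOL-Library.Function_Algebras" "HOL-Library.Equipollence"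
begin

text \<open>
  An Archimedean vector lattice \<open>E\<close> need not contain the suprema \<open>|f + i g|\<close> of the rotations
  \<open>f cos t + g sin t\<close>, but these are relatively uniform limits of the finite suprema \<open>\<sigma>\<^sub>n(f, g)\<close> over grids
  of angles. The complexification is therefore realised by relatively uniform Cauchy sequences in
  \<open>E + i E\<close>, modulo those that converge to zero: the modulus of a sequence has the terms
  \<open>\<sigma>\<^sub>n(f\<^sub>n, g\<^sub>n)\<close>, and one takes the part generated by the constant sequences.

  In a complex Archimedean vector lattice \<open>F\<close>, the axioms of a modulus imply that \<open>|f + i g|\<close> is the
  supremum of the rotations and differs from \<open>\<sigma>\<^sub>n(f, g)\<close> by at most \<open>(|f| + |g|) / (n + 1)\<close>. A real lattice
  homomorphism \<open>T\<close> from \<open>E\<close> to \<open>F\<^sub>\<rho>\<close> commutes with \<open>\<sigma>\<^sub>n\<close>, so by induction over the generation the images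
  under \<open>T\<close> of a generated sequence converge in \<open>F\<close>, and the limit is the extension of \<open>T\<close>.
\<close>

section \<open>Spaces with a modulus\<close>

text \<open>Neither the order on \<open>E^+ - E^+\<close> nor the formula for |f + i g| is assumed;
  both are derived from the axioms of a modulus. The obstacle over the complex numbers is that no
  axiom relates |f + i g| to |f - i g|, and without such a relation not even f \<le> |f + i g| is in
  sight. The way around it is a narrow sector about the positive axis: there a vector and its
  conjugate both have nearly the modulus f. Replacing g by |g| and rotating, with the angle halved
  each time, moves any vector into such a sector while the moduli of the vector and of its conjugate
  stay controlled together. The types of HOL shape the rest. The complexification has to lie in the
  type of E, which calls for a bound on the cardinality of the quotient. The universal property can
  be stated for one test type at a time; it passes from one test type to another by comparison with
  a single space that is universal for both.\<close>

text \<open>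
  Vectors are complex-valued functions on an arbitrary index type, so that linear identities can be
  verified pointwise. Every module over \<open>\<real>\<close> or \<open>\<complex>\<close> embeds linearly into such a space of
  functions; the scalar field then becomes a set \<open>K\<close> of complex numbers.
\<close>

definition cscale :: "complex \<Rightarrow> ('i \<Rightarrow> complex) \<Rightarrow> 'i \<Rightarrow> complex"  (infixr "*\<^sub>C" 75)
  where "c *\<^sub>C x = (\<lambda>i. c * x i)"

lemma cscale_apply [simp]: "(c *\<^sub>C x) i = c * x i"
  by (simp add: cscale_def)

lemmas vec = fun_eq_iff algebra_simps

lemma cscale_simps [simp]:
  "0 *\<^sub>C x = 0" "c *\<^sub>C 0 = 0" "1 *\<^sub>C x = x" "(- 1) *\<^sub>C x = - x" "c *\<^sub>C d *\<^sub>C x = (c * d) *\<^sub>C x"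
  by (simp_all add: vec)

lemma cscale_add: "c *\<^sub>C (x + y) = c *\<^sub>C x + c *\<^sub>C y"
  by (simp add: vec)

text \<open>One locale serves both scalar fields. The hull axiom is not part of it: it returns in
  the form in which it is used, as \<open>R_decomp\<close> over the complex numbers and as
  \<open>S_R\<close> over the reals.\<close>

locale modulus_structure =
  fixes K :: "complex set" and S :: "('i \<Rightarrow> complex) set" and m :: "('i \<Rightarrow> complex) \<Rightarrow> 'i \<Rightarrow> complex"
  assumes Reals_subset: "\<real> \<subseteq> K"
    and zero_mem [simp]: "0 \<in> S"
    and add_mem [simp]: "x \<in> S \<Longrightarrow> y \<in> S \<Longrightarrow> x + y \<in> S"
    and scale_mem: "c \<in> K \<Longrightarrow> x \<in> S \<Longrightarrow> c *\<^sub>C x \<in> S"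
    and m_mem [simp]: "x \<in> S \<Longrightarrow> m x \<in> S"
    and m_idem: "x \<in> S \<Longrightarrow> m (m x) = m x"
    and m_scale: "c \<in> K \<Longrightarrow> x \<in> S \<Longrightarrow> m (c *\<^sub>C x) = norm c *\<^sub>C m x"
    and m_add: "x \<in> S \<Longrightarrow> y \<in> S \<Longrightarrow> m (m (m x + m y) - m (x + y)) = m x + m y - m (x + y)"
    and archimedean: "x \<in> S \<Longrightarrow> y \<in> S \<Longrightarrow>
        (\<And>n::nat. m (m y - of_nat n *\<^sub>C m x) = m y - of_nat n *\<^sub>C m x) \<Longrightarrow> x = 0"
begin

section \<open>The positive cone, its order, and the lattice structure of its span\<close>

definition pos where "pos = {x \<in> S. m x = x}"

definition R where "R = {p - q | p q. p \<in> pos \<and> q \<in> pos}"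

definition le (infix "\<preceq>" 50) where "x \<preceq> y \<longleftrightarrow> y - x \<in> pos"

lemma of_real_mem [simp]: "complex_of_real r \<in> K"
  using Reals_subset by auto

lemma scale_real_mem [simp]: "x \<in> S \<Longrightarrow> complex_of_real r *\<^sub>C x \<in> S"
  by (rule scale_mem) simp

lemma uminus_mem [simp]: "x \<in> S \<Longrightarrow> - x \<in> S"
  using scale_real_mem[of x "-1"] by simp

lemma diff_mem [simp]: "x \<in> S \<Longrightarrow> y \<in> S \<Longrightarrow> x - y \<in> S"
  using add_mem[of x "- y"] by simp

lemma m_scale_real: "x \<in> S \<Longrightarrow> m (complex_of_real r *\<^sub>C x) = complex_of_real \<bar>r\<bar> *\<^sub>C m x"
  by (subst m_scale) simp_all

lemma m_uminus: "x \<in> S \<Longrightarrow> m (- x) = m x"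
  using m_scale_real[of x "-1"] by simp

lemma m_zero [simp]: "m 0 = 0"
  using m_scale_real[of 0 0] by simp

lemma zero_pos [simp]: "0 \<in> pos"
  by (simp add: pos_def)

lemma m_pos [simp]: "x \<in> S \<Longrightarrow> m x \<in> pos"
  by (simp add: pos_def m_idem)

lemma pos_S: "x \<in> pos \<Longrightarrow> x \<in> S"
  by (simp add: pos_def)

lemma m_eq: "x \<in> pos \<Longrightarrow> m x = x"
  by (simp add: pos_def)

lemma pos_scale: "x \<in> pos \<Longrightarrow> 0 \<le> r \<Longrightarrow> complex_of_real r *\<^sub>C x \<in> pos"
  by (simp add: pos_def m_scale_real)

text \<open>Axiom (2) at fixed points of \<open>m\<close>: the outer argument becomes m (x + y) - m
  (x + y) = 0, which leaves x + y = m (x + y).\<close>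

lemma pos_add: assumes "x \<in> pos" "y \<in> pos" shows "x + y \<in> pos"
proof -
  have "m (m (x + y) - m (x + y)) = x + y - m (x + y)"
    using m_add[of x y] assms by (simp add: pos_def)
  hence "m (x + y) = x + y" by simp
  thus ?thesis using assms by (simp add: pos_def)
qed

lemma pos_pointed: assumes "x \<in> pos" "- x \<in> pos" shows "x = 0"
proof -
  have "x = - x" using assms m_uminus[of x] by (simp add: pos_def)
  thus ?thesis by (simp add: fun_eq_iff eq_neg_iff_add_eq_0)
qed

text \<open>By \<open>pos_add\<close> the inner \<open>m\<close> in axiom (2) acts on a positive
  vector and disappears; what remains says that the defect of the triangle inequality is fixed by
  \<open>m\<close>.\<close>

lemma m_triangle: assumes "x \<in> S" "y \<in> S" shows "m (x + y) \<preceq> m x + m y"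
proof -
  have "m x + m y \<in> pos" using assms by (simp add: pos_add)
  hence "m (m x + m y - m (x + y)) = m x + m y - m (x + y)"
    using m_add[OF assms] by (simp add: m_eq)
  thus ?thesis using assms by (simp add: le_def pos_def)
qed

lemma pos_R [simp]: "x \<in> pos \<Longrightarrow> x \<in> R"
  unfolding R_def using zero_pos by (metis (mono_tags, lifting) diff_zero mem_Collect_eq)

lemma R_S: "x \<in> R \<Longrightarrow> x \<in> S"
  by (auto simp: R_def pos_S)

lemma zero_R [simp]: "0 \<in> R"
  by simp

lemma m_R [simp]: "x \<in> S \<Longrightarrow> m x \<in> R"
  by simp

lemma add_R [simp]: assumes "x \<in> R" "y \<in> R" shows "x + y \<in> R"
proof -
  obtain a b c d where "x = a - b" "y = c - d" and p: "a \<in> pos" "b \<in> pos" "c \<in> pos" "d \<in> pos"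
    using assms by (auto simp: R_def)
  hence "x + y = (a + c) - (b + d)" by simp
  thus ?thesis using p pos_add unfolding R_def by blast
qed

lemma uminus_R [simp]: "x \<in> R \<Longrightarrow> - x \<in> R"
  unfolding R_def by (smt (verit) mem_Collect_eq minus_diff_eq)

lemma diff_R [simp]: "x \<in> R \<Longrightarrow> y \<in> R \<Longrightarrow> x - y \<in> R"
  using add_R[of x "- y"] by simp

lemma scale_R [simp]: assumes "x \<in> R" shows "complex_of_real r *\<^sub>C x \<in> R"
proof -
  have *: "complex_of_real r *\<^sub>C x \<in> R" if that': "x \<in> R" "r \<ge> 0" for r x
  proof -
    obtain a b where x: "x = a - b" and p: "a \<in> pos" "b \<in> pos" using that' by (auto simp: R_def)
    have "complex_of_real r *\<^sub>C x = complex_of_real r *\<^sub>C a - complex_of_real r *\<^sub>C b"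
      unfolding x by (simp add: vec)
    thus ?thesis using p that' pos_scale unfolding R_def by blast
  qed
  show ?thesis
  proof (cases "r \<ge> 0")
    case False
    hence "complex_of_real (- r) *\<^sub>C (- x) \<in> R" using assms by (intro *) auto
    moreover have "complex_of_real (- r) *\<^sub>C (- x) = complex_of_real r *\<^sub>C x" by (simp add: vec)
    ultimately show ?thesis by simp
  qed (use * assms in auto)
qed

lemma le_refl [simp]: "x \<preceq> x"
  by (simp add: le_def)

lemma zero_le_iff: "0 \<preceq> x \<longleftrightarrow> x \<in> pos"
  by (simp add: le_def)

lemma le_trans [trans]: "x \<preceq> y \<Longrightarrow> y \<preceq> z \<Longrightarrow> x \<preceq> z"
  using pos_add[of "y - x" "z - y"] by (simp add: le_def)

lemma eq_le_trans [trans]: "x = y \<Longrightarrow> y \<preceq> z \<Longrightarrow> x \<preceq> z"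
  and le_eq_trans [trans]: "x \<preceq> y \<Longrightarrow> y = z \<Longrightarrow> x \<preceq> z"
  by simp_all

lemma le_antisym: "x \<preceq> y \<Longrightarrow> y \<preceq> x \<Longrightarrow> x = y"
  using pos_pointed[of "y - x"] by (simp add: le_def)

text \<open>\<open>le_comb1\<close> and \<open>le_comb2\<close> reduce an inequality to a linear
  identity: the difference to be shown positive is a nonnegative combination of differences known to
  be positive, and the identity is checked pointwise.\<close>

lemma le_comb1: "a \<preceq> b \<Longrightarrow> 0 \<le> r \<Longrightarrow> d - c = complex_of_real r *\<^sub>C (b - a) \<Longrightarrow> c \<preceq> d"
  by (simp add: le_def pos_scale)

lemma le_comb2: "a \<preceq> b \<Longrightarrow> a' \<preceq> b' \<Longrightarrow> 0 \<le> r \<Longrightarrow> 0 \<le> s \<Longrightarrow>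
    d - c = complex_of_real r *\<^sub>C (b - a) + complex_of_real s *\<^sub>C (b' - a') \<Longrightarrow> c \<preceq> d"
  by (simp add: le_def pos_scale pos_add)

lemma le_add_mono: "a \<preceq> b \<Longrightarrow> a' \<preceq> b' \<Longrightarrow> a + a' \<preceq> b + b'"
  by (rule le_comb2[of a b a' b' 1 1]) simp_all

lemma le_scale_mono: "a \<preceq> b \<Longrightarrow> 0 \<le> r \<Longrightarrow> complex_of_real r *\<^sub>C a \<preceq> complex_of_real r *\<^sub>C b"
  by (rule le_comb1[of a b r]) (simp_all add: vec)

lemma le_scale_pos: assumes "x \<in> pos" "r \<le> s"
  shows "complex_of_real r *\<^sub>C x \<preceq> complex_of_real s *\<^sub>C x"
  by (rule le_comb1[of 0 x "s - r"]) (use assms in \<open>simp add: zero_le_iff\<close>, use assms in simp, simp add: vec)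

lemma le_add_pos: "x \<preceq> y \<Longrightarrow> u \<in> pos \<Longrightarrow> x \<preceq> y + u"
  using le_add_mono[of x y 0 u] by (simp add: zero_le_iff)

text \<open>For x = p - q with p and q positive, the triangle inequality for x + q = p gives p \<le>
  m x + q.\<close>

lemma le_m: assumes "x \<in> R" shows "x \<preceq> m x"
proof -
  obtain p q where x: "x = p - q" and pq: "p \<in> pos" "q \<in> pos" using assms by (auto simp: R_def)
  have "m (x + q) \<preceq> m x + m q" using assms pq by (intro m_triangle) (simp_all add: R_S pos_S)
  thus ?thesis using pq by (simp add: x m_eq le_def algebra_simps)
qed

lemma uminus_le_m: "x \<in> R \<Longrightarrow> - x \<preceq> m x"
  using le_m[of "- x"] by (simp add: m_uminus R_S)

text \<open>The vectors h - x and h + x are positive and x is half their difference, so m x is at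
  most half their sum, which is h. With \<open>le_m\<close> this makes m x the supremum of x and -
  x, hence \<open>R\<close> a vector lattice.\<close>

lemma m_le: assumes "x \<preceq> h" "- x \<preceq> h" shows "m x \<preceq> h"
proof -
  define a b where "a = h - x" and "b = h + x"
  hence ab: "a \<in> pos" "b \<in> pos" using assms by (simp_all add: le_def)
  have x: "x = complex_of_real (1/2) *\<^sub>C (b - a)" and h: "h = complex_of_real (1/2) *\<^sub>C (b + a)"
    by (simp_all add: a_def b_def fun_eq_iff)
  have "m x = complex_of_real (1/2) *\<^sub>C m (b - a)"
    unfolding x using ab by (subst m_scale_real) (simp_all add: pos_S)
  moreover have "m (b + - a) \<preceq> m b + m (- a)"
    using ab by (intro m_triangle) (simp_all add: pos_S)
  hence "m (b - a) \<preceq> b + a" using ab by (simp add: m_uminus pos_S m_eq)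
  ultimately show ?thesis unfolding h by (metis le_scale_mono zero_le_divide_1_iff zero_le_numeral)
qed

lemma m_le_iff: "x \<in> R \<Longrightarrow> m x \<preceq> h \<longleftrightarrow> x \<preceq> h \<and> - x \<preceq> h"
  by (meson m_le le_m uminus_le_m le_trans)

text \<open>The axiom speaks of moduli, so it is applied to the positive part \<open>?p\<close> of
  x. Since n x and - n x both lie below 2 u - n x, so does n m x, whence n \<open>?p\<close> \<le>
  u. Then \<open>?p\<close> = 0, that is, m x = - x.\<close>

lemma nat_archimedean:
  assumes x: "x \<in> R" and le: "\<And>n::nat. complex_of_real (real n) *\<^sub>C x \<preceq> u"
  shows "x \<preceq> 0"
proof -
  let ?p = "complex_of_real (1/2) *\<^sub>C (x + m x)"
  have u: "u \<in> pos" using le[of 0] by (simp add: zero_le_iff)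
  have p: "?p \<in> pos" using uminus_le_m[OF x] by (intro pos_scale) (simp_all add: le_def add.commute)
  have "m (m u - of_nat n *\<^sub>C m ?p) = m u - of_nat n *\<^sub>C m ?p" for n
  proof -
    let ?y = "complex_of_real (real n) *\<^sub>C x"
    have "?y \<preceq> (u + u) - ?y"
      by (rule le_comb1[OF le[of n], of 2]) (simp_all add: vec)
    moreover have "- ?y \<preceq> (u + u) - ?y"
      by (rule le_comb1[OF u[folded zero_le_iff], of 2]) (simp_all add: vec)
    ultimately have "m ?y \<preceq> (u + u) - ?y" by (rule m_le)
    moreover have "m ?y = complex_of_real (real n) *\<^sub>C m x" using m_scale_real[of x n] x by (simp add: R_S)
    ultimately have *: "complex_of_real (real n) *\<^sub>C m x \<preceq> (u + u) - ?y" by simp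
    have "complex_of_real (real n) *\<^sub>C ?p \<preceq> u"
      by (rule le_comb1[OF *, of "1/2"]) (simp_all add: vec)
    thus ?thesis using p u by (simp add: le_def m_eq)
  qed
  hence "?p = 0" using p u by (intro archimedean[of ?p u]) (simp_all add: pos_S)
  hence "x + m x = 0" by (simp add: fun_eq_iff)
  hence "- x = m x" by (rule minus_unique)
  thus ?thesis using x by (simp add: le_def R_S)
qed

lemma arch_eps:
  assumes "x \<in> R" "y \<in> R" and u: "u \<in> pos"
    and le: "\<And>n::nat. x \<preceq> y + complex_of_real (1 / real (Suc n)) *\<^sub>C u"
  shows "x \<preceq> y"
proof -
  have "complex_of_real (real n) *\<^sub>C (x - y) \<preceq> u" for n
  proof -
    have "complex_of_real (real n) *\<^sub>C (x - y) \<preceq> complex_of_real (real n * (1 / real (Suc n))) *\<^sub>C u"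
      by (rule le_comb1[OF le[of n], of n]) (simp_all add: vec)
    also have "\<dots> \<preceq> complex_of_real 1 *\<^sub>C u"
      using u by (rule le_scale_pos) simp
    finally show ?thesis by simp
  qed
  hence "x - y \<preceq> 0" using assms by (intro nat_archimedean[of _ u]) simp_all
  thus ?thesis by (simp add: le_def)
qed

text \<open>Serves to let the angle of the sector tend to 0: the factors will be expressions in
  cosines that converge to 1.\<close>

lemma arch_scale:
  assumes "x \<in> pos" "y \<in> R" and le: "\<And>k::nat. complex_of_real (c k) *\<^sub>C x \<preceq> y" and c: "c \<longlonglongrightarrow> 1"
  shows "x \<preceq> y"
proof (rule arch_eps[of x y x])
  fix n
  have "1 - 1 / real (Suc n) < 1" by simp
  then obtain k where "1 - 1 / real (Suc n) < c k"
    using eventually_happens'[OF sequentially_bot order_tendstoD(1)[OF c]] by blast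
  hence "complex_of_real (1 - 1 / real (Suc n)) *\<^sub>C x \<preceq> complex_of_real (c k) *\<^sub>C x"
    using assms by (intro le_scale_pos) auto
  also note le
  finally have *: "complex_of_real (1 - 1 / real (Suc n)) *\<^sub>C x \<preceq> y" .
  show "x \<preceq> y + complex_of_real (1 / real (Suc n)) *\<^sub>C x"
    by (rule le_comb1[OF *, of 1]) (simp_all add: vec)
qed (use assms in auto)

text \<open>
  Since \<open>m g - g\<close> and \<open>m g + g\<close> are twice the negative and the positive part of \<open>g\<close>, this allows one to
  argue as if \<open>g\<close> were either positive or negative.
\<close>

lemma le_by_cases:
  assumes "a \<preceq> b + (m g - g)" "a \<preceq> b + (m g + g)"
  shows "a \<preceq> b"
proof -
  \<comment> \<open>Rearranged, the two assumptions say that m g - (a - b) dominates g and -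
    g.\<close>
  have "m g \<preceq> m g - (a - b)"
    using assms by (intro m_le) (simp_all add: le_def algebra_simps)
  thus ?thesis by (simp add: le_def)
qed

lemma m_eq_zero: assumes "x \<in> S" "m x = 0" shows "x = 0"
  by (rule archimedean[of x 0]) (use assms in simp_all)

lemma m_diff_le: assumes "x \<in> S" "y \<in> S" shows "m (m x - m y) \<preceq> m (x - y)"
proof -
  have "m ((x - y) + y) \<preceq> m (x - y) + m y" "m ((y - x) + x) \<preceq> m (y - x) + m x"
    using assms by (intro m_triangle; simp)+
  moreover have "m (y - x) = m (x - y)" using m_uminus[of "x - y"] assms by simp
  ultimately show ?thesis by (intro m_le) (simp_all add: le_def algebra_simps)
qed

lemma m_triangle_diff: "x \<in> S \<Longrightarrow> y \<in> S \<Longrightarrow> m (x - y) \<preceq> m x + m y"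
  using m_triangle[of x "- y"] by (simp add: m_uminus)

end

section \<open>Finite suprema of rotations\<close>

text \<open>The supremum of \<open>x\<close> and \<open>y\<close>, see \<open>vsup_le_iff\<close>,
  written with the modulus so that linear maps commuting with \<open>m\<close> visibly preserve
  it.\<close>

definition vsup :: "(('i \<Rightarrow> complex) \<Rightarrow> 'i \<Rightarrow> complex) \<Rightarrow> ('i \<Rightarrow> complex) \<Rightarrow> ('i \<Rightarrow> complex) \<Rightarrow> 'i \<Rightarrow> complex"
  where "vsup m x y = complex_of_real (1/2) *\<^sub>C (x + y + m (x - y))"

text \<open>The real part of exp (- i t) (f + i g).\<close>

definition ray :: "real \<Rightarrow> ('i \<Rightarrow> complex) \<Rightarrow> ('i \<Rightarrow> complex) \<Rightarrow> 'i \<Rightarrow> complex"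
  where "ray t f g = complex_of_real (cos t) *\<^sub>C f + complex_of_real (sin t) *\<^sub>C g"

text \<open>Starting from 0 makes every finite supremum positive. This is harmless, since an upper
  bound of all rays is positive by \<open>rays_le_pos\<close>.\<close>

definition ray_sup :: "(('i \<Rightarrow> complex) \<Rightarrow> 'i \<Rightarrow> complex) \<Rightarrow> real list \<Rightarrow> ('i \<Rightarrow> complex) \<Rightarrow> ('i \<Rightarrow> complex) \<Rightarrow> 'i \<Rightarrow> complex"
  where "ray_sup m ts f g = foldr (\<lambda>t s. vsup m (ray t f g) s) ts 0"

text \<open>The angles cover \<open>[0, 8)\<close>, hence a full period, with mesh \<open>1 / (n + 1)\<close>.\<close>

definition grid :: "nat \<Rightarrow> real list"
  where "grid n = map (\<lambda>j. real j / real (Suc n)) [0..<8 * Suc n]"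

lemma ray_zero: "ray 0 f g = f"
  by (simp add: ray_def)

lemma ray_add: "ray t (f + f') (g + g') = ray t f g + ray t f' g'"
  by (simp add: ray_def vec)

text \<open>After reduction modulo 2 pi, which is below 8, round down to the grid; sine and cosine
  are 1-Lipschitz by the sum-to-product formulas.\<close>

lemma grid_near:
  "\<exists>s\<in>set (grid n). \<bar>cos t - cos s\<bar> \<le> 1 / real (Suc n) \<and> \<bar>sin t - sin s\<bar> \<le> 1 / real (Suc n)"
proof -
  define k where "k = \<lfloor>t / (2 * pi)\<rfloor>"
  define u where "u = t - 2 * pi * k"
  define j where "j = nat \<lfloor>u * Suc n\<rfloor>"
  define s where "s = real j / real (Suc n)"
  have k: "k \<le> t / (2 * pi)" "t / (2 * pi) < k + 1" unfolding k_def by linarith+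
  have u: "0 \<le> u" "u < 2 * pi" using k by (simp_all add: u_def field_simps)
  hence "u < 8" using pi_less_4 by linarith
  have un: "0 \<le> u * Suc n" using u by simp
  have "real j \<le> u * Suc n" "u * Suc n < real j + 1" unfolding j_def using un by linarith+
  hence j: "s \<le> u" "u < s + 1 / Suc n" by (simp_all add: s_def field_simps)
  have "real j < 8 * real (Suc n)"
  proof -
    have "u * Suc n < 8 * real (Suc n)" using \<open>u < 8\<close> by (intro mult_strict_right_mono) auto
    thus ?thesis using \<open>real j \<le> u * Suc n\<close> by linarith
  qed
  hence "real j < real (8 * Suc n)" by simp
  hence "j < 8 * Suc n" by (simp only: of_nat_less_iff)
  hence s: "s \<in> set (grid n)" by (auto simp: grid_def s_def)
  have tu: "t = u + of_int k * (2 * pi)" by (simp add: u_def)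
  have "cos t = cos u" "sin t = sin u" unfolding tu
    using cos_int_2pin[of k] sin_int_2pin[of k] by (simp_all add: cos_add sin_add mult.commute)
  moreover have "\<bar>cos u - cos s\<bar> \<le> \<bar>u - s\<bar>"
  proof -
    have "\<bar>sin ((u + s) / 2)\<bar> * \<bar>sin ((s - u) / 2)\<bar> \<le> 1 * \<bar>(s - u) / 2\<bar>"
      by (intro mult_mono abs_sin_x_le_abs_x) auto
    thus ?thesis by (simp add: cos_diff_cos abs_mult)
  qed
  moreover have "\<bar>sin u - sin s\<bar> \<le> \<bar>u - s\<bar>"
  proof -
    have "\<bar>sin ((u - s) / 2)\<bar> * \<bar>cos ((u + s) / 2)\<bar> \<le> \<bar>(u - s) / 2\<bar> * 1"
      by (intro mult_mono abs_sin_x_le_abs_x) auto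
    thus ?thesis by (simp add: sin_diff_sin abs_mult)
  qed
  moreover have "\<bar>u - s\<bar> \<le> 1 / Suc n" using j by auto
  ultimately show ?thesis using s by (intro bexI[of _ s]) auto
qed

context modulus_structure
begin

lemma vsup_R [simp]: "x \<in> R \<Longrightarrow> y \<in> R \<Longrightarrow> vsup m x y \<in> R"
  by (simp add: vsup_def R_S del: of_real_divide)

lemma vsup_le_iff: assumes "x \<in> R" "y \<in> R" shows "vsup m x y \<preceq> h \<longleftrightarrow> x \<preceq> h \<and> y \<preceq> h"
proof -
  have d: "x - y \<in> R" using assms by simp
  have "vsup m x y \<preceq> h \<longleftrightarrow> m (x - y) \<preceq> h + h - (x + y)"
  proof
    assume *: "vsup m x y \<preceq> h"
    show "m (x - y) \<preceq> h + h - (x + y)" by (rule le_comb1[OF *, of 2]) (simp_all add: vec vsup_def)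
  next
    assume *: "m (x - y) \<preceq> h + h - (x + y)"
    show "vsup m x y \<preceq> h" by (rule le_comb1[OF *, of "1/2"]) (simp_all add: vec vsup_def)
  qed
  also have "\<dots> \<longleftrightarrow> x - y \<preceq> h + h - (x + y) \<and> - (x - y) \<preceq> h + h - (x + y)"
    using m_le_iff[OF d] .
  also have "x - y \<preceq> h + h - (x + y) \<longleftrightarrow> x \<preceq> h"
  proof
    assume *: "x - y \<preceq> h + h - (x + y)"
    show "x \<preceq> h" by (rule le_comb1[OF *, of "1/2"]) (simp_all add: vec)
  next
    assume *: "x \<preceq> h"
    show "x - y \<preceq> h + h - (x + y)" by (rule le_comb1[OF *, of 2]) (simp_all add: vec)
  qed
  also have "- (x - y) \<preceq> h + h - (x + y) \<longleftrightarrow> y \<preceq> h"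
  proof
    assume *: "- (x - y) \<preceq> h + h - (x + y)"
    show "y \<preceq> h" by (rule le_comb1[OF *, of "1/2"]) (simp_all add: vec)
  next
    assume *: "y \<preceq> h"
    show "- (x - y) \<preceq> h + h - (x + y)" by (rule le_comb1[OF *, of 2]) (simp_all add: vec)
  qed
  finally show ?thesis .
qed

lemma ray_R [simp]: "f \<in> R \<Longrightarrow> g \<in> R \<Longrightarrow> ray t f g \<in> R"
  by (simp add: ray_def)

lemma ray_sup_R [simp]: "f \<in> R \<Longrightarrow> g \<in> R \<Longrightarrow> ray_sup m ts f g \<in> R"
  by (induction ts) (simp_all add: ray_sup_def)

lemma ray_sup_le_iff:
  "f \<in> R \<Longrightarrow> g \<in> R \<Longrightarrow> ray_sup m ts f g \<preceq> h \<longleftrightarrow> (\<forall>t\<in>set ts. ray t f g \<preceq> h) \<and> 0 \<preceq> h"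
proof (induction ts)
  case (Cons t ts)
  have "ray_sup m (t # ts) f g = vsup m (ray t f g) (ray_sup m ts f g)" by (simp add: ray_sup_def)
  thus ?case using Cons by (simp add: vsup_le_iff)
qed (simp add: ray_sup_def)

text \<open>The rays at 0 and pi are f and - f, so h dominates |f|.\<close>

lemma rays_le_pos: assumes "f \<in> R" "\<And>t. ray t f g \<preceq> h" shows "h \<in> pos"
proof -
  have "m f \<preceq> h" using assms(2)[of 0] assms(2)[of pi] by (intro m_le) (simp_all add: ray_def)
  moreover have "0 \<preceq> m f" using assms by (simp add: zero_le_iff R_S)
  ultimately show ?thesis using le_trans zero_le_iff by blast
qed

abbreviation \<sigma> where "\<sigma> n f g \<equiv> ray_sup m (grid n) f g"

lemma sigma_pos [simp]: "f \<in> R \<Longrightarrow> g \<in> R \<Longrightarrow> \<sigma> n f g \<in> pos"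
  using ray_sup_le_iff[of f g "grid n" "\<sigma> n f g"] by (simp add: zero_le_iff)

lemma sigma_le: "f \<in> R \<Longrightarrow> g \<in> R \<Longrightarrow> (\<And>t. ray t f g \<preceq> h) \<Longrightarrow> \<sigma> n f g \<preceq> h"
  using rays_le_pos[of f g h] by (simp add: ray_sup_le_iff zero_le_iff)

lemma ray_le_sigma_grid: "f \<in> R \<Longrightarrow> g \<in> R \<Longrightarrow> t \<in> set (grid n) \<Longrightarrow> ray t f g \<preceq> \<sigma> n f g"
  using ray_sup_le_iff[of f g "grid n" "\<sigma> n f g"] by simp

lemma scale_le_m: assumes "f \<in> R" "\<bar>r\<bar> \<le> e" shows "complex_of_real r *\<^sub>C f \<preceq> complex_of_real e *\<^sub>C m f"
proof -
  have "complex_of_real r *\<^sub>C f \<preceq> m (complex_of_real r *\<^sub>C f)" using assms by (intro le_m) simp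
  also have "\<dots> = complex_of_real \<bar>r\<bar> *\<^sub>C m f" using assms by (simp add: m_scale_real R_S)
  also have "\<dots> \<preceq> complex_of_real e *\<^sub>C m f" using assms by (intro le_scale_pos) (simp_all add: R_S)
  finally show ?thesis .
qed

lemma ray_le: assumes "f \<in> R" "g \<in> R" shows "ray t f g \<preceq> m f + m g"
proof -
  have "complex_of_real (cos t) *\<^sub>C f \<preceq> complex_of_real 1 *\<^sub>C m f"
    "complex_of_real (sin t) *\<^sub>C g \<preceq> complex_of_real 1 *\<^sub>C m g"
    using assms by (intro scale_le_m; simp)+
  thus ?thesis unfolding ray_def using le_add_mono by fastforce
qed

text \<open>Passing to a grid angle s near t changes the ray by (cos t - cos s) f + (sin t - sin s)
  g.\<close>

lemma ray_le_sigma: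
  assumes "f \<in> R" "g \<in> R"
  shows "ray t f g \<preceq> \<sigma> n f g + complex_of_real (1 / real (Suc n)) *\<^sub>C (m f + m g)"
proof -
  let ?e = "1 / real (Suc n)"
  obtain s where s: "s \<in> set (grid n)" "\<bar>cos t - cos s\<bar> \<le> ?e" "\<bar>sin t - sin s\<bar> \<le> ?e"
    using grid_near by blast
  have "complex_of_real (cos t - cos s) *\<^sub>C f + complex_of_real (sin t - sin s) *\<^sub>C g
      \<preceq> complex_of_real ?e *\<^sub>C m f + complex_of_real ?e *\<^sub>C m g"
    using assms s by (intro le_add_mono scale_le_m)
  with ray_le_sigma_grid[OF assms s(1)]
  have *: "ray s f g + (complex_of_real (cos t - cos s) *\<^sub>C f + complex_of_real (sin t - sin s) *\<^sub>C g)
      \<preceq> \<sigma> n f g + (complex_of_real ?e *\<^sub>C m f + complex_of_real ?e *\<^sub>C m g)"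
    by (rule le_add_mono)
  show ?thesis by (rule le_comb1[OF *, of 1]) (simp_all add: ray_def vec)
qed

lemma sigma_le_sigma:
  assumes "f \<in> R" "g \<in> R"
  shows "\<sigma> k f g \<preceq> \<sigma> n f g + complex_of_real (1 / real (Suc n)) *\<^sub>C (m f + m g)"
  using assms ray_le_sigma by (intro sigma_le)

lemma sigma_le_sum: "f \<in> R \<Longrightarrow> g \<in> R \<Longrightarrow> \<sigma> n f g \<preceq> m f + m g"
  using ray_le by (intro sigma_le)

lemma sigma_subadditive:
  assumes "f \<in> R" "g \<in> R" "f' \<in> R" "g' \<in> R"
  shows "\<sigma> n (f + f') (g + g') \<preceq> \<sigma> n f g + \<sigma> n f' g'"
proof -
  have "ray t (f + f') (g + g') \<preceq> \<sigma> n f g + \<sigma> n f' g'" if "t \<in> set (grid n)" for t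
    using le_add_mono[OF ray_le_sigma_grid[of f g t n] ray_le_sigma_grid[of f' g' t n]] assms that
    by (simp add: ray_add)
  thus ?thesis using assms by (simp add: ray_sup_le_iff zero_le_iff pos_add)
qed

lemma sigma_lipschitz:
  assumes "f \<in> R" "g \<in> R" "f' \<in> R" "g' \<in> R"
  shows "m (\<sigma> n f g - \<sigma> n f' g') \<preceq> m (f - f') + m (g - g')"
proof -
  have *: "\<sigma> n f g \<preceq> \<sigma> n f' g' + (m (f - f') + m (g - g'))"
    if "f \<in> R" "g \<in> R" "f' \<in> R" "g' \<in> R" for f g f' g'
  proof -
    have "\<sigma> n (f' + (f - f')) (g' + (g - g')) \<preceq> \<sigma> n f' g' + \<sigma> n (f - f') (g - g')"
      using that by (intro sigma_subadditive) simp_all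
    also have "\<dots> \<preceq> \<sigma> n f' g' + (m (f - f') + m (g - g'))"
      using that by (intro le_add_mono sigma_le_sum) simp_all
    finally show ?thesis by simp
  qed
  have "m (f' - f) = m (f - f')" "m (g' - g) = m (g - g')"
    using assms m_uminus[of "f - f'"] m_uminus[of "g - g'"] by (simp_all add: R_S)
  with *[OF assms] *[OF assms(3,4,1,2)] show ?thesis
    by (intro m_le) (simp_all add: le_def algebra_simps)
qed

text \<open>Exact because the angle 0 lies on every grid. Idempotence and axiom (2) for sequences
  rest on this equality.\<close>

lemma sigma_of_pos: assumes "f \<in> pos" shows "\<sigma> n f 0 = f"
proof (rule le_antisym)
  show "\<sigma> n f 0 \<preceq> f"
  proof (rule sigma_le)
    fix t
    show "ray t f 0 \<preceq> f" using ray_le[of f 0 t] assms by (simp add: m_eq)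
  qed (use assms in simp_all)
  have "0 \<in> set (grid n)" by (force simp: grid_def)
  thus "f \<preceq> \<sigma> n f 0" using ray_le_sigma_grid[of f 0 0 n] assms by (simp add: ray_def)
qed

text \<open>Only approximate: - f is the ray at pi, whereas the grid angles are rational.\<close>

lemma sigma_real_approx:
  assumes "f \<in> R" shows "m (\<sigma> n f 0 - m f) \<preceq> complex_of_real (1 / real (Suc n)) *\<^sub>C m f"
proof -
  have "\<sigma> n f 0 \<preceq> m f" using sigma_le_sum[of f 0 n] assms by simp
  moreover have "m f \<preceq> \<sigma> n f 0 + complex_of_real (1 / real (Suc n)) *\<^sub>C m f"
    using ray_le_sigma[of f 0 0 n] ray_le_sigma[of f 0 pi n] assms by (intro m_le) (simp_all add: ray_def)
  moreover have "complex_of_real (1 / real (Suc n)) *\<^sub>C m f \<in> pos" using assms by (intro pos_scale) (simp_all add: R_S)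
  hence "\<sigma> n f 0 - m f \<preceq> 0 \<Longrightarrow> \<sigma> n f 0 - m f \<preceq> complex_of_real (1 / real (Suc n)) *\<^sub>C m f"
    using zero_le_iff le_trans by blast
  ultimately show ?thesis
    by (intro m_le) (simp_all add: le_def algebra_simps)
qed

text \<open>The arguments are the real and imaginary part of c (f + i g), and multiplication by c
  scales by |c| and turns by \<open>Arg c\<close>.\<close>

lemma ray_rotate:
  "ray t (complex_of_real (Re c) *\<^sub>C f - complex_of_real (Im c) *\<^sub>C g)
         (complex_of_real (Im c) *\<^sub>C f + complex_of_real (Re c) *\<^sub>C g)
     = complex_of_real (norm c) *\<^sub>C ray (t - Arg c) f g"
proof -
  have c: "Re c = norm c * cos (Arg c)" "Im c = norm c * sin (Arg c)"
    by (metis Re_rcis rcis_cmod_Arg, metis Im_rcis rcis_cmod_Arg)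
  show ?thesis
    unfolding c ray_def cos_diff sin_diff by (simp add: vec)
qed

text \<open>\<open>f'\<close> and \<open>g'\<close> are the parts of c (f + i g). The grid is not
  invariant under the turn by \<open>Arg c\<close>, so each of the two inequalities costs one
  discretisation error.\<close>

lemma sigma_rotate:
  fixes c f g
  defines "f' \<equiv> complex_of_real (Re c) *\<^sub>C f - complex_of_real (Im c) *\<^sub>C g"
    and "g' \<equiv> complex_of_real (Im c) *\<^sub>C f + complex_of_real (Re c) *\<^sub>C g"
  assumes fg: "f \<in> R" "g \<in> R"
  shows "m (\<sigma> n f' g' - complex_of_real (norm c) *\<^sub>C \<sigma> n f g) \<preceq>
    complex_of_real (1 / real (Suc n)) *\<^sub>C (complex_of_real (norm c) *\<^sub>C (m f + m g) + (m f' + m g'))"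
proof -
  let ?c = "complex_of_real (norm c)" and ?e = "complex_of_real (1 / real (Suc n))"
  have fg': "f' \<in> R" "g' \<in> R" using fg by (simp_all add: f'_def g'_def)
  have p: "?e *\<^sub>C ?c *\<^sub>C (m f + m g) \<in> pos" "?e *\<^sub>C (m f' + m g') \<in> pos"
    using fg fg' by (auto intro!: pos_scale pos_add simp: R_S simp del: of_real_divide cscale_simps)
  have "\<sigma> n f' g' \<preceq> ?c *\<^sub>C \<sigma> n f g + ?e *\<^sub>C ?c *\<^sub>C (m f + m g)"
  proof (rule sigma_le[OF fg'])
    fix t
    show "ray t f' g' \<preceq> ?c *\<^sub>C \<sigma> n f g + ?e *\<^sub>C ?c *\<^sub>C (m f + m g)"
      unfolding f'_def g'_def ray_rotate
      by (rule le_comb1[OF ray_le_sigma[OF fg, of "t - Arg c" n], of "norm c"]) (simp_all add: vec add_divide_distrib)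
  qed
  hence 1: "\<sigma> n f' g' \<preceq> (?c *\<^sub>C \<sigma> n f g + ?e *\<^sub>C ?c *\<^sub>C (m f + m g)) + ?e *\<^sub>C (m f' + m g')"
    using p(2) by (rule le_add_pos)
  have "?c *\<^sub>C \<sigma> n f g \<preceq> \<sigma> n f' g' + ?e *\<^sub>C (m f' + m g')"
  \<comment> \<open>This direction rotates back and divides by |c|.\<close>
  proof (cases "c = 0")
    case True
    thus ?thesis using p(2) sigma_pos[OF fg', of n] by (simp add: zero_le_iff pos_add)
  next
    case False
    have "\<sigma> n f g \<preceq> complex_of_real (1 / norm c) *\<^sub>C (\<sigma> n f' g' + ?e *\<^sub>C (m f' + m g'))"
    proof (rule sigma_le[OF fg])
      fix t
      have *: "?c *\<^sub>C ray t f g \<preceq> \<sigma> n f' g' + ?e *\<^sub>C (m f' + m g')"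
        using ray_le_sigma[OF fg', of "t + Arg c" n] unfolding f'_def g'_def ray_rotate by simp
      have "complex_of_real (1 / norm c) *\<^sub>C ?c *\<^sub>C ray t f g \<preceq> complex_of_real (1 / norm c) *\<^sub>C (\<sigma> n f' g' + ?e *\<^sub>C (m f' + m g'))"
        by (rule le_scale_mono[OF *]) simp
      thus "ray t f g \<preceq> complex_of_real (1 / norm c) *\<^sub>C (\<sigma> n f' g' + ?e *\<^sub>C (m f' + m g'))"
        using False by simp
    qed
    hence "?c *\<^sub>C \<sigma> n f g \<preceq> ?c *\<^sub>C complex_of_real (1 / norm c) *\<^sub>C (\<sigma> n f' g' + ?e *\<^sub>C (m f' + m g'))"
      by (rule le_scale_mono) simp
    thus ?thesis using False by simp
  qed
  hence 2: "?c *\<^sub>C \<sigma> n f g \<preceq> (\<sigma> n f' g' + ?e *\<^sub>C (m f' + m g')) + ?e *\<^sub>C ?c *\<^sub>C (m f + m g)"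
    using p(1) by (rule le_add_pos)
  show ?thesis
  proof (rule m_le)
    show "\<sigma> n f' g' - ?c *\<^sub>C \<sigma> n f g \<preceq> ?e *\<^sub>C (?c *\<^sub>C (m f + m g) + (m f' + m g'))"
      by (rule le_comb1[OF 1, of 1]) (simp_all add: vec add_divide_distrib)
    show "- (\<sigma> n f' g' - ?c *\<^sub>C \<sigma> n f g) \<preceq> ?e *\<^sub>C (?c *\<^sub>C (m f + m g) + (m f' + m g'))"
      by (rule le_comb1[OF 2, of 1]) (simp_all add: vec add_divide_distrib)
  qed
qed

end

section \<open>The modulus over the complex numbers as a supremum\<close>

locale complex_modulus_structure = modulus_structure UNIV S m for S m +
  assumes R_decomp: "x \<in> S \<Longrightarrow> \<exists>f\<in>R. \<exists>g\<in>R. x = f + \<i> *\<^sub>C g"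
begin

lemma scale_S [simp]: "x \<in> S \<Longrightarrow> c *\<^sub>C x \<in> S"
  by (rule scale_mem) simp

lemma m_unit: "x \<in> S \<Longrightarrow> norm c = 1 \<Longrightarrow> m (c *\<^sub>C x) = m x"
  by (subst m_scale) simp_all

section \<open>Folding vectors into a narrow sector\<close>

lemma m_shift_imag:
  assumes "f \<in> R" "a \<in> R" "b \<in> R"
  shows "m (f + \<i> *\<^sub>C a) \<preceq> m (f + \<i> *\<^sub>C b) + m (a - b)"
proof -
  have "m ((f + \<i> *\<^sub>C b) + \<i> *\<^sub>C (a - b)) \<preceq> m (f + \<i> *\<^sub>C b) + m (\<i> *\<^sub>C (a - b))"
    using assms by (intro m_triangle) (simp_all add: R_S)
  moreover have "(f + \<i> *\<^sub>C b) + \<i> *\<^sub>C (a - b) = f + \<i> *\<^sub>C a" by (simp add: vec)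
  moreover have "m (\<i> *\<^sub>C (a - b)) = m (a - b)" using assms by (intro m_unit) (simp_all add: R_S)
  ultimately show ?thesis by simp
qed

text \<open>If g were positive or negative, f + i g would be one of f + i |g| and f - i |g|. In
  general \<open>le_by_cases\<close> admits the errors |g| - g and |g| + g, and these are exactly
  the moduli of the shifts from g to |g| and to - |g| in \<open>m_shift_imag\<close>.\<close>

lemma m_fold_cases:
  assumes f: "f \<in> R" and g: "g \<in> R"
  shows "m (f + \<i> *\<^sub>C m g) \<preceq> Y \<Longrightarrow> m (f - \<i> *\<^sub>C m g) \<preceq> Y \<Longrightarrow> m (f + \<i> *\<^sub>C g) \<preceq> Y"
    and "Y \<preceq> m (f + \<i> *\<^sub>C m g) \<Longrightarrow> Y \<preceq> m (f - \<i> *\<^sub>C m g) \<Longrightarrow> Y \<preceq> m (f + \<i> *\<^sub>C g)"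
proof -
  have gm: "m (m g - g) = m g - g" "m (m g + g) = m g + g"
    using le_m[OF g] uminus_le_m[OF g] by (simp_all add: m_eq le_def)
  have gm': "m (g - m g) = m g - g" "m (g + m g) = m g + g" "m (- m g - g) = m g + g"
    using gm m_uminus[of "m g - g"] m_uminus[of "m g + g"] g by (simp_all add: R_S add.commute minus_diff_commute[of "m g" g])
  have i: "\<i> *\<^sub>C (- m g) = - (\<i> *\<^sub>C m g)" by (simp add: vec)
  have mg: "m g \<in> R" using g by (simp add: R_S)
  note shift = m_shift_imag[OF f g mg] m_shift_imag[OF f g uminus_R[OF mg]]
     m_shift_imag[OF f mg g] m_shift_imag[OF f uminus_R[OF mg] g]
  note shift = shift[simplified, unfolded gm gm' i, simplified]
  show "m (f + \<i> *\<^sub>C g) \<preceq> Y" if "m (f + \<i> *\<^sub>C m g) \<preceq> Y" "m (f - \<i> *\<^sub>C m g) \<preceq> Y"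
  proof (rule le_by_cases[of _ _ g])
    show "m (f + \<i> *\<^sub>C g) \<preceq> Y + (m g - g)"
      by (rule le_trans[OF shift(1) le_add_mono[OF that(1) le_refl]])
    show "m (f + \<i> *\<^sub>C g) \<preceq> Y + (m g + g)"
      using le_trans[OF shift(2) le_add_mono[OF that(2) le_refl]] by (simp add: add.commute)
  qed
  show "Y \<preceq> m (f + \<i> *\<^sub>C g)" if "Y \<preceq> m (f + \<i> *\<^sub>C m g)" "Y \<preceq> m (f - \<i> *\<^sub>C m g)"
  proof (rule le_by_cases[of _ _ g])
    show "Y \<preceq> m (f + \<i> *\<^sub>C g) + (m g - g)" by (rule le_trans[OF that(1) shift(3)])
    show "Y \<preceq> m (f + \<i> *\<^sub>C g) + (m g + g)" using le_trans[OF that(2) shift(4)] by (simp add: add.commute)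
  qed
qed

end

text \<open>The bound 1/2 keeps the factor 2 - 1 / c of \<open>m_bounds\<close> nonnegative.\<close>

lemma half_le_cos: "1 / 2 \<le> cos (pi / 2 ^ (k + 2))"
proof -
  have "pi / 2 ^ (k + 2) \<le> pi / 3"
  proof (rule divide_left_mono)
    have "(1::real) \<le> 2 ^ k" by simp
    hence "3 \<le> 4 * (2::real) ^ k" by linarith
    thus "(3::real) \<le> 2 ^ (k + 2)" by simp
  qed auto
  hence "cos (pi / 3) \<le> cos (pi / 2 ^ (k + 2))" by (intro cos_monotone_0_pi_le) auto
  thus ?thesis by (simp add: cos_60)
qed

context complex_modulus_structure
begin

lemma m_fold_cases':
  assumes f: "f \<in> R" and g: "g \<in> R"
  shows "m (f + \<i> *\<^sub>C m g) \<preceq> Y \<Longrightarrow> m (f - \<i> *\<^sub>C m g) \<preceq> Y \<Longrightarrow> m (f - \<i> *\<^sub>C g) \<preceq> Y"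
    and "Y \<preceq> m (f + \<i> *\<^sub>C m g) \<Longrightarrow> Y \<preceq> m (f - \<i> *\<^sub>C m g) \<Longrightarrow> Y \<preceq> m (f - \<i> *\<^sub>C g)"
proof -
  have "m (- g) = m g" "\<i> *\<^sub>C (- g) = - (\<i> *\<^sub>C g)" using g by (simp_all add: m_uminus R_S vec)
  thus "m (f + \<i> *\<^sub>C m g) \<preceq> Y \<Longrightarrow> m (f - \<i> *\<^sub>C m g) \<preceq> Y \<Longrightarrow> m (f - \<i> *\<^sub>C g) \<preceq> Y"
    and "Y \<preceq> m (f + \<i> *\<^sub>C m g) \<Longrightarrow> Y \<preceq> m (f - \<i> *\<^sub>C m g) \<Longrightarrow> Y \<preceq> m (f - \<i> *\<^sub>C g)"
    using m_fold_cases[OF f uminus_R[OF g], of Y] by simp_all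
qed

text \<open>The ray with |g| exceeds the ray at t by sin t (|g| - g) and the ray at - t by sin t
  (|g| + g); both are within the errors that \<open>le_by_cases\<close> admits.\<close>

lemma ray_m_le:
  assumes g: "g \<in> R" and le: "\<And>t. ray t f g \<preceq> h"
  shows "ray t f (m g) \<preceq> h"
proof (rule le_by_cases[of _ _ g])
  have p: "0 \<preceq> m g - g" "0 \<preceq> m g + g"
    using le_m[OF g] uminus_le_m[OF g] by (simp_all add: le_def)
  show "ray t f (m g) \<preceq> h + (m g - g)"
    by (rule le_comb2[OF le[of t] p(1), of 1 "1 - sin t"]) (simp_all add: ray_def vec)
  show "ray t f (m g) \<preceq> h + (m g + g)"
    by (rule le_comb2[OF le[of "- t"] p(2), of 1 "1 - sin t"]) (simp_all add: ray_def vec)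
qed

text \<open>
  Folding: replace \<open>f + i g\<close> by \<open>f + i |g|\<close> and rotate by \<open>- pi / 2^(k+1)\<close>. After \<open>k\<close> steps the vector
  lies in the sector of half-angle \<open>pi / 2^k\<close> around the positive axis. By \<open>m_fold_cases\<close>, every bound
  for the moduli of the folded vector and of its conjugate is a bound for the original ones.
\<close>

lemma fold_bounds:
  assumes fg: "f \<in> R" "g \<in> R"
  shows "\<exists>f'\<in>R. \<exists>g'\<in>R.
    complex_of_real (cos (pi / 2 ^ k)) *\<^sub>C m g' \<preceq> complex_of_real (sin (pi / 2 ^ k)) *\<^sub>C f' \<and>
    (\<forall>Y. m (f' + \<i> *\<^sub>C g') \<preceq> Y \<longrightarrow> m (f' - \<i> *\<^sub>C g') \<preceq> Y \<longrightarrow>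
         m (f + \<i> *\<^sub>C g) \<preceq> Y \<and> m (f - \<i> *\<^sub>C g) \<preceq> Y) \<and>
    (\<forall>Y. Y \<preceq> m (f' + \<i> *\<^sub>C g') \<longrightarrow> Y \<preceq> m (f' - \<i> *\<^sub>C g') \<longrightarrow>
         Y \<preceq> m (f + \<i> *\<^sub>C g) \<and> Y \<preceq> m (f - \<i> *\<^sub>C g)) \<and>
    (\<forall>h. (\<forall>t. ray t f g \<preceq> h) \<longrightarrow> (\<forall>t. ray t f' g' \<preceq> h))"
proof (induction k)
  \<comment> \<open>For k = 0 the sector is the whole plane: cos pi = -1 and sin pi = 0 turn the
    condition into - |g| \<le> 0.\<close>
  case 0
  have "0 \<preceq> m g" using fg by (simp add: R_S zero_le_iff)
  hence "- m g \<preceq> 0" by (simp add: le_def)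
  moreover have "complex_of_real (cos (pi / 2 ^ 0)) *\<^sub>C m g = - m g" "complex_of_real (sin (pi / 2 ^ 0)) *\<^sub>C f = 0"
    by (simp_all add: fun_eq_iff)
  ultimately show ?case using fg by - (rule bexI[of _ f], rule bexI[of _ g], simp only:, blast+)
next
  case (Suc k)
  then obtain f' g' where f': "f' \<in> R" and g': "g' \<in> R"
    and inv: "complex_of_real (cos (pi / 2 ^ k)) *\<^sub>C m g' \<preceq> complex_of_real (sin (pi / 2 ^ k)) *\<^sub>C f'"
    and up: "\<And>Y. m (f' + \<i> *\<^sub>C g') \<preceq> Y \<Longrightarrow> m (f' - \<i> *\<^sub>C g') \<preceq> Y \<Longrightarrow>
         m (f + \<i> *\<^sub>C g) \<preceq> Y \<and> m (f - \<i> *\<^sub>C g) \<preceq> Y"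
    and lo: "\<And>Y. Y \<preceq> m (f' + \<i> *\<^sub>C g') \<Longrightarrow> Y \<preceq> m (f' - \<i> *\<^sub>C g') \<Longrightarrow>
         Y \<preceq> m (f + \<i> *\<^sub>C g) \<and> Y \<preceq> m (f - \<i> *\<^sub>C g)"
    and rays: "\<And>h t. (\<forall>t. ray t f g \<preceq> h) \<Longrightarrow> ray t f' g' \<preceq> h"
    by blast
  define d where "d = pi / 2 ^ Suc k"
  have d2: "pi / 2 ^ k = d + d" by (simp add: d_def)
  have "d \<le> pi / 2" using divide_left_mono[of 2 "2 ^ Suc k" pi] by (simp add: d_def)
  moreover have "0 \<le> d" by (simp add: d_def)
  ultimately have c: "0 \<le> cos d" by (intro cos_ge_zero) auto
  \<comment> \<open>The new vector \<open>f'' + i g''\<close> is \<open>f' + i |g'|\<close> rotated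
    by - d, with d half the previous angle.\<close>
  define f'' where "f'' = complex_of_real (cos d) *\<^sub>C f' + complex_of_real (sin d) *\<^sub>C m g'"
  define g'' where "g'' = complex_of_real (cos d) *\<^sub>C m g' - complex_of_real (sin d) *\<^sub>C f'"
  have R'': "f'' \<in> R" "g'' \<in> R" using f' g' by (simp_all add: f''_def g''_def R_S)
  have cs: "sin (complex_of_real d) * (sin (complex_of_real d) * z) = z - cos (complex_of_real d) * (cos (complex_of_real d) * z)" for z
    using sin_squared_eq[of "complex_of_real d"] by (simp add: power2_eq_square mult.assoc[symmetric] left_diff_distrib)
  have eq: "m (complex_of_real (cos d) *\<^sub>C g'') = complex_of_real (cos d) *\<^sub>C m g''"
    using m_scale_real[of g'' "cos d"] R'' c by (simp add: R_S)
  \<comment> \<open>The two edges of the new sector: sin d f'' - cos d g'' = sin (2 d) f' - cos (2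
    d) |g'| is positive by \<open>inv\<close>, and sin d f'' + cos d g'' = |g'|.\<close>
  have "m (complex_of_real (cos d) *\<^sub>C g'') \<preceq> complex_of_real (sin d) *\<^sub>C f''"
  proof (rule m_le)
    show "complex_of_real (cos d) *\<^sub>C g'' \<preceq> complex_of_real (sin d) *\<^sub>C f''"
      by (rule le_comb1[OF inv[unfolded d2 cos_add sin_add], of 1]) (simp_all add: f''_def g''_def vec)
    have "0 \<preceq> m g'" using g' by (simp add: zero_le_iff R_S)
    thus "- (complex_of_real (cos d) *\<^sub>C g'') \<preceq> complex_of_real (sin d) *\<^sub>C f''"
      by (rule le_comb1[of 0 "m g'" 1]) (simp_all add: f''_def g''_def vec cos_of_real[symmetric] sin_of_real[symmetric] cs)
  qed
  hence inv': "complex_of_real (cos d) *\<^sub>C m g'' \<preceq> complex_of_real (sin d) *\<^sub>C f''"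
    unfolding eq .
  have cis_eq: "cis t = complex_of_real (cos t) + \<i> * complex_of_real (sin t)" for t
    by (simp add: complex_eq_iff)
  have rot: "f'' + \<i> *\<^sub>C g'' = cis (- d) *\<^sub>C (f' + \<i> *\<^sub>C m g')" "f'' - \<i> *\<^sub>C g'' = cis d *\<^sub>C (f' - \<i> *\<^sub>C m g')"
    unfolding f''_def g''_def cis_eq by (simp_all add: vec)
  have m: "m (f'' + \<i> *\<^sub>C g'') = m (f' + \<i> *\<^sub>C m g')" "m (f'' - \<i> *\<^sub>C g'') = m (f' - \<i> *\<^sub>C m g')"
    unfolding rot using f' g' by (simp_all add: m_unit R_S)
  have "ray t f'' g'' = ray (t + d) f' (m g')" for t
    by (simp add: ray_def f''_def g''_def cos_add sin_add vec)
  hence rays': "ray t f'' g'' \<preceq> h" if "\<forall>t. ray t f g \<preceq> h" for t h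
    using ray_m_le[OF g' rays[OF that]] by simp
  show ?case
    using R'' inv' up lo rays' m_fold_cases[OF f' g'] m_fold_cases'[OF f' g']
    unfolding d_def[symmetric] by - (rule bexI[of _ f''], rule bexI[of _ g''], simp only: m, blast+)
qed

text \<open>\<open>p\<close> is the real part after k + 2 foldings. It is a ray of the folded
  vector, so it lies below every upper bound of the original rays; and in the narrow sector it
  agrees with the moduli up to factors that tend to 1 as k grows.\<close>

lemma m_bounds:
  fixes k :: nat
  assumes fg: "f \<in> R" "g \<in> R"
  defines "c \<equiv> cos (pi / 2 ^ (k + 2))"
  obtains p where "p \<in> R" "\<And>h. (\<And>t. ray t f g \<preceq> h) \<Longrightarrow> p \<preceq> h"
    and "complex_of_real c *\<^sub>C m (f + \<i> *\<^sub>C g) \<preceq> p" "complex_of_real c *\<^sub>C m (f - \<i> *\<^sub>C g) \<preceq> p"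
    and "complex_of_real (2 - 1 / c) *\<^sub>C p \<preceq> m (f + \<i> *\<^sub>C g)"
proof -
  define d where "d = pi / 2 ^ (k + 2)"
  define s where "s = sin d"
  have c_eq: "c = cos d" by (simp add: c_def d_def)
  have c: "1 / 2 \<le> c" unfolding c_def by (rule half_le_cos)
  have "(1::real) \<le> 2 ^ k" by simp
  hence "2 \<le> 4 * (2::real) ^ k" by linarith
  hence "d \<le> pi / 2" unfolding d_def by (intro divide_left_mono) auto
  moreover have "0 < d" by (simp add: d_def)
  ultimately have s: "0 < s" unfolding s_def using pi_gt_zero by (intro sin_gt_zero) linarith+
  obtain f' g' where f': "f' \<in> R" and g': "g' \<in> R"
    and inv: "complex_of_real c *\<^sub>C m g' \<preceq> complex_of_real s *\<^sub>C f'"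
    and up: "\<And>Y. m (f' + \<i> *\<^sub>C g') \<preceq> Y \<Longrightarrow> m (f' - \<i> *\<^sub>C g') \<preceq> Y \<Longrightarrow>
         m (f + \<i> *\<^sub>C g) \<preceq> Y \<and> m (f - \<i> *\<^sub>C g) \<preceq> Y"
    and lo: "\<And>Y. Y \<preceq> m (f' + \<i> *\<^sub>C g') \<Longrightarrow> Y \<preceq> m (f' - \<i> *\<^sub>C g') \<Longrightarrow>
         Y \<preceq> m (f + \<i> *\<^sub>C g) \<and> Y \<preceq> m (f - \<i> *\<^sub>C g)"
    and rays: "\<And>h. (\<And>t. ray t f g \<preceq> h) \<Longrightarrow> \<forall>t. ray t f' g' \<preceq> h"
    using fold_bounds[OF fg, of "k + 2"] unfolding c_def s_def d_def by metis
  have m_cg: "m (complex_of_real c *\<^sub>C g') = complex_of_real c *\<^sub>C m g'"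
    using m_scale_real[of g' c] c g' by (simp add: R_S)
  \<comment> \<open>In the narrow sector, \<open>f' + i g'\<close> is a combination of \<open>cis d\<close> and \<open>cis (- d)\<close> with the positive
    coefficients \<open>a\<close> and \<open>b\<close>, up to the factor \<open>sin (2 d)\<close>.\<close>
  define a b where "a = complex_of_real s *\<^sub>C f' + complex_of_real c *\<^sub>C g'"
    and "b = complex_of_real s *\<^sub>C f' - complex_of_real c *\<^sub>C g'"
  have le_cg: "complex_of_real c *\<^sub>C g' \<preceq> complex_of_real s *\<^sub>C f'" "- (complex_of_real c *\<^sub>C g') \<preceq> complex_of_real s *\<^sub>C f'"
    using inv le_m[of "complex_of_real c *\<^sub>C g'"] uminus_le_m[of "complex_of_real c *\<^sub>C g'"] g' le_trans
    unfolding m_cg by (blast intro: scale_R)+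
  hence ab: "a \<in> pos" "b \<in> pos" by (simp_all add: a_def b_def le_def)
  have f'_pos: "f' \<in> pos"
  proof -
    have "complex_of_real (1 / (2 * s)) *\<^sub>C (a + b) \<in> pos" using s ab by (intro pos_scale pos_add) auto
    moreover have "complex_of_real (1 / (2 * s)) *\<^sub>C (a + b) = f'" using s by (simp add: a_def b_def fun_eq_iff)
    ultimately show ?thesis by simp
  qed
  have cis_eq: "cis t = complex_of_real (cos t) + \<i> * complex_of_real (sin t)" for t
    by (simp add: complex_eq_iff)
  have key: "complex_of_real c *\<^sub>C m (f' + \<i> *\<^sub>C g'') \<preceq> f'"
    if "g'' \<in> R" "complex_of_real s *\<^sub>C f' + complex_of_real c *\<^sub>C g'' \<in> pos"
       "complex_of_real s *\<^sub>C f' - complex_of_real c *\<^sub>C g'' \<in> pos" for g''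
  proof -
    let ?a = "complex_of_real s *\<^sub>C f' + complex_of_real c *\<^sub>C g''"
    let ?b = "complex_of_real s *\<^sub>C f' - complex_of_real c *\<^sub>C g''"
    \<comment> \<open>By the triangle inequality the left-hand side has modulus at most
      \<open>?a\<close> + \<open>?b\<close>, which is 2 s f'; dividing by 2 s gives the
      claim.\<close>
    have eq: "cis d *\<^sub>C ?a + cis (- d) *\<^sub>C ?b = complex_of_real (2 * s * c) *\<^sub>C (f' + \<i> *\<^sub>C g'')"
      unfolding cis_eq by (simp add: s_def c_eq vec)
    have "m (cis d *\<^sub>C ?a + cis (- d) *\<^sub>C ?b) \<preceq> m (cis d *\<^sub>C ?a) + m (cis (- d) *\<^sub>C ?b)"
      using that by (intro m_triangle) (simp_all only: scale_S pos_S)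
    moreover have "m (cis d *\<^sub>C ?a) = ?a" "m (cis (- d) *\<^sub>C ?b) = ?b"
      using that by (simp_all only: m_unit pos_S norm_cis m_eq)
    moreover have "m (complex_of_real (2 * s * c) *\<^sub>C (f' + \<i> *\<^sub>C g'')) = complex_of_real (2 * s * c) *\<^sub>C m (f' + \<i> *\<^sub>C g'')"
      using m_scale_real[of "f' + \<i> *\<^sub>C g''" "2 * s * c"] s c f' that(1) by (simp add: R_S abs_mult)
    ultimately have *: "complex_of_real (2 * s * c) *\<^sub>C m (f' + \<i> *\<^sub>C g'') \<preceq> ?a + ?b"
      unfolding eq by simp
    have "complex_of_real (1 / (2 * s)) *\<^sub>C complex_of_real (2 * s * c) *\<^sub>C m (f' + \<i> *\<^sub>C g'')
        \<preceq> complex_of_real (1 / (2 * s)) *\<^sub>C (?a + ?b)"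
      using s by (intro le_scale_mono[OF *]) simp
    moreover have "complex_of_real (1 / (2 * s)) *\<^sub>C (?a + ?b) = f'"
      using s by (simp add: fun_eq_iff)
    ultimately show ?thesis using s by simp
  qed
  have key1: "complex_of_real c *\<^sub>C m (f' + \<i> *\<^sub>C g') \<preceq> f'"
    using ab g' by (intro key) (simp_all add: a_def b_def)
  have "complex_of_real c *\<^sub>C (- g') = - (complex_of_real c *\<^sub>C g')" "\<i> *\<^sub>C (- g') = - (\<i> *\<^sub>C g')"
    by (simp_all add: vec)
  hence key2: "complex_of_real c *\<^sub>C m (f' - \<i> *\<^sub>C g') \<preceq> f'"
    using key[of "- g'"] ab g' by (simp add: a_def b_def)
  define Y where "Y = complex_of_real (1 / c) *\<^sub>C f'"
  have c0: "c > 0" using c by simp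
  have scaled: "z \<preceq> Y" if "complex_of_real c *\<^sub>C z \<preceq> f'" for z
    using le_scale_mono[OF that, of "1 / c"] c0 by (simp add: Y_def)
  have scaled': "complex_of_real c *\<^sub>C z \<preceq> f'" if "z \<preceq> Y" for z
    using le_scale_mono[OF that, of c] c0 by (simp add: Y_def)
  have up': "m (f + \<i> *\<^sub>C g) \<preceq> Y \<and> m (f - \<i> *\<^sub>C g) \<preceq> Y"
    using up[OF scaled[OF key1] scaled[OF key2]] .
  \<comment> \<open>The lower bound comes from the conjugate: 2 f' is the sum of the folded vector
    and its conjugate, and each of these has modulus at most \<open>Y\<close>.\<close>
  have two: "(f' + \<i> *\<^sub>C g') + (f' - \<i> *\<^sub>C g') = complex_of_real 2 *\<^sub>C f'" by (simp add: vec)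
  have "m (complex_of_real 2 *\<^sub>C f') \<preceq> m (f' + \<i> *\<^sub>C g') + m (f' - \<i> *\<^sub>C g')"
    unfolding two[symmetric] using f' g' by (intro m_triangle) (simp_all add: R_S)
  hence two_le: "complex_of_real 2 *\<^sub>C f' \<preceq> m (f' + \<i> *\<^sub>C g') + m (f' - \<i> *\<^sub>C g')"
    using m_scale_real[of f' 2] f'_pos by (simp add: m_eq pos_S)
  have Y2: "complex_of_real (2 - 1 / c) *\<^sub>C f' = complex_of_real 2 *\<^sub>C f' - Y"
    by (simp add: Y_def vec)
  have lower: "complex_of_real (2 - 1 / c) *\<^sub>C f' \<preceq> m (f' + \<i> *\<^sub>C g')"
    "complex_of_real (2 - 1 / c) *\<^sub>C f' \<preceq> m (f' - \<i> *\<^sub>C g')"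
    unfolding Y2
    using le_add_mono[OF two_le scaled[OF key1]] le_add_mono[OF two_le scaled[OF key2]]
    by (simp_all add: le_def algebra_simps)
  show ?thesis
  proof (rule that[of f'])
    show "f' \<preceq> h" if "\<And>t. ray t f g \<preceq> h" for h
      using rays[OF that] by (metis ray_zero)
  qed (use f' lo lower up' scaled' in auto)
qed

end

section \<open>The limit of ever narrower sectors\<close>

lemma cos_pi_power_tendsto: "(\<lambda>k::nat. cos (pi / 2 ^ (k + 2))) \<longlonglongrightarrow> 1"
proof -
  have "(\<lambda>k. pi / 4 * (1 / 2) ^ k) \<longlonglongrightarrow> pi / 4 * 0"
    by (intro tendsto_mult tendsto_const LIMSEQ_power_zero) simp
  hence "(\<lambda>k. cos (pi / 4 * (1 / 2) ^ k)) \<longlonglongrightarrow> cos 0"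
    by (intro tendsto_cos) simp
  moreover have "pi / 2 ^ (k + 2) = pi / 4 * (1 / 2) ^ k" for k :: nat
    by (simp add: power_add power_one_over field_simps)
  ultimately show ?thesis by (simp only: cos_zero)
qed

context complex_modulus_structure
begin

lemma m_le_of_rays:
  assumes fg: "f \<in> R" "g \<in> R" and h: "\<And>t. ray t f g \<preceq> h"
  shows "m (f + \<i> *\<^sub>C g) \<preceq> h"
proof (rule arch_scale[OF _ _ _ cos_pi_power_tendsto])
  show "h \<in> R" using rays_le_pos[OF fg(1) h] by simp
  show "complex_of_real (cos (pi / 2 ^ (k + 2))) *\<^sub>C m (f + \<i> *\<^sub>C g) \<preceq> h" for k
  proof -
    obtain p where "\<And>h. (\<And>t. ray t f g \<preceq> h) \<Longrightarrow> p \<preceq> h"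
      "complex_of_real (cos (pi / 2 ^ (k + 2))) *\<^sub>C m (f + \<i> *\<^sub>C g) \<preceq> p"
      using m_bounds[OF fg] by blast
    thus ?thesis using h le_trans by blast
  qed
qed (use fg in \<open>simp add: R_S\<close>)

text \<open>No axiom mentions conjugation. The bounds in \<open>m_bounds\<close> share one
  \<open>p\<close>, and combining them gives (2 c - 1) |f - i g| \<le> |f + i g| with c tending to
  1.\<close>

lemma m_conj_le: assumes fg: "f \<in> R" "g \<in> R" shows "m (f - \<i> *\<^sub>C g) \<preceq> m (f + \<i> *\<^sub>C g)"
proof (rule arch_scale[where c = "\<lambda>k. 2 * cos (pi / 2 ^ (k + 2)) - 1"])
  show "(\<lambda>k. 2 * cos (pi / 2 ^ (k + 2)) - 1) \<longlonglongrightarrow> 1"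
    using tendsto_diff[OF tendsto_mult[OF tendsto_const[of 2] cos_pi_power_tendsto] tendsto_const[of 1]] by simp
  fix k :: nat
  define c where "c = cos (pi / 2 ^ (k + 2))"
  have c: "1 / 2 \<le> c" unfolding c_def by (rule half_le_cos)
  obtain p where 1: "complex_of_real c *\<^sub>C m (f - \<i> *\<^sub>C g) \<preceq> p"
    and 2: "complex_of_real (2 - 1 / c) *\<^sub>C p \<preceq> m (f + \<i> *\<^sub>C g)"
    using m_bounds[OF fg, of k] unfolding c_def by blast
  have "complex_of_real (2 - 1 / c) *\<^sub>C complex_of_real c *\<^sub>C m (f - \<i> *\<^sub>C g) \<preceq> complex_of_real (2 - 1 / c) *\<^sub>C p"
    using c by (intro le_scale_mono[OF 1]) (simp add: field_simps)
  also note 2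
  also have "complex_of_real (2 - 1 / c) *\<^sub>C complex_of_real c *\<^sub>C m (f - \<i> *\<^sub>C g)
      = complex_of_real (2 * c - 1) *\<^sub>C m (f - \<i> *\<^sub>C g)"
    using c by (simp add: left_diff_distrib)
  finally show "complex_of_real (2 * cos (pi / 2 ^ (k + 2)) - 1) *\<^sub>C m (f - \<i> *\<^sub>C g) \<preceq> m (f + \<i> *\<^sub>C g)"
    unfolding c_def .
qed (use fg in \<open>simp_all add: R_S\<close>)

text \<open>2 f is the sum of f + i g and its conjugate, whose modulus is no larger by
  \<open>m_conj_le\<close>.\<close>

lemma re_le_m: assumes fg: "f \<in> R" "g \<in> R" shows "f \<preceq> m (f + \<i> *\<^sub>C g)"
proof -
  have two: "(f + \<i> *\<^sub>C g) + (f - \<i> *\<^sub>C g) = complex_of_real 2 *\<^sub>C f" by (simp add: vec)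
  have "m (complex_of_real 2 *\<^sub>C f) \<preceq> m (f + \<i> *\<^sub>C g) + m (f - \<i> *\<^sub>C g)"
    unfolding two[symmetric] using fg by (intro m_triangle) (simp_all add: R_S)
  also have "\<dots> \<preceq> m (f + \<i> *\<^sub>C g) + m (f + \<i> *\<^sub>C g)"
    using m_conj_le[OF fg] by (intro le_add_mono) simp_all
  finally have "m (complex_of_real 2 *\<^sub>C f) \<preceq> m (f + \<i> *\<^sub>C g) + m (f + \<i> *\<^sub>C g)" .
  hence *: "complex_of_real 2 *\<^sub>C m f \<preceq> m (f + \<i> *\<^sub>C g) + m (f + \<i> *\<^sub>C g)"
    using m_scale_real[of f 2] fg by (simp add: R_S)
  have "m f \<preceq> m (f + \<i> *\<^sub>C g)"
    by (rule le_comb1[OF *, of "1/2"]) (simp_all add: vec)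
  thus ?thesis using le_m[OF fg(1)] le_trans by blast
qed

text \<open>The ray is the real part of a unit multiple of f + i g, which has the same modulus.
  Together with \<open>m_le_of_rays\<close> this makes |f + i g| the supremum of the rays.\<close>

lemma ray_le_m: assumes fg: "f \<in> R" "g \<in> R" shows "ray t f g \<preceq> m (f + \<i> *\<^sub>C g)"
proof -
  have cis_eq: "cis (- t) = complex_of_real (cos t) - \<i> * complex_of_real (sin t)"
    by (simp add: complex_eq_iff)
  have "cis (- t) *\<^sub>C (f + \<i> *\<^sub>C g) = ray t f g + \<i> *\<^sub>C ray (t + pi / 2) f g"
    unfolding cis_eq ray_def cos_add sin_add by (simp add: vec)
  hence "m (f + \<i> *\<^sub>C g) = m (ray t f g + \<i> *\<^sub>C ray (t + pi / 2) f g)"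
    using m_unit[of "f + \<i> *\<^sub>C g" "cis (- t)"] fg by (simp add: R_S)
  thus ?thesis using re_le_m[of "ray t f g" "ray (t + pi / 2) f g"] fg by simp
qed

lemma sigma_approx:
  assumes fg: "f \<in> R" "g \<in> R"
  shows "m (m (f + \<i> *\<^sub>C g) - \<sigma> n f g) \<preceq> complex_of_real (1 / real (Suc n)) *\<^sub>C (m f + m g)"
proof -
  have 1: "\<sigma> n f g \<preceq> m (f + \<i> *\<^sub>C g)" using ray_le_m[OF fg] by (intro sigma_le fg)
  have 2: "m (f + \<i> *\<^sub>C g) \<preceq> \<sigma> n f g + complex_of_real (1 / real (Suc n)) *\<^sub>C (m f + m g)"
    using ray_le_sigma[OF fg] by (intro m_le_of_rays fg)
  have eq: "m (m (f + \<i> *\<^sub>C g) - \<sigma> n f g) = m (f + \<i> *\<^sub>C g) - \<sigma> n f g"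
    using 1 by (simp add: le_def m_eq)
  show ?thesis unfolding eq using 2 by (simp add: le_def algebra_simps)
qed

end

section \<open>Embedding modules into function spaces\<close>

lemma ring_of_type_algebra_simps [simp]:
  "carrier (ring_of_type_algebra :: 'k :: comm_ring_1 ring) = UNIV"
  "add (ring_of_type_algebra :: 'k ring) = (+)"
  "monoid.mult (ring_of_type_algebra :: 'k ring) = (*)"
  "one (ring_of_type_algebra :: 'k ring) = 1"
  "zero (ring_of_type_algebra :: 'k ring) = 0"
  by (simp_all add: ring_of_type_algebra_def)

section \<open>Modules as quotients of free vector spaces\<close>

definition point :: "'a \<Rightarrow> 'a \<Rightarrow> 'k :: zero_neq_one"
  where "point v = (\<lambda>i. if i = v then 1 else 0)"

lemma vector_space_fun: "vector_space (\<lambda>(c :: 'k :: field) w i. c * w i)"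
  by standard (simp_all add: fun_eq_iff algebra_simps)

locale type_module = Module.module "ring_of_type_algebra :: 'k ring" E
  for E :: "('k :: field, 'a, 'z) module_scheme" (structure)
begin

definition supp :: "('a \<Rightarrow> 'k) \<Rightarrow> 'a set" where "supp w = {v. w v \<noteq> 0}"

definition comb :: "('a \<Rightarrow> 'k) \<Rightarrow> 'a" where "comb w = (\<Oplus>\<^bsub>E\<^esub>v\<in>supp w. w v \<odot>\<^bsub>E\<^esub> v)"

text \<open>The free vector space on \<open>B\<close>; \<open>comb\<close> evaluates its formal
  combinations in the module.\<close>

definition fins :: "'a set \<Rightarrow> ('a \<Rightarrow> 'k) set" where "fins B = {w. finite (supp w) \<and> supp w \<subseteq> B}"

lemma comb_superset:
  assumes "finite A" "A \<subseteq> carrier E" "supp w \<subseteq> A"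
  shows "comb w = (\<Oplus>\<^bsub>E\<^esub>v\<in>A. w v \<odot>\<^bsub>E\<^esub> v)"
  unfolding comb_def
proof (rule M.add.finprod_mono_neutral_cong_left)
  show "w i \<odot>\<^bsub>E\<^esub> i = \<zero>\<^bsub>E\<^esub>" if "i \<in> A - supp w" for i
    using that assms smult_l_null[of i] by (auto simp: supp_def)
qed (use assms in auto)

lemma comb_add:
  assumes "w \<in> fins (carrier E)" "z \<in> fins (carrier E)"
  shows "comb (w + z) = comb w \<oplus>\<^bsub>E\<^esub> comb z"
proof -
  let ?A = "supp w \<union> supp z"
  have A: "finite ?A" "?A \<subseteq> carrier E" using assms by (auto simp: fins_def)
  have "comb (w + z) = (\<Oplus>\<^bsub>E\<^esub>v\<in>?A. (w + z) v \<odot>\<^bsub>E\<^esub> v)"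
    using A by (intro comb_superset) (auto simp: supp_def)
  also have "\<dots> = (\<Oplus>\<^bsub>E\<^esub>v\<in>?A. w v \<odot>\<^bsub>E\<^esub> v \<oplus>\<^bsub>E\<^esub> z v \<odot>\<^bsub>E\<^esub> v)"
  proof (rule M.add.finprod_cong')
    show "(w + z) i \<odot>\<^bsub>E\<^esub> i = w i \<odot>\<^bsub>E\<^esub> i \<oplus>\<^bsub>E\<^esub> z i \<odot>\<^bsub>E\<^esub> i" if "i \<in> ?A" for i
      using smult_l_distr[of "w i" "z i" i] that A by auto
  qed (use A in auto)
  also have "\<dots> = (\<Oplus>\<^bsub>E\<^esub>v\<in>?A. w v \<odot>\<^bsub>E\<^esub> v) \<oplus>\<^bsub>E\<^esub> (\<Oplus>\<^bsub>E\<^esub>v\<in>?A. z v \<odot>\<^bsub>E\<^esub> v)"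
    using A by (intro M.finsum_addf) auto
  also have "\<dots> = comb w \<oplus>\<^bsub>E\<^esub> comb z"
    using A comb_superset[of ?A w] comb_superset[of ?A z] by simp
  finally show ?thesis .
qed

lemma comb_scale:
  assumes "w \<in> fins (carrier E)"
  shows "comb (\<lambda>i. c * w i) = c \<odot>\<^bsub>E\<^esub> comb w"
proof -
  have A: "finite (supp w)" "supp w \<subseteq> carrier E" using assms by (auto simp: fins_def)
  have "comb (\<lambda>i. c * w i) = (\<Oplus>\<^bsub>E\<^esub>v\<in>supp w. (c * w v) \<odot>\<^bsub>E\<^esub> v)"
    using A by (intro comb_superset) (auto simp: supp_def)
  also have "\<dots> = (\<Oplus>\<^bsub>E\<^esub>v\<in>supp w. c \<odot>\<^bsub>E\<^esub> (w v \<odot>\<^bsub>E\<^esub> v))"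
  proof (rule M.add.finprod_cong')
    show "(c * w i) \<odot>\<^bsub>E\<^esub> i = c \<odot>\<^bsub>E\<^esub> (w i \<odot>\<^bsub>E\<^esub> i)" if "i \<in> supp w" for i
      using smult_assoc1[of c "w i" i] that A by auto
  qed (use A in auto)
  also have "\<dots> = c \<odot>\<^bsub>E\<^esub> comb w"
    unfolding comb_def using A by (intro finsum_smult_ldistr[symmetric]) auto
  finally show ?thesis .
qed

lemma comb_point: "v \<in> carrier E \<Longrightarrow> comb (point v) = v"
proof -
  assume v: "v \<in> carrier E"
  have "comb (point v) = (\<Oplus>\<^bsub>E\<^esub>i\<in>{v}. point v i \<odot>\<^bsub>E\<^esub> i)"
    using v by (intro comb_superset) (auto simp: supp_def point_def)
  thus ?thesis using v smult_one[of v] by (simp add: point_def)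
qed

lemma fins_zero: "0 \<in> fins B"
  by (simp add: fins_def supp_def)

lemma fins_supp_subset:
  assumes "w \<in> fins B" "z \<in> fins B" "supp y \<subseteq> supp w \<union> supp z" shows "y \<in> fins B"
  using assms finite_subset[of "supp y" "supp w \<union> supp z"] by (auto simp: fins_def)

lemma fins_add: "w \<in> fins B \<Longrightarrow> z \<in> fins B \<Longrightarrow> w + z \<in> fins B"
  by (rule fins_supp_subset[of w B z]) (auto simp: supp_def)

lemma fins_diff: "w \<in> fins B \<Longrightarrow> z \<in> fins B \<Longrightarrow> w - z \<in> fins B"
  by (rule fins_supp_subset[of w B z]) (auto simp: supp_def)

lemma fins_scale: "w \<in> fins B \<Longrightarrow> (\<lambda>i. c * w i) \<in> fins B"
  by (rule fins_supp_subset[of w B w]) (auto simp: supp_def)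

lemma fins_point: "v \<in> B \<Longrightarrow> point v \<in> fins B"
  by (auto simp: fins_def supp_def point_def)

lemma comb_closed: "w \<in> fins (carrier E) \<Longrightarrow> comb w \<in> carrier E"
  unfolding comb_def fins_def by (intro M.finsum_closed) auto

lemma comb_zero: "comb 0 = \<zero>\<^bsub>E\<^esub>"
  by (simp add: comb_def supp_def)

text \<open>
  The module is the quotient of the free vector space on its carrier by the relations \<open>N\<close>; a linear
  projection with kernel \<open>N\<close> realises the quotient inside the free vector space.
\<close>

lemma embedding:
  obtains \<iota> :: "'a \<Rightarrow> 'a \<Rightarrow> 'k" where "inj_on \<iota> (carrier E)"
    and "\<And>v w. v \<in> carrier E \<Longrightarrow> w \<in> carrier E \<Longrightarrow> \<iota> (v \<oplus>\<^bsub>E\<^esub> w) = \<iota> v + \<iota> w"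
    and "\<And>c v. v \<in> carrier E \<Longrightarrow> \<iota> (c \<odot>\<^bsub>E\<^esub> v) = (\<lambda>i. c * \<iota> v i)"
proof -
  interpret V: vector_space "\<lambda>(c :: 'k) (w :: 'a \<Rightarrow> 'k) i. c * w i" by (rule vector_space_fun)
  interpret P: vector_space_pair "\<lambda>(c :: 'k) (w :: 'a \<Rightarrow> 'k) i. c * w i" "\<lambda>(c :: 'k) (w :: 'a \<Rightarrow> 'k) i. c * w i" ..
  define N where "N = {w \<in> fins (carrier E). comb w = \<zero>\<^bsub>E\<^esub>}"
  have N: "V.subspace N"
    unfolding V.subspace_def N_def
    by (auto simp: fins_zero fins_add fins_scale comb_zero comb_add comb_scale)
  obtain B where B: "B \<subseteq> N" "V.independent B" "N \<subseteq> V.span B"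
    using V.maximal_independent_subset[of N] by blast
  have spanB: "V.span B = N" using B N V.span_minimal[of B N] by blast
  define B' where "B' = V.extend_basis B"
  have B': "B \<subseteq> B'" "V.independent B'" "V.span B' = UNIV"
    unfolding B'_def using V.extend_basis_superset[OF B(2)] V.independent_extend_basis[OF B(2)] V.span_extend_basis[OF B(2)] by auto
  \<comment> \<open>\<open>q\<close> kills a basis of \<open>N\<close> and fixes the remaining
    members of a basis of the whole space, so its kernel is exactly \<open>N\<close>.\<close>
  define q where "q = P.construct B' (\<lambda>b. if b \<in> B then 0 else b)"
  have lin: "Vector_Spaces.linear (\<lambda>(c :: 'k) (w :: 'a \<Rightarrow> 'k) i. c * w i) (\<lambda>(c :: 'k) (w :: 'a \<Rightarrow> 'k) i. c * w i) q"
    unfolding q_def by (rule P.linear_construct[OF B'(2)])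
  have qB: "q b = 0" if "b \<in> B" for b
    using P.construct_basis[OF B'(2), of b "\<lambda>b. if b \<in> B then 0 else b"] that B'(1) by (auto simp: q_def)
  have qB': "q b = b" if "b \<in> B' - B" for b
    using P.construct_basis[OF B'(2), of b "\<lambda>b. if b \<in> B then 0 else b"] that by (auto simp: q_def)
  have q0: "q w = 0" if "w \<in> N" for w
    using P.linear_eq_0_on_span[OF lin qB] that spanB by blast
  have qN: "w \<in> N" if "q w = 0" for w
  proof -
    have "w \<in> V.span (B \<union> (B' - B))" using B' by (simp add: Un_absorb1)
    then obtain x y where w: "w = x + y" and x: "x \<in> V.span B" and y: "y \<in> V.span (B' - B)"
      unfolding V.span_Un by auto
    have "q y = id y" using P.linear_eq_on[OF lin V.linear_id y] qB' by auto
    moreover have "q w = q x + q y" unfolding w by (rule P.linear_add[OF lin])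
    ultimately have "y = 0" using that q0[of x] x spanB by simp
    thus ?thesis using w x spanB by simp
  qed
  \<comment> \<open>\<open>point\<close> is not linear, but \<open>q\<close> identifies formal
    combinations with the same value in the module, so the composite is.\<close>
  define \<iota> where "\<iota> v = q (point v)" for v
  have pf: "point v \<in> fins (carrier E)" if "v \<in> carrier E" for v using that by (rule fins_point)
  have q_eq_iff: "q w = q z \<longleftrightarrow> comb w = comb z" if wz: "w \<in> fins (carrier E)" "z \<in> fins (carrier E)" for w z
  proof -
    have "comb w = comb (w - z) \<oplus>\<^bsub>E\<^esub> comb z" using comb_add[OF fins_diff[OF wz] wz(2)] by simp
    hence *: "comb w = comb z \<longleftrightarrow> comb (w - z) = \<zero>\<^bsub>E\<^esub>"
      using comb_closed[OF fins_diff[OF wz]] comb_closed[OF wz(2)] by (simp add: M.add.l_cancel_one)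
    have "q (w - z) = q w - q z" by (rule P.linear_diff[OF lin])
    hence "q w = q z \<longleftrightarrow> w - z \<in> N" using q0[of "w - z"] qN[of "w - z"] by auto
    thus ?thesis using * fins_diff[OF wz] by (simp add: N_def)
  qed
  show ?thesis
  proof (rule that[of \<iota>])
    show "inj_on \<iota> (carrier E)"
      by (rule inj_onI) (simp add: \<iota>_def q_eq_iff pf comb_point)
    fix v assume v: "v \<in> carrier E"
    show "\<iota> (v \<oplus>\<^bsub>E\<^esub> w) = \<iota> v + \<iota> w" if w: "w \<in> carrier E" for w
    proof -
      have "\<iota> (v \<oplus>\<^bsub>E\<^esub> w) = q (point v + point w)"
        unfolding \<iota>_def using v w by (subst q_eq_iff) (simp_all add: pf fins_add comb_add comb_point)
      thus ?thesis unfolding \<iota>_def by (simp add: P.linear_add[OF lin])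
    qed
    show "\<iota> (c \<odot>\<^bsub>E\<^esub> v) = (\<lambda>i. c * \<iota> v i)" for c
    proof -
      have "\<iota> (c \<odot>\<^bsub>E\<^esub> v) = q (\<lambda>i. c * point v i)"
        unfolding \<iota>_def using v by (subst q_eq_iff) (simp_all add: pf fins_scale comb_scale comb_point)
      thus ?thesis unfolding \<iota>_def using P.linear_scale[OF lin, of c "point v"] by simp
    qed
  qed
qed

lemma linear_hull_eq: assumes "B \<subseteq> carrier E" shows "linear_hull E B = comb ` fins B"
proof (intro equalityI subsetI)
  fix x assume "x \<in> linear_hull E B"
  then obtain c A where A: "finite A" "A \<subseteq> B" and x: "x = (\<Oplus>\<^bsub>E\<^esub>v\<in>A. c v \<odot>\<^bsub>E\<^esub> v)"
    by (auto simp: linear_hull_def)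
  define w where "w v = (if v \<in> A then c v else 0)" for v
  have "comb w = (\<Oplus>\<^bsub>E\<^esub>v\<in>A. w v \<odot>\<^bsub>E\<^esub> v)"
    using A assms by (intro comb_superset) (auto simp: supp_def w_def)
  also have "\<dots> = x"
    unfolding x by (rule M.add.finprod_cong') (use A assms in \<open>auto simp: w_def\<close>)
  finally have "x = comb w" ..
  moreover have "w \<in> fins B" using A by (auto simp: fins_def supp_def w_def intro: finite_subset[of _ A])
  ultimately show "x \<in> comb ` fins B" by blast
next
  fix x assume "x \<in> comb ` fins B"
  then obtain w where "w \<in> fins B" "x = comb w" by blast
  thus "x \<in> linear_hull E B" unfolding linear_hull_def comb_def fins_def by blast
qed

lemma linear_hull_superset: "B \<subseteq> carrier E \<Longrightarrow> v \<in> B \<Longrightarrow> v \<in> linear_hull E B"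
  using comb_point[of v] fins_point[of v B] by (force simp: linear_hull_eq)

lemma linear_hull_add:
  assumes "B \<subseteq> carrier E" "v \<in> linear_hull E B" "w \<in> linear_hull E B"
  shows "v \<oplus>\<^bsub>E\<^esub> w \<in> linear_hull E B"
proof -
  obtain x y where xy: "v = comb x" "w = comb y" "x \<in> fins B" "y \<in> fins B"
    using assms by (auto simp: linear_hull_eq)
  hence "x \<in> fins (carrier E)" "y \<in> fins (carrier E)" using assms(1) by (auto simp: fins_def)
  hence "v \<oplus>\<^bsub>E\<^esub> w = comb (x + y)" using xy by (simp add: comb_add)
  thus ?thesis using assms(1) xy by (simp add: linear_hull_eq fins_add)
qed

lemma linear_hull_scale:
  assumes "B \<subseteq> carrier E" "v \<in> linear_hull E B" shows "c \<odot>\<^bsub>E\<^esub> v \<in> linear_hull E B"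
proof -
  obtain x where x: "v = comb x" "x \<in> fins B"
    using assms by (auto simp: linear_hull_eq)
  hence "x \<in> fins (carrier E)" using assms(1) by (auto simp: fins_def)
  hence "c \<odot>\<^bsub>E\<^esub> v = comb (\<lambda>i. c * x i)" using x by (simp add: comb_scale)
  thus ?thesis using assms(1) x by (simp add: linear_hull_eq fins_scale)
qed

lemma linear_hull_minimal:
  assumes "B \<subseteq> carrier E" and zero: "\<zero>\<^bsub>E\<^esub> \<in> Q"
    and add: "\<And>x y. x \<in> Q \<Longrightarrow> y \<in> Q \<Longrightarrow> x \<oplus>\<^bsub>E\<^esub> y \<in> Q"
    and scale: "\<And>c v. v \<in> B \<Longrightarrow> c \<odot>\<^bsub>E\<^esub> v \<in> Q"
  shows "linear_hull E B \<subseteq> Q"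
proof
  fix x assume "x \<in> linear_hull E B"
  then obtain c A where A: "finite A" "A \<subseteq> B" and x: "x = (\<Oplus>\<^bsub>E\<^esub>v\<in>A. c v \<odot>\<^bsub>E\<^esub> v)"
    by (auto simp: linear_hull_def)
  from A have "(\<Oplus>\<^bsub>E\<^esub>v\<in>A. c v \<odot>\<^bsub>E\<^esub> v) \<in> Q"
  proof (induction A)
    case (insert v A)
    have "(\<Oplus>\<^bsub>E\<^esub>v\<in>insert v A. c v \<odot>\<^bsub>E\<^esub> v) = c v \<odot>\<^bsub>E\<^esub> v \<oplus>\<^bsub>E\<^esub> (\<Oplus>\<^bsub>E\<^esub>v\<in>A. c v \<odot>\<^bsub>E\<^esub> v)"
      using insert assms(1) by (intro M.finsum_insert) auto
    thus ?case using insert add scale by auto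
  qed (simp add: zero)
  thus "x \<in> Q" by (simp add: x)
qed

end

text \<open>\<open>\<kappa>\<close> is the inclusion of the scalars in the complex numbers:
  \<open>complex_of_real\<close> in one case, the identity in the other.\<close>

locale embedded_lattice = archimedean_vector_lattice E
  for E :: "('k :: real_normed_field, 'a) modulus_space" (structure) +
  fixes \<iota> :: "'a \<Rightarrow> 'i \<Rightarrow> complex" and \<kappa> :: "'k \<Rightarrow> complex"
  assumes inj: "inj_on \<iota> (carrier E)"
    and iota_add: "\<And>v w. v \<in> carrier E \<Longrightarrow> w \<in> carrier E \<Longrightarrow> \<iota> (v \<oplus> w) = \<iota> v + \<iota> w"
    and iota_scale: "\<And>c v. v \<in> carrier E \<Longrightarrow> \<iota> (c \<odot> v) = \<kappa> c *\<^sub>C \<iota> v"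
    and kappa_real: "\<And>r. \<kappa> (of_real r) = of_real r"
    and kappa_norm: "\<And>c. norm (\<kappa> c) = norm c"
begin

sublocale T: type_module E
  by unfold_locales

definition S where "S = \<iota> ` carrier E"

definition im :: "('i \<Rightarrow> complex) \<Rightarrow> 'i \<Rightarrow> complex" where
  "im x = \<iota> (modulus E (the_inv_into (carrier E) \<iota> x))"

lemma im_iota: "v \<in> carrier E \<Longrightarrow> im (\<iota> v) = \<iota> (modulus E v)"
  by (simp add: im_def the_inv_into_f_f[OF inj])

lemma iota_S [simp]: "v \<in> carrier E \<Longrightarrow> \<iota> v \<in> S"
  by (simp add: S_def)

lemma iota_eq_iff: "v \<in> carrier E \<Longrightarrow> w \<in> carrier E \<Longrightarrow> \<iota> v = \<iota> w \<longleftrightarrow> v = w"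
  using inj by (auto dest: inj_onD)

lemma iota_zero: "\<iota> \<zero> = 0"
  using iota_add[of \<zero> \<zero>] by simp

lemma iota_minus: assumes "v \<in> carrier E" "w \<in> carrier E" shows "\<iota> (v \<ominus> w) = \<iota> v - \<iota> w"
proof -
  have "\<iota> (v \<ominus> w) + \<iota> w = \<iota> (v \<ominus> w \<oplus> w)" using assms by (subst iota_add) auto
  also have "v \<ominus> w \<oplus> w = v" using assms by (simp add: M.minus_eq M.a_assoc M.l_neg)
  finally show ?thesis by (simp only: eq_diff_eq)
qed

lemma kappa_nat: "\<kappa> (of_nat n) = of_nat n"
  using kappa_real[of "real n"] by simp

sublocale modulus_structure "range \<kappa>" S im
proof
  show "\<real> \<subseteq> range \<kappa>"
  proof
    fix z :: complex assume "z \<in> \<real>"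
    then obtain r where "z = of_real r" by (auto elim: Reals_cases)
    thus "z \<in> range \<kappa>" using kappa_real[of r] by (metis rangeI)
  qed
  show "0 \<in> S" using iota_S[of \<zero>] by (simp add: iota_zero)
  fix x assume "x \<in> S"
  then obtain v where x: "x = \<iota> v" and v: "v \<in> carrier E" by (auto simp: S_def)
  have mv: "modulus E v \<in> carrier E" using v by (rule modulus_closed)
  show "im x \<in> S" "im (im x) = im x"
    using v mv by (simp_all add: x im_iota modulus_idem)
  show "c *\<^sub>C x \<in> S" "im (c *\<^sub>C x) = complex_of_real (cmod c) *\<^sub>C im x" if cK: "c \<in> range \<kappa>" for c
  proof -
    obtain d where c: "c = \<kappa> d" using cK by auto
    have "c *\<^sub>C x = \<iota> (d \<odot> v)" using v by (simp add: iota_scale x c)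
    moreover have "d \<odot> v \<in> carrier E" using v by simp
    ultimately show "c *\<^sub>C x \<in> S" by simp
    have "im (c *\<^sub>C x) = \<iota> (modulus E (d \<odot> v))" using \<open>c *\<^sub>C x = _\<close> \<open>d \<odot> v \<in> _\<close> by (simp add: im_iota)
    thus "im (c *\<^sub>C x) = complex_of_real (cmod c) *\<^sub>C im x"
      using v mv by (simp add: modulus_smult iota_scale x im_iota kappa_real kappa_norm c)
  qed
  fix y assume "y \<in> S"
  then obtain w where y: "y = \<iota> w" and w: "w \<in> carrier E" by (auto simp: S_def)
  have mw: "modulus E w \<in> carrier E" using w by (rule modulus_closed)
  have xy: "x + y = \<iota> (v \<oplus> w)" using v w by (simp add: x y iota_add)
  show "x + y \<in> S" using v w by (simp add: xy)
  have mm: "modulus E (modulus E v \<oplus> modulus E w) \<in> carrier E" "modulus E (v \<oplus> w) \<in> carrier E"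
    using v w mv mw by (simp_all add: modulus_closed)
  show "im (im (im x + im y) - im (x + y)) = im x + im y - im (x + y)"
    using modulus_add[OF v w] v w mv mw mm
    by (simp add: x y im_iota iota_add[symmetric] iota_minus[symmetric])
  assume *: "\<And>n::nat. im (im y - of_nat n *\<^sub>C im x) = im y - of_nat n *\<^sub>C im x"
  have "v = \<zero>"
  proof (rule modulus_archimedean[OF v w])
    fix n :: nat
    have nv: "of_nat n \<odot> modulus E v \<in> carrier E" "modulus E w \<ominus> of_nat n \<odot> modulus E v \<in> carrier E"
      using mv mw by simp_all
    have "im y - of_nat n *\<^sub>C im x = \<iota> (modulus E w \<ominus> of_nat n \<odot> modulus E v)"
      using v w mv mw nv by (simp add: x y im_iota iota_minus iota_scale kappa_nat)
    with *[of n] nv show "modulus E (modulus E w \<ominus> of_nat n \<odot> modulus E v) = modulus E w \<ominus> of_nat n \<odot> modulus E v"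
      by (simp add: im_iota iota_eq_iff modulus_closed)
  qed
  thus "x = 0" by (simp add: x iota_zero)
qed

lemma iota_pos_iff: "v \<in> carrier E \<Longrightarrow> \<iota> v \<in> pos \<longleftrightarrow> v \<in> positive_cone E"
  by (simp add: pos_def positive_cone_def im_iota iota_eq_iff modulus_closed)

lemma pos_eq: "pos = \<iota> ` positive_cone E"
proof (intro equalityI subsetI)
  fix x assume x: "x \<in> pos"
  then obtain v where v: "v \<in> carrier E" "x = \<iota> v" using pos_S by (auto simp: S_def)
  thus "x \<in> \<iota> ` positive_cone E" using x iota_pos_iff by blast
next
  fix x assume "x \<in> \<iota> ` positive_cone E"
  thus "x \<in> pos" using iota_pos_iff by (auto simp: positive_cone_def)
qed

lemma R_eq: "R = \<iota> ` carrier (rho E)"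
proof (intro equalityI subsetI)
  fix x assume "x \<in> R"
  then obtain p q where x: "x = \<iota> p - \<iota> q" and pq: "p \<in> positive_cone E" "q \<in> positive_cone E"
    by (auto simp: R_def pos_eq)
  hence "x = \<iota> (p \<ominus> q)" by (simp add: iota_minus positive_cone_def)
  thus "x \<in> \<iota> ` carrier (rho E)" using pq by (auto simp: rho_def)
next
  fix x assume "x \<in> \<iota> ` carrier (rho E)"
  then obtain p q where "x = \<iota> (p \<ominus> q)" and pq: "p \<in> positive_cone E" "q \<in> positive_cone E"
    by (auto simp: rho_def)
  hence "x = \<iota> p - \<iota> q" by (simp add: iota_minus positive_cone_def)
  thus "x \<in> R" using pq by (auto simp: R_def pos_eq)
qed

lemma modulus_pos: "v \<in> carrier E \<Longrightarrow> modulus E v \<in> positive_cone E"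
  by (simp add: positive_cone_def modulus_closed modulus_idem)

text \<open>Induction along the hull axiom: moduli lie in the positive cone, so multiples of
  positive vectors generate everything.\<close>

lemma carrier_induct_hull:
  assumes "\<zero> \<in> Q" "\<And>x y. x \<in> Q \<Longrightarrow> y \<in> Q \<Longrightarrow> x \<oplus> y \<in> Q" "\<And>c v. v \<in> positive_cone E \<Longrightarrow> c \<odot> v \<in> Q"
  shows "carrier E \<subseteq> Q"
proof -
  have "linear_hull E (modulus E ` carrier E) \<subseteq> Q"
    using assms modulus_pos modulus_closed by (intro T.linear_hull_minimal) auto
  thus ?thesis by (simp add: modulus_hull)
qed

end

text \<open>The coordinates are chosen real so that pointwise real and imaginary parts later
  separate E from i E.\<close>

lemma real_embedding:
  fixes E :: "(real, 'a) modulus_space"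
  assumes "archimedean_vector_lattice E"
  obtains \<iota> :: "'a \<Rightarrow> 'a \<Rightarrow> complex"
  where "embedded_lattice E \<iota> complex_of_real" "\<And>v i. Im (\<iota> v i) = 0"
proof -
  interpret E: archimedean_vector_lattice E by fact
  interpret T: type_module E by unfold_locales
  obtain j :: "'a \<Rightarrow> 'a \<Rightarrow> real" where j: "inj_on j (carrier E)"
    "\<And>v w. v \<in> carrier E \<Longrightarrow> w \<in> carrier E \<Longrightarrow> j (v \<oplus>\<^bsub>E\<^esub> w) = j v + j w"
    "\<And>c v. v \<in> carrier E \<Longrightarrow> j (c \<odot>\<^bsub>E\<^esub> v) = (\<lambda>i. c * j v i)"
    using T.embedding by blast
  have "inj_on (\<lambda>v i. complex_of_real (j v i)) (carrier E)"
    using j(1) by (auto simp: inj_on_def fun_eq_iff)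
  hence "embedded_lattice E (\<lambda>v i. complex_of_real (j v i)) complex_of_real"
    by unfold_locales (auto simp: j fun_eq_iff)
  thus ?thesis using that by simp
qed

lemma complex_embedding:
  fixes F :: "(complex, 'a) modulus_space"
  assumes "archimedean_vector_lattice F"
  obtains \<iota> :: "'a \<Rightarrow> 'a \<Rightarrow> complex" where "embedded_lattice F \<iota> (\<lambda>c. c)"
proof -
  interpret F: archimedean_vector_lattice F by fact
  interpret T: type_module F by unfold_locales
  obtain j :: "'a \<Rightarrow> 'a \<Rightarrow> complex" where j: "inj_on j (carrier F)"
    "\<And>v w. v \<in> carrier F \<Longrightarrow> w \<in> carrier F \<Longrightarrow> j (v \<oplus>\<^bsub>F\<^esub> w) = j v + j w"
    "\<And>c v. v \<in> carrier F \<Longrightarrow> j (c \<odot>\<^bsub>F\<^esub> v) = (\<lambda>i. c * j v i)"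
    using T.embedding by blast
  have "embedded_lattice F j (\<lambda>c. c)"
    using j by unfold_locales (auto simp: fun_eq_iff)
  thus ?thesis using that by blast
qed

text \<open>A multiple of a positive vector by c splits along c = Re c + i Im c, and the hull axiom
  builds everything from such multiples.\<close>

lemma (in embedded_lattice) complex_structure:
  assumes "range \<kappa> = UNIV" shows "complex_modulus_structure S im"
proof -
  interpret M: modulus_structure UNIV S im using modulus_structure_axioms assms by simp
  let ?Q = "{v \<in> carrier E. \<exists>f\<in>R. \<exists>g\<in>R. \<iota> v = f + \<i> *\<^sub>C g}"
  have "carrier E \<subseteq> ?Q"
  proof (rule carrier_induct_hull)
    show "\<zero> \<in> ?Q" by (auto intro!: bexI[of _ 0] simp: iota_zero)
    show "x \<oplus> y \<in> ?Q" if xy: "x \<in> ?Q" "y \<in> ?Q" for x y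
    proof -
      obtain f g f' g' where R: "f \<in> R" "g \<in> R" "f' \<in> R" "g' \<in> R"
        and "\<iota> x = f + \<i> *\<^sub>C g" "\<iota> y = f' + \<i> *\<^sub>C g'" using xy by blast
      hence "\<iota> (x \<oplus> y) = (f + f') + \<i> *\<^sub>C (g + g')" using xy by (simp add: iota_add vec)
      moreover have "f + f' \<in> R" "g + g' \<in> R" "x \<oplus> y \<in> carrier E" using R xy by simp_all
      ultimately show ?thesis by blast
    qed
    show "c \<odot> v \<in> ?Q" if v: "v \<in> positive_cone E" for c v
    proof -
      have vc: "v \<in> carrier E" "\<iota> v \<in> R" using v iota_pos_iff[of v] by (auto simp: positive_cone_def)
      have "\<kappa> c = complex_of_real (Re (\<kappa> c)) + \<i> * complex_of_real (Im (\<kappa> c))" by (simp add: complex_eq_iff)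
      hence "\<iota> (c \<odot> v) = (complex_of_real (Re (\<kappa> c)) + \<i> * complex_of_real (Im (\<kappa> c))) *\<^sub>C \<iota> v"
        using vc by (simp add: iota_scale)
      also have "\<dots> = complex_of_real (Re (\<kappa> c)) *\<^sub>C \<iota> v + \<i> *\<^sub>C (complex_of_real (Im (\<kappa> c)) *\<^sub>C \<iota> v)"
        by (simp add: vec)
      finally have "\<iota> (c \<odot> v) = complex_of_real (Re (\<kappa> c)) *\<^sub>C \<iota> v + \<i> *\<^sub>C (complex_of_real (Im (\<kappa> c)) *\<^sub>C \<iota> v)" .
      moreover have "c \<odot> v \<in> carrier E" using vc by simp
      moreover have "complex_of_real r *\<^sub>C \<iota> v \<in> R" for r using vc by simp
      ultimately show ?thesis using vc by blast
    qed
  qed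
  thus ?thesis
    by unfold_locales (auto simp: S_def)
qed

lemma (in embedded_lattice) real_structure:
  assumes "\<And>c. \<kappa> c \<in> \<real>" shows "S \<subseteq> R"
proof -
  have "carrier E \<subseteq> {v \<in> carrier E. \<iota> v \<in> R}"
  proof (rule carrier_induct_hull)
    show "c \<odot> v \<in> {v \<in> carrier E. \<iota> v \<in> R}" if v: "v \<in> positive_cone E" for c v
    proof -
      have vc: "v \<in> carrier E" "\<iota> v \<in> R" using v iota_pos_iff[of v] by (auto simp: positive_cone_def)
      obtain r where "\<kappa> c = complex_of_real r" using assms[of c] by (auto elim: Reals_cases)
      thus ?thesis using vc by (simp add: iota_scale)
    qed
  qed (auto simp: iota_zero iota_add)
  thus ?thesis by (auto simp: S_def)
qed

section \<open>Relatively uniform Cauchy sequences\<close>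

definition reV :: "('i \<Rightarrow> complex) \<Rightarrow> 'i \<Rightarrow> complex" where "reV x = (\<lambda>i. complex_of_real (Re (x i)))"
definition imV :: "('i \<Rightarrow> complex) \<Rightarrow> 'i \<Rightarrow> complex" where "imV x = (\<lambda>i. complex_of_real (Im (x i)))"

lemma reV_imV_simps [simp]:
  "reV 0 = 0" "imV 0 = 0"
  "reV (x + y) = reV x + reV y" "imV (x + y) = imV x + imV y"
  "reV (x - y) = reV x - reV y" "imV (x - y) = imV x - imV y"
  "reV (- x) = - reV x" "imV (- x) = - imV x"
  by (simp_all add: reV_def imV_def fun_eq_iff)

lemma reV_scale: "reV (c *\<^sub>C x) = complex_of_real (Re c) *\<^sub>C reV x - complex_of_real (Im c) *\<^sub>C imV x"
  and imV_scale: "imV (c *\<^sub>C x) = complex_of_real (Im c) *\<^sub>C reV x + complex_of_real (Re c) *\<^sub>C imV x"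
  by (simp_all add: reV_def imV_def fun_eq_iff algebra_simps)

locale real_modulus_structure = modulus_structure K S m for K S and m :: "('i \<Rightarrow> complex) \<Rightarrow> 'i \<Rightarrow> complex" +
  assumes S_R: "S \<subseteq> R" and S_real: "x \<in> S \<Longrightarrow> Im (x i) = 0"
begin

lemma S_in_R [simp]: "x \<in> S \<Longrightarrow> x \<in> R"
  using S_R by auto

lemma reV_S [simp]: "x \<in> S \<Longrightarrow> reV x = x" and imV_S [simp]: "x \<in> S \<Longrightarrow> imV x = 0"
  by (auto simp: reV_def imV_def fun_eq_iff complex_eq_iff S_real)

text \<open>The algebraic complexification S + i S, a direct sum because the vectors in
  \<open>S\<close> are real-valued.\<close>

definition CS where "CS = {x. reV x \<in> S \<and> imV x \<in> S}"

lemma S_CS: "x \<in> S \<Longrightarrow> x \<in> CS"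
  by (simp add: CS_def)

lemma CS_add [simp]: "x \<in> CS \<Longrightarrow> y \<in> CS \<Longrightarrow> x + y \<in> CS"
  by (simp add: CS_def)

lemma CS_diff [simp]: "x \<in> CS \<Longrightarrow> y \<in> CS \<Longrightarrow> x - y \<in> CS"
  by (simp add: CS_def)

lemma CS_scale [simp]: "x \<in> CS \<Longrightarrow> c *\<^sub>C x \<in> CS"
  by (simp add: CS_def reV_scale imV_scale)

lemma CS_parts [simp]: "x \<in> CS \<Longrightarrow> reV x \<in> S" "x \<in> CS \<Longrightarrow> imV x \<in> S"
  by (simp_all add: CS_def)

text \<open>A stand-in for the modulus of x, which need not exist in \<open>S\<close>; where it
  exists, the two agree up to a factor 2.\<close>

definition N1 where "N1 x = m (reV x) + m (imV x)"

lemma N1_S: "x \<in> S \<Longrightarrow> N1 x = m x"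
  by (simp add: N1_def)

lemma N1_pos [simp]: "x \<in> CS \<Longrightarrow> N1 x \<in> pos"
  by (simp add: N1_def pos_add)

lemma N1_add: assumes "x \<in> CS" "y \<in> CS" shows "N1 (x + y) \<preceq> N1 x + N1 y"
proof -
  have *: "m (reV x + reV y) + m (imV x + imV y) \<preceq> (m (reV x) + m (reV y)) + (m (imV x) + m (imV y))"
    using assms by (intro le_add_mono m_triangle) simp_all
  show ?thesis by (rule le_comb1[OF *, of 1]) (simp_all add: N1_def vec)
qed

lemma N1_scale: assumes "x \<in> CS" shows "N1 (c *\<^sub>C x) \<preceq> complex_of_real (\<bar>Re c\<bar> + \<bar>Im c\<bar>) *\<^sub>C N1 x"
proof -
  have m: "m (complex_of_real r *\<^sub>C reV x) = complex_of_real \<bar>r\<bar> *\<^sub>C m (reV x)"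
    "m (complex_of_real r *\<^sub>C imV x) = complex_of_real \<bar>r\<bar> *\<^sub>C m (imV x)" for r
    using assms by (simp_all add: m_scale_real)
  have *: "N1 (c *\<^sub>C x) \<preceq> (complex_of_real \<bar>Re c\<bar> *\<^sub>C m (reV x) + complex_of_real \<bar>Im c\<bar> *\<^sub>C m (imV x)) +
     (complex_of_real \<bar>Im c\<bar> *\<^sub>C m (reV x) + complex_of_real \<bar>Re c\<bar> *\<^sub>C m (imV x))"
    unfolding N1_def reV_scale imV_scale m[symmetric]
    using assms by (intro le_add_mono m_triangle m_triangle_diff) simp_all
  show ?thesis by (rule le_comb1[OF *, of 1]) (simp_all add: N1_def vec)
qed

lemma N1_uminus: "x \<in> CS \<Longrightarrow> N1 (- x) = N1 x"
  by (simp add: N1_def m_uminus)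

lemma N1_minus_commute: "x \<in> CS \<Longrightarrow> y \<in> CS \<Longrightarrow> N1 (x - y) = N1 (y - x)"
  using N1_uminus[of "y - x"] by simp

end

section \<open>Vanishing and Cauchy sequences with rate 1 / (n + 1)\<close>

definition eps :: "nat \<Rightarrow> real" where "eps n = 1 / real (Suc n)"

lemma eps_pos [simp]: "0 < eps n" "0 \<le> eps n" and eps_mono: "n \<le> k \<Longrightarrow> eps k \<le> eps n"
  by (simp_all add: eps_def frac_le)

definition seq_scale :: "complex \<Rightarrow> (nat \<Rightarrow> 'i \<Rightarrow> complex) \<Rightarrow> nat \<Rightarrow> 'i \<Rightarrow> complex"  (infixr "*\<^sub>S" 75)
  where "c *\<^sub>S x = (\<lambda>n. c *\<^sub>C x n)"

lemma seq_scale_apply [simp]: "(c *\<^sub>S x) n = c *\<^sub>C x n"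
  by (simp add: seq_scale_def)

lemma seq_scale_simps [simp]: "1 *\<^sub>S x = x" "c *\<^sub>S d *\<^sub>S x = (c * d) *\<^sub>S x"
  by (simp_all add: seq_scale_def)

context real_modulus_structure
begin

lemmas eps_arch = arch_eps[folded eps_def]

text \<open>
  The rate \<open>1 / (n + 1)\<close> is prescribed to avoid quantifiers over \<open>\<epsilon>\<close>. Merely bounded sequences would
  not do: modulo vanishing ones they need not be Archimedean.
\<close>

definition vanishing where
  "vanishing x \<longleftrightarrow> (\<forall>n. x n \<in> CS) \<and> (\<exists>u\<in>pos. \<forall>n. N1 (x n) \<preceq> complex_of_real (eps n) *\<^sub>C u)"

definition cauchy where
  "cauchy x \<longleftrightarrow> (\<forall>n. x n \<in> CS) \<and>
     (\<exists>u\<in>pos. \<forall>n k. n \<le> k \<longrightarrow> N1 (x n - x k) \<preceq> complex_of_real (eps n) *\<^sub>C u)"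

definition modS where "modS x = (\<lambda>n. \<sigma> n (reV (x n)) (imV (x n)))"

lemma cauchyI:
  "(\<And>n. x n \<in> CS) \<Longrightarrow> u \<in> pos \<Longrightarrow>
    (\<And>n k. n \<le> k \<Longrightarrow> N1 (x n - x k) \<preceq> complex_of_real (eps n) *\<^sub>C u) \<Longrightarrow> cauchy x"
  by (auto simp: cauchy_def)

lemma cauchy_CS: "cauchy x \<Longrightarrow> x n \<in> CS"
  by (simp add: cauchy_def)

lemma zero_CS [simp]: "0 \<in> CS"
  by (simp add: S_CS)

lemma cauchy_const: assumes "f \<in> S" shows "cauchy (\<lambda>_. f)"
  using assms by (auto simp: cauchy_def S_CS N1_def intro!: bexI[of _ 0])

lemma cauchy_add: assumes "cauchy x" "cauchy y" shows "cauchy (x + y)"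
proof -
  obtain u v where uv: "u \<in> pos" "v \<in> pos" and CS: "\<And>n. x n \<in> CS" "\<And>n. y n \<in> CS"
    and le: "\<And>n k. n \<le> k \<Longrightarrow> N1 (x n - x k) \<preceq> complex_of_real (eps n) *\<^sub>C u"
      "\<And>n k. n \<le> k \<Longrightarrow> N1 (y n - y k) \<preceq> complex_of_real (eps n) *\<^sub>C v"
    using assms unfolding cauchy_def by metis
  have "N1 ((x + y) n - (x + y) k) \<preceq> complex_of_real (eps n) *\<^sub>C (u + v)" if nk: "n \<le> k" for n k
  proof -
    have "N1 ((x n - x k) + (y n - y k)) \<preceq> N1 (x n - x k) + N1 (y n - y k)"
      using CS by (intro N1_add) simp_all
    also have "\<dots> \<preceq> complex_of_real (eps n) *\<^sub>C u + complex_of_real (eps n) *\<^sub>C v"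
      by (intro le_add_mono le nk)
    finally show ?thesis by (simp add: cscale_add algebra_simps)
  qed
  thus ?thesis using uv CS by (intro cauchyI[of _ "u + v"] pos_add) simp_all
qed

lemma cauchy_scale: assumes "cauchy x" shows "cauchy (c *\<^sub>S x)"
proof -
  obtain u where u: "u \<in> pos" and CS: "\<And>n. x n \<in> CS"
    and le: "\<And>n k. n \<le> k \<Longrightarrow> N1 (x n - x k) \<preceq> complex_of_real (eps n) *\<^sub>C u"
    using assms unfolding cauchy_def by metis
  define r where "r = \<bar>Re c\<bar> + \<bar>Im c\<bar>"
  have "N1 ((c *\<^sub>S x) n - (c *\<^sub>S x) k) \<preceq> complex_of_real (eps n) *\<^sub>C complex_of_real r *\<^sub>C u" if nk: "n \<le> k" for n k
  proof -
    have "(c *\<^sub>S x) n - (c *\<^sub>S x) k = c *\<^sub>C (x n - x k)" by (simp add: vec)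
    hence "N1 ((c *\<^sub>S x) n - (c *\<^sub>S x) k) \<preceq> complex_of_real r *\<^sub>C N1 (x n - x k)"
      using CS N1_scale[of "x n - x k" c] by (simp add: r_def)
    also have "\<dots> \<preceq> complex_of_real r *\<^sub>C complex_of_real (eps n) *\<^sub>C u"
      by (intro le_scale_mono le nk) (simp add: r_def)
    finally show ?thesis by (simp add: mult.commute)
  qed
  moreover have "complex_of_real r *\<^sub>C u \<in> pos" using u by (intro pos_scale) (auto simp: r_def)
  ultimately show ?thesis using CS by (intro cauchyI[of _ "complex_of_real r *\<^sub>C u"]) simp_all
qed

lemma cauchy_bounded: assumes "cauchy x" obtains b where "b \<in> pos" "\<And>n. N1 (x n) \<preceq> b"
proof -
  obtain u where u: "u \<in> pos" and CS: "\<And>n. x n \<in> CS"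
    and le: "\<And>n k. n \<le> k \<Longrightarrow> N1 (x n - x k) \<preceq> complex_of_real (eps n) *\<^sub>C u"
    using assms unfolding cauchy_def by metis
  have "N1 (x n) \<preceq> u + N1 (x 0)" for n
  proof -
    have "N1 ((x n - x 0) + x 0) \<preceq> N1 (x n - x 0) + N1 (x 0)" using CS by (intro N1_add) simp_all
    also have "\<dots> \<preceq> u + N1 (x 0)"
      using le[of 0 n] CS by (intro le_add_mono) (simp_all add: N1_minus_commute eps_def)
    finally show ?thesis by simp
  qed
  moreover have "u + N1 (x 0) \<in> pos" using u CS by (intro pos_add) simp_all
  ultimately show ?thesis using that by blast
qed

lemma sigma_S [simp]: "f \<in> S \<Longrightarrow> g \<in> S \<Longrightarrow> \<sigma> n f g \<in> S"
  by (simp add: R_S)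

lemma modS_S [simp]: "(\<And>n. x n \<in> CS) \<Longrightarrow> modS x n \<in> S"
  by (simp add: modS_def)

lemma modS_pos: "(\<And>n. x n \<in> CS) \<Longrightarrow> modS x n \<in> pos"
  by (simp add: modS_def)

lemma sigma_diff_grid:
  assumes "z \<in> CS" "n \<le> k"
  shows "m (\<sigma> n (reV z) (imV z) - \<sigma> k (reV z) (imV z)) \<preceq> complex_of_real (eps n) *\<^sub>C N1 z"
proof -
  have R: "reV z \<in> R" "imV z \<in> R" using assms by simp_all
  have 1: "\<sigma> k (reV z) (imV z) \<preceq> \<sigma> n (reV z) (imV z) + complex_of_real (eps n) *\<^sub>C N1 z"
    using sigma_le_sigma[OF R] by (simp only: N1_def eps_def)
  have "\<sigma> n (reV z) (imV z) \<preceq> \<sigma> k (reV z) (imV z) + complex_of_real (eps k) *\<^sub>C N1 z"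
    using sigma_le_sigma[OF R] by (simp only: N1_def eps_def)
  also have "\<dots> \<preceq> \<sigma> k (reV z) (imV z) + complex_of_real (eps n) *\<^sub>C N1 z"
    using assms by (intro le_add_mono le_scale_pos eps_mono) simp_all
  finally have 2: "\<sigma> n (reV z) (imV z) \<preceq> \<sigma> k (reV z) (imV z) + complex_of_real (eps n) *\<^sub>C N1 z" .
  show ?thesis using 1 2 by (intro m_le) (simp_all add: le_def algebra_simps)
qed

text \<open>Move from x n to x k on the same grid by the Lipschitz bound, then from grid n to grid k
  at the point x k; the second error is uniform because the sequence is bounded.\<close>

lemma cauchy_modS: assumes "cauchy x" shows "cauchy (modS x)"
proof -
  obtain u where u: "u \<in> pos" and CS: "\<And>n. x n \<in> CS"
    and le: "\<And>n k. n \<le> k \<Longrightarrow> N1 (x n - x k) \<preceq> complex_of_real (eps n) *\<^sub>C u"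
    using assms unfolding cauchy_def by metis
  obtain b where b: "b \<in> pos" "\<And>n. N1 (x n) \<preceq> b" using cauchy_bounded[OF assms] by blast
  have "N1 (modS x n - modS x k) \<preceq> complex_of_real (eps n) *\<^sub>C (u + b)" if nk: "n \<le> k" for n k
  proof -
    let ?s = "\<lambda>n k. \<sigma> n (reV (x k)) (imV (x k))"
    have "N1 (modS x n - modS x k) = m ((?s n n - ?s n k) + (?s n k - ?s k k))"
      using CS by (simp add: N1_S modS_def)
    also have "m ((?s n n - ?s n k) + (?s n k - ?s k k)) \<preceq> m (?s n n - ?s n k) + m (?s n k - ?s k k)"
      using CS by (intro m_triangle) simp_all
    also have "\<dots> \<preceq> complex_of_real (eps n) *\<^sub>C u + complex_of_real (eps n) *\<^sub>C b"
    proof (rule le_add_mono)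
      have "m (?s n n - ?s n k) \<preceq> N1 (x n - x k)"
        using sigma_lipschitz[of "reV (x n)" "imV (x n)" "reV (x k)" "imV (x k)" n] CS by (simp add: N1_def)
      thus "m (?s n n - ?s n k) \<preceq> complex_of_real (eps n) *\<^sub>C u" using le[OF nk] by (rule le_trans)
      have "m (?s n k - ?s k k) \<preceq> complex_of_real (eps n) *\<^sub>C N1 (x k)" using CS nk by (rule sigma_diff_grid)
      also have "\<dots> \<preceq> complex_of_real (eps n) *\<^sub>C b" by (intro le_scale_mono b) simp
      finally show "m (?s n k - ?s k k) \<preceq> complex_of_real (eps n) *\<^sub>C b" .
    qed
    finally show ?thesis by (simp add: cscale_add)
  qed
  moreover have "modS x n \<in> CS" for n using CS by (simp add: S_CS)
  ultimately show ?thesis using u b(1) by (intro cauchyI[of _ "u + b"] pos_add) simp_all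
qed

lemma vanishingI:
  "(\<And>n. x n \<in> CS) \<Longrightarrow> u \<in> pos \<Longrightarrow> (\<And>n. N1 (x n) \<preceq> complex_of_real (eps n) *\<^sub>C u) \<Longrightarrow> vanishing x"
  by (auto simp: vanishing_def)

lemma vanishing_zero: "vanishing 0"
  by (rule vanishingI[of _ 0]) (simp_all add: N1_def)

lemma vanishing_add: assumes "vanishing x" "vanishing y" shows "vanishing (x + y)"
proof -
  obtain u v where uv: "u \<in> pos" "v \<in> pos" and CS: "\<And>n. x n \<in> CS" "\<And>n. y n \<in> CS"
    and le: "\<And>n. N1 (x n) \<preceq> complex_of_real (eps n) *\<^sub>C u" "\<And>n. N1 (y n) \<preceq> complex_of_real (eps n) *\<^sub>C v"
    using assms unfolding vanishing_def by metis
  have "N1 ((x + y) n) \<preceq> complex_of_real (eps n) *\<^sub>C (u + v)" for n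
    using le_trans[OF N1_add[OF CS(1,2)] le_add_mono[OF le(1,2)]] by (simp add: cscale_add)
  thus ?thesis using uv CS by (intro vanishingI[of _ "u + v"] pos_add) simp_all
qed

lemma vanishing_scale: assumes "vanishing x" shows "vanishing (c *\<^sub>S x)"
proof -
  obtain u where u: "u \<in> pos" and CS: "\<And>n. x n \<in> CS" and le: "\<And>n. N1 (x n) \<preceq> complex_of_real (eps n) *\<^sub>C u"
    using assms unfolding vanishing_def by metis
  define r where "r = \<bar>Re c\<bar> + \<bar>Im c\<bar>"
  have r: "0 \<le> r" by (simp add: r_def)
  have "N1 ((c *\<^sub>S x) n) \<preceq> complex_of_real (eps n) *\<^sub>C complex_of_real r *\<^sub>C u" for n
    using le_trans[OF N1_scale[OF CS] le_scale_mono[OF le r, unfolded r_def]]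
    by (simp add: r_def mult.commute)
  thus ?thesis using u CS r by (intro vanishingI[of _ "complex_of_real r *\<^sub>C u"] pos_scale) simp_all
qed

lemma vanishing_diff_trans: assumes "vanishing (x - y)" "vanishing (y - z)" shows "vanishing (x - z)"
  using vanishing_add[OF assms] by simp

lemma vanishing_diff_sym: assumes "vanishing (x - y)" shows "vanishing (y - x)"
proof -
  have "(- 1) *\<^sub>S (x - y) = y - x" by (simp add: fun_eq_iff)
  thus ?thesis using vanishing_scale[OF assms, of "- 1"] by simp
qed

text \<open>Makes the modulus of a class well defined.\<close>

lemma vanishing_modS_diff:
  assumes "cauchy x" "cauchy y" "vanishing (x - y)" shows "vanishing (modS x - modS y)"
proof -
  obtain u where u: "u \<in> pos" and le: "\<And>n. N1 ((x - y) n) \<preceq> complex_of_real (eps n) *\<^sub>C u"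
    using assms unfolding vanishing_def by metis
  have CS: "x n \<in> CS" "y n \<in> CS" for n using assms cauchy_CS by blast+
  show ?thesis
  proof (rule vanishingI[OF _ u])
    fix n
    show "(modS x - modS y) n \<in> CS" using CS by (simp add: S_CS)
    have "N1 ((modS x - modS y) n) = m (modS x n - modS y n)" using CS by (simp add: N1_S)
    also have "\<dots> \<preceq> N1 ((x - y) n)"
      using sigma_lipschitz[of "reV (x n)" "imV (x n)" "reV (y n)" "imV (y n)" n] CS by (simp add: N1_def modS_def)
    also note le
    finally show "N1 ((modS x - modS y) n) \<preceq> complex_of_real (eps n) *\<^sub>C u" .
  qed
qed

lemma modS_of_pos: assumes "\<And>n. x n \<in> pos" shows "modS x = x"
proof
  fix n show "modS x n = x n" using assms[of n] pos_S[of "x n"] by (simp add: modS_def sigma_of_pos)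
qed

lemma modS_modS: "cauchy x \<Longrightarrow> modS (modS x) = modS x"
  by (intro modS_of_pos modS_pos cauchy_CS)

text \<open>Holds exactly, term by term: on a fixed grid \<sigma> is subadditive, so the sequences
  to which the outer \<open>modS\<close> are applied are positive and hence fixed.\<close>

lemma modS_add:
  assumes "cauchy x" "cauchy y"
  shows "modS (modS (modS x + modS y) - modS (x + y)) = modS x + modS y - modS (x + y)"
proof -
  have CS: "x n \<in> CS" "y n \<in> CS" for n using assms cauchy_CS by blast+
  have "modS (modS x + modS y) = modS x + modS y"
    using CS by (intro modS_of_pos) (simp add: pos_add modS_pos)
  moreover have "modS (modS x + modS y - modS (x + y)) = modS x + modS y - modS (x + y)"
  proof (rule modS_of_pos)
    fix n
    show "(modS x + modS y - modS (x + y)) n \<in> pos"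
      using sigma_subadditive[of "reV (x n)" "imV (x n)" "reV (y n)" "imV (y n)" n] CS
      by (simp add: modS_def le_def)
  qed
  ultimately show ?thesis by simp
qed

text \<open>In contrast to \<open>modS_add\<close> this holds only modulo vanishing sequences,
  because a grid is not invariant under rotation.\<close>

lemma modS_scale: assumes "cauchy x" shows "vanishing (modS (c *\<^sub>S x) - complex_of_real (norm c) *\<^sub>S modS x)"
proof -
  obtain b where b: "b \<in> pos" "\<And>n. N1 (x n) \<preceq> b" using cauchy_bounded[OF assms] by blast
  have CS: "x n \<in> CS" for n using assms cauchy_CS by blast
  define r where "r = \<bar>Re c\<bar> + \<bar>Im c\<bar>"
  have r: "0 \<le> r" by (simp add: r_def)
  have bp: "complex_of_real (norm c) *\<^sub>C b + complex_of_real r *\<^sub>C b \<in> pos" (is "?b \<in> _")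
    using b r by (intro pos_add pos_scale) simp_all
  show ?thesis
  proof (rule vanishingI[OF _ bp])
    fix n
    have S: "modS (c *\<^sub>S x) n - complex_of_real (norm c) *\<^sub>C modS x n \<in> S"
      using CS by simp
    thus "(modS (c *\<^sub>S x) - complex_of_real (norm c) *\<^sub>S modS x) n \<in> CS" by (simp add: S_CS)
    have "N1 (modS (c *\<^sub>S x) n - complex_of_real (norm c) *\<^sub>C modS x n) =
        m (modS (c *\<^sub>S x) n - complex_of_real (norm c) *\<^sub>C modS x n)" using S by (rule N1_S)
    also have "\<dots> \<preceq> complex_of_real (eps n) *\<^sub>C (complex_of_real (norm c) *\<^sub>C N1 (x n) + N1 (c *\<^sub>C x n))"
      using sigma_rotate[of "reV (x n)" "imV (x n)" n c] CS
      by (simp only: modS_def N1_def reV_scale imV_scale seq_scale_apply eps_def CS_parts S_in_R)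
    also have "\<dots> \<preceq> complex_of_real (eps n) *\<^sub>C ?b"
    proof (intro le_scale_mono le_add_mono b)
      show "N1 (c *\<^sub>C x n) \<preceq> complex_of_real r *\<^sub>C b"
        using le_trans[OF N1_scale[OF CS] le_scale_mono[OF b(2) r, unfolded r_def]] by (simp add: r_def)
    qed simp_all
    finally show "N1 ((modS (c *\<^sub>S x) - complex_of_real (norm c) *\<^sub>S modS x) n) \<preceq> complex_of_real (eps n) *\<^sub>C ?b"
      by simp
  qed
qed

lemma modS_const: assumes "f \<in> S" shows "vanishing (modS (\<lambda>_. f) - (\<lambda>_. m f))"
proof (rule vanishingI[of _ "m f"])
  fix n
  show "N1 ((modS (\<lambda>_. f) - (\<lambda>_. m f)) n) \<preceq> complex_of_real (eps n) *\<^sub>C m f"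
    using sigma_real_approx[of f n] assms by (simp add: modS_def N1_S eps_def)
qed (use assms in \<open>simp_all add: modS_def S_CS\<close>)

lemma eps_le_zero:
  assumes "x \<in> R" "u \<in> pos" "\<And>n. x \<preceq> complex_of_real (eps n) *\<^sub>C u" shows "x \<preceq> 0"
  using assms by (intro eps_arch[of x 0 u]) simp_all

lemma m_le_zero: assumes "x \<in> S" "m x \<preceq> 0" shows "x = 0"
proof (rule le_antisym)
  show "x \<preceq> 0" using le_trans[OF le_m assms(2)] assms(1) by simp
  show "0 \<preceq> x" using le_trans[OF uminus_le_m assms(2)] assms(1) by (simp add: le_def)
qed

text \<open>Here the Archimedean property yields the injectivity of the embedding of E by constant
  sequences.\<close>

lemma vanishing_const: assumes "f \<in> S" "vanishing (\<lambda>_. f)" shows "f = 0"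
proof -
  obtain u where "u \<in> pos" "\<And>n. N1 f \<preceq> complex_of_real (eps n) *\<^sub>C u"
    using assms unfolding vanishing_def by blast
  hence "m f \<preceq> 0" using assms(1) by (intro eps_le_zero[of _ u]) (simp_all add: N1_S)
  thus ?thesis using assms(1) by (intro m_le_zero)
qed

text \<open>The rays at multiples of pi / 2 are the real and imaginary part up to sign, and all rays
  lie below the modulus up to the grid error.\<close>

lemma vanishing_of_modS: assumes "cauchy x" "vanishing (modS x)" shows "vanishing x"
proof -
  obtain b where b: "b \<in> pos" "\<And>n. N1 (x n) \<preceq> b" using cauchy_bounded[OF assms(1)] by blast
  have CS: "x n \<in> CS" for n using assms cauchy_CS by blast
  obtain u where u: "u \<in> pos" and le: "\<And>n. N1 (modS x n) \<preceq> complex_of_real (eps n) *\<^sub>C u"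
    using assms(2) unfolding vanishing_def by blast
  have p: "(u + b) + (u + b) \<in> pos" using u b by (intro pos_add)
  show ?thesis
  proof (rule vanishingI[OF CS p])
    fix n
    let ?f = "reV (x n)" and ?g = "imV (x n)"
    have R: "?f \<in> R" "?g \<in> R" using CS by simp_all
    have mle: "modS x n \<preceq> complex_of_real (eps n) *\<^sub>C u"
    proof (rule le_trans)
      show "modS x n \<preceq> m (modS x n)" using CS by (intro le_m) simp
      show "m (modS x n) \<preceq> complex_of_real (eps n) *\<^sub>C u" using le[of n] CS by (simp add: N1_S)
    qed
    have ray: "ray t ?f ?g \<preceq> complex_of_real (eps n) *\<^sub>C (u + b)" for t
    proof -
      have "ray t ?f ?g \<preceq> modS x n + complex_of_real (eps n) *\<^sub>C N1 (x n)"
        using ray_le_sigma[OF R, of t n] by (simp only: modS_def N1_def eps_def)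
      also have "\<dots> \<preceq> complex_of_real (eps n) *\<^sub>C u + complex_of_real (eps n) *\<^sub>C b"
        by (intro le_add_mono le_scale_mono b mle) simp
      finally show ?thesis by (simp add: cscale_add)
    qed
    have "m ?f \<preceq> complex_of_real (eps n) *\<^sub>C (u + b)"
      using ray[of 0] ray[of pi] by (intro m_le) (simp_all add: ray_def)
    moreover have "m ?g \<preceq> complex_of_real (eps n) *\<^sub>C (u + b)"
      using ray[of "pi / 2"] ray[of "- pi / 2"] by (intro m_le) (simp_all add: ray_def)
    ultimately show "N1 (x n) \<preceq> complex_of_real (eps n) *\<^sub>C ((u + b) + (u + b))"
      unfolding cscale_add[of _ "u + b"] N1_def by (rule le_add_mono)
  qed
qed

text \<open>The hypothesis bounds j \<open>modS x\<close> by \<open>modS y\<close> up to an error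
  whose regulator \<open>w\<close> depends on j. For fixed j and l this error is removed by going to
  late terms k, which the Cauchy rate of \<open>modS x\<close> compares with term l. What is left is
  j (modS x l - eps l u) \<le> v with u and v independent of j, and then j tends to
  infinity.\<close>

lemma modS_archimedean:
  assumes x: "cauchy x" and y: "cauchy y"
    and le: "\<And>j::nat. vanishing (modS (modS y - of_nat j *\<^sub>S modS x) - (modS y - of_nat j *\<^sub>S modS x))"
  shows "vanishing x"
proof (rule vanishing_of_modS[OF x])
  have CSx: "x n \<in> CS" and CSy: "y n \<in> CS" for n using x y cauchy_CS by blast+
  have S: "modS x n \<in> S" "modS y n \<in> S" for n using CSx CSy by simp_all
  obtain u where u: "u \<in> pos"
    and cau: "\<And>n k. n \<le> k \<Longrightarrow> N1 (modS x n - modS x k) \<preceq> complex_of_real (eps n) *\<^sub>C u"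
    using cauchy_modS[OF x] unfolding cauchy_def by metis
  obtain v where v: "v \<in> pos" "\<And>n. N1 (modS y n) \<preceq> v" using cauchy_bounded[OF cauchy_modS[OF y]] by blast
  show "vanishing (modS x)"
  proof (rule vanishingI[OF _ u])
    fix l
    show "modS x l \<in> CS" using S by (simp add: S_CS)
    have "complex_of_real (real j) *\<^sub>C (modS x l - complex_of_real (eps l) *\<^sub>C u) \<preceq> v" for j
    proof -
      let ?a = "modS y - of_nat j *\<^sub>S modS x"
      obtain w where w: "w \<in> pos" "\<And>n. N1 ((modS ?a - ?a) n) \<preceq> complex_of_real (eps n) *\<^sub>C w"
        using le[of j] unfolding vanishing_def by metis
      have aS: "?a n \<in> S" for n using S scale_real_mem[of "modS x n" "real j"] by simp
      have a: "0 \<preceq> ?a n + complex_of_real (eps n) *\<^sub>C w" for n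
      proof -
        have 0: "0 \<preceq> modS ?a n" using aS by (simp add: zero_le_iff modS_pos S_CS del: minus_apply)
        have "modS ?a n - ?a n \<preceq> m (modS ?a n - ?a n)" 
          using aS by (intro le_m S_in_R diff_mem modS_S S_CS)
        also have "\<dots> = N1 ((modS ?a - ?a) n)"
          using aS by (subst minus_apply, subst N1_S) (simp_all add: S_CS del: minus_apply)
        also note w(2)[of n]
        finally show ?thesis using le_add_mono[OF 0] by (fastforce simp: le_def algebra_simps)
      qed
      have "complex_of_real (real j) *\<^sub>C modS x l \<preceq> v + complex_of_real (real j) *\<^sub>C complex_of_real (eps l) *\<^sub>C u"
      proof (rule eps_arch[OF _ _ w(1)])
        show "complex_of_real (real j) *\<^sub>C modS x l \<in> R" by (intro scale_R S_in_R S)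
        show "v + complex_of_real (real j) *\<^sub>C complex_of_real (eps l) *\<^sub>C u \<in> R"
          by (intro add_R scale_R pos_R u v(1))
        fix n
        \<comment> \<open>k has to be late enough for the error with \<open>w\<close>, and not
          before l so that the Cauchy estimate applies.\<close>
        define k where "k = max l n"
        have "modS x l - modS x k \<preceq> m (modS x l - modS x k)" using S by (intro le_m) simp
        also have "\<dots> \<preceq> complex_of_real (eps l) *\<^sub>C u" using cau[of l k] S by (simp add: N1_S k_def)
        finally have 1: "modS x l - modS x k \<preceq> complex_of_real (eps l) *\<^sub>C u" .
        have 2: "modS y k \<preceq> v" using le_trans[OF le_m v(2)[of k, unfolded N1_S[OF S(2)]]] S by simp
        have 3: "complex_of_real (eps k) *\<^sub>C w \<preceq> complex_of_real (eps n) *\<^sub>C w"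
          using w(1) by (intro le_scale_pos eps_mono) (simp_all add: k_def)
        have 4: "complex_of_real (real j) *\<^sub>C modS x k \<preceq> modS y k + complex_of_real (eps k) *\<^sub>C w"
          using a[of k] by (simp add: le_def algebra_simps)
        have 5: "complex_of_real (real j) *\<^sub>C (modS x l - modS x k) \<preceq> complex_of_real (real j) *\<^sub>C complex_of_real (eps l) *\<^sub>C u"
          by (rule le_scale_mono[OF 1]) simp
        have 6: "modS y k + complex_of_real (eps k) *\<^sub>C w \<preceq> v + complex_of_real (eps n) *\<^sub>C w"
          by (rule le_add_mono[OF 2 3])
        have "complex_of_real (real j) *\<^sub>C modS x k + complex_of_real (real j) *\<^sub>C (modS x l - modS x k) \<preceq>
          v + complex_of_real (eps n) *\<^sub>C w + complex_of_real (real j) *\<^sub>C complex_of_real (eps l) *\<^sub>C u"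
          by (rule le_add_mono[OF le_trans[OF 4 6] 5])
        thus "complex_of_real (real j) *\<^sub>C modS x l \<preceq>
          (v + complex_of_real (real j) *\<^sub>C complex_of_real (eps l) *\<^sub>C u) + complex_of_real (eps n) *\<^sub>C w"
          by (rule le_comb1[where r = 1]) (simp_all add: vec)
      qed
      thus ?thesis by (rule le_comb1[where r = 1]) (simp_all add: vec)
    qed
    hence "modS x l - complex_of_real (eps l) *\<^sub>C u \<preceq> 0"
      using S u by (intro nat_archimedean[of _ v]) simp_all
    moreover have "N1 (modS x l) = modS x l" using S CSx by (simp add: N1_S m_eq modS_pos)
    ultimately show "N1 (modS x l) \<preceq> complex_of_real (eps l) *\<^sub>C u" by (simp add: le_def)
  qed
qed

end

section \<open>The generated complex vector lattice\<close>

lemma lepoll_iff_ordLeq: "lepoll A B \<longleftrightarrow> (card_of A, card_of B) \<in> ordLeq"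
  unfolding lepoll_def by (rule card_of_ordLeq)

lemma infinite_times_lepoll:
  assumes "infinite A" "lepoll B A" "lepoll C A" shows "lepoll (B \<times> C) A"
  using times_lepoll_mono[OF assms(2,3)] card_of_Times_same_infinite[OF assms(1)]
  by (metis eqpoll_iff_card_of_ordIso lepoll_trans2)

lemma infinite_UN_lepoll:
  assumes "infinite A" "\<And>n::nat. lepoll (B n) A" shows "lepoll (\<Union>n. B n) A"
proof -
  have "lepoll (UNIV :: nat set) A" using assms(1) infinite_le_lepoll by blast
  thus ?thesis using assms card_of_UNION_ordLeq_infinite[of A UNIV B] unfolding lepoll_iff_ordLeq by blast
qed

lemma infinite_Un_lepoll:
  assumes "infinite A" "lepoll B A" "lepoll C A" shows "lepoll (B \<union> C) A"
proof -
  have "lepoll (\<Union>n::nat. if n = 0 then B else C) A"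
    using assms by (intro infinite_UN_lepoll) simp_all
  moreover have "B \<union> C \<subseteq> (\<Union>n::nat. if n = 0 then B else C)" by (auto split: if_splits)
  ultimately show ?thesis using subset_imp_lepoll lepoll_trans by blast
qed

context real_modulus_structure
begin

text \<open>
  Restricting to the generated sequences makes extensions of homomorphisms unique and keeps the
  cardinality down to that of the original lattice, so that the quotient fits into the same type.
\<close>

inductive_set gen :: "(nat \<Rightarrow> 'i \<Rightarrow> complex) set" where
  const: "f \<in> S \<Longrightarrow> (\<lambda>_. f) \<in> gen"
| add: "x \<in> gen \<Longrightarrow> y \<in> gen \<Longrightarrow> x + y \<in> gen"
| scale: "x \<in> gen \<Longrightarrow> c *\<^sub>S x \<in> gen"
| modS: "x \<in> gen \<Longrightarrow> modS x \<in> gen"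

lemma gen_cauchy: "x \<in> gen \<Longrightarrow> cauchy x"
  by (induction rule: gen.induct) (rule cauchy_const cauchy_add cauchy_scale cauchy_modS; assumption)+

lemma zero_gen: "0 \<in> gen"
  using gen.const[OF zero_mem] by (simp add: zero_fun_def)

lemma diff_gen: assumes "x \<in> gen" "y \<in> gen" shows "x - y \<in> gen"
proof -
  have "x - y = x + (- 1) *\<^sub>S y" by (simp add: fun_eq_iff)
  thus ?thesis using assms by (simp only: gen.add gen.scale)
qed

text \<open>Treated apart because the cardinal arithmetic of the general case needs \<open>S\<close>
  to be infinite.\<close>

lemma gen_trivial: assumes "S = {0}" shows "gen = {0}"
proof -
  have "x = 0" if "x \<in> gen" for x
    using that
  proof induction
    case (modS x)
    have "modS 0 = 0" by (rule modS_of_pos) simp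
    thus ?case using modS.IH by (simp only:)
  qed (use assms in \<open>auto simp: fun_eq_iff\<close>)
  thus ?thesis using zero_gen by blast
qed

text \<open>Splits the generation into countably many layers whose size can be bounded one after the
  other.\<close>

primrec stage :: "nat \<Rightarrow> (nat \<Rightarrow> 'i \<Rightarrow> complex) set" where
  "stage 0 = (\<lambda>f _. f) ` S"
| "stage (Suc n) = stage n \<union> (\<lambda>(x, y). x + y) ` (stage n \<times> stage n) \<union>
     (\<lambda>(c, x). c *\<^sub>S x) ` (UNIV \<times> stage n) \<union> modS ` stage n"

lemma stage_mono: "n \<le> k \<Longrightarrow> stage n \<subseteq> stage k"
  by (induction k rule: dec_induct) auto

lemma gen_subset_stages: "gen \<subseteq> (\<Union>n. stage n)"
proof
  fix x assume "x \<in> gen"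
  hence "\<exists>n. x \<in> stage n"
  proof induction
    case (const f)
    hence "(\<lambda>_. f) \<in> stage 0" by simp
    thus ?case by blast
  next
    case (add x y)
    then obtain a b where "x \<in> stage a" "y \<in> stage b" by blast
    hence "x \<in> stage (max a b)" "y \<in> stage (max a b)"
      using stage_mono[of a "max a b"] stage_mono[of b "max a b"] by auto
    hence "x + y \<in> stage (Suc (max a b))" by force
    thus ?case by blast
  next
    case (scale x c)
    then obtain n where "x \<in> stage n" by blast
    hence "c *\<^sub>S x \<in> stage (Suc n)" by force
    thus ?case by blast
  next
    case (modS x)
    then obtain n where "x \<in> stage n" by blast
    hence "modS x \<in> stage (Suc n)" by simp
    thus ?case by blast
  qed
  thus "x \<in> (\<Union>n. stage n)" by blast
qed

text \<open>A nonzero vector spans a copy of the reals in \<open>S\<close>, so \<open>S\<close> is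
  infinite and at least as large as the set of complex scalars; then no layer is larger than
  \<open>S\<close>.\<close>

lemma gen_lepoll: "lepoll gen S"
proof (cases "S = {0}")
  case True
  thus ?thesis using gen_trivial[OF True] by (simp add: eqpoll_imp_lepoll singleton_eqpoll)
next
  case False
  then obtain v where v: "v \<in> S" "v \<noteq> 0" using zero_mem by blast
  then obtain i where i: "v i \<noteq> 0" by (auto simp: fun_eq_iff)
  have "inj (\<lambda>r. complex_of_real r *\<^sub>C v)"
    using i by (auto simp: inj_on_def fun_eq_iff)
  hence real: "lepoll (UNIV :: real set) S" using v by (auto simp: lepoll_def)
  have inf: "infinite S" using real lepoll_trans infinite_le_lepoll infinite_UNIV_char_0 by metis
  have "inj (\<lambda>z. (Re z, Im z))" by (auto simp: inj_on_def complex_eq_iff)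
  hence "lepoll (UNIV :: complex set) ((UNIV :: real set) \<times> (UNIV :: real set))"
    unfolding lepoll_def by blast
  hence complex: "lepoll (UNIV :: complex set) S"
    using infinite_times_lepoll[OF inf real real] lepoll_trans by blast
  have "lepoll (stage n) S" for n
  proof (induction n)
    case 0
    show ?case by (simp add: image_lepoll)
  next
    case (Suc n)
    thus ?case unfolding stage.simps
      by (intro infinite_Un_lepoll[OF inf] lepoll_trans[OF image_lepoll] infinite_times_lepoll[OF inf] complex)
  qed
  hence "lepoll (\<Union>n. stage n) S" by (rule infinite_UN_lepoll[OF inf])
  thus ?thesis using gen_subset_stages subset_imp_lepoll lepoll_trans by blast
qed

text \<open>The quotient by vanishing sequences is realised by chosen representatives, moved into
  \<open>A\<close> by the cardinality bound. With the carrier of E for \<open>A\<close>, the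
  quotient lives in the type of E.\<close>

lemma quotient_map:
  assumes "lepoll S A"
  obtains q where "\<And>x y. x \<in> gen \<Longrightarrow> y \<in> gen \<Longrightarrow> q x = q y \<longleftrightarrow> vanishing (x - y)"
    and "q ` gen \<subseteq> A"
proof -
  obtain j where j: "inj_on j gen" "j ` gen \<subseteq> A"
    using lepoll_trans[OF gen_lepoll assms] unfolding lepoll_def by blast
  \<comment> \<open>The predicate depends only on the class of x, so equivalent sequences get the
    same choice.\<close>
  define s where "s x = (SOME y. y \<in> gen \<and> vanishing (y - x))" for x
  have s: "s x \<in> gen \<and> vanishing (s x - x)" if "x \<in> gen" for x
  proof -
    have "x \<in> gen \<and> vanishing (x - x)" using that vanishing_zero by (simp only: diff_self)
    thus ?thesis unfolding s_def by (rule someI[where P = "\<lambda>y. y \<in> gen \<and> vanishing (y - x)"])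
  qed
  have s_eq: "s x = s y" if "vanishing (x - y)" for x y
  proof -
    have "vanishing (z - x) \<longleftrightarrow> vanishing (z - y)" for z
      using that vanishing_diff_trans vanishing_diff_sym by blast
    thus ?thesis by (simp add: s_def)
  qed
  show ?thesis
  proof (rule that[of "j \<circ> s"])
    fix x y assume xy: "x \<in> gen" "y \<in> gen"
    have "(j \<circ> s) x = (j \<circ> s) y \<longleftrightarrow> s x = s y"
      using j(1) s[OF xy(1)] s[OF xy(2)] by (auto dest: inj_onD)
    also have "\<dots> \<longleftrightarrow> vanishing (x - y)"
    proof
      assume "s x = s y"
      thus "vanishing (x - y)"
        using s[OF xy(1)] s[OF xy(2)] vanishing_diff_trans vanishing_diff_sym by metis
    qed (rule s_eq)
    finally show "(j \<circ> s) x = (j \<circ> s) y \<longleftrightarrow> vanishing (x - y)" .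
  qed (use j s in auto)
qed

end

section \<open>The quotient as a complex Archimedean vector lattice\<close>

locale gen_quotient = real_modulus_structure K S m
  for K S and m :: "('i \<Rightarrow> complex) \<Rightarrow> 'i \<Rightarrow> complex" +
  fixes q :: "(nat \<Rightarrow> 'i \<Rightarrow> complex) \<Rightarrow> 'b"
  assumes q_eq_iff: "x \<in> gen \<Longrightarrow> y \<in> gen \<Longrightarrow> q x = q y \<longleftrightarrow> vanishing (x - y)"
begin

definition rep where "rep a = (SOME x. x \<in> gen \<and> q x = a)"

text \<open>The ring multiplication and unit of the record are irrelevant.\<close>

definition EC :: "(complex, 'b) modulus_space" where
  "EC = \<lparr> carrier = q ` gen, monoid.mult = (\<lambda>a b. a), one = q 0, zero = q 0,
     add = (\<lambda>a b. q (rep a + rep b)), module.smult = (\<lambda>c a. q (c *\<^sub>S rep a)),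
     modulus = (\<lambda>a. q (modS (rep a))) \<rparr>"

lemma rep: "x \<in> gen \<Longrightarrow> rep (q x) \<in> gen \<and> q (rep (q x)) = q x"
  unfolding rep_def by (rule someI[of _ x]) simp

lemma rep_diff: "x \<in> gen \<Longrightarrow> vanishing (rep (q x) - x)"
  using rep[of x] q_eq_iff by blast

lemma q_EC [simp]: "x \<in> gen \<Longrightarrow> q x \<in> carrier EC"
  by (simp add: EC_def)

lemma EC_carrierE: assumes "a \<in> carrier EC" obtains x where "x \<in> gen" "a = q x"
  using assms by (auto simp: EC_def)

lemma q_zero: "\<zero>\<^bsub>EC\<^esub> = q 0"
  by (simp add: EC_def)

lemma q_add: assumes "x \<in> gen" "y \<in> gen" shows "q x \<oplus>\<^bsub>EC\<^esub> q y = q (x + y)"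
proof -
  have "(rep (q x) + rep (q y)) - (x + y) = (rep (q x) - x) + (rep (q y) - y)" by simp
  hence "vanishing ((rep (q x) + rep (q y)) - (x + y))"
    using assms by (simp only: rep_diff vanishing_add)
  thus ?thesis using assms rep by (simp add: EC_def q_eq_iff gen.add)
qed

lemma q_scale: assumes "x \<in> gen" shows "c \<odot>\<^bsub>EC\<^esub> q x = q (c *\<^sub>S x)"
proof -
  have "c *\<^sub>S rep (q x) - c *\<^sub>S x = c *\<^sub>S (rep (q x) - x)" by (simp add: fun_eq_iff algebra_simps)
  hence "vanishing (c *\<^sub>S rep (q x) - c *\<^sub>S x)"
    using assms by (simp only: rep_diff vanishing_scale)
  thus ?thesis using assms rep by (simp add: EC_def q_eq_iff gen.scale)
qed

lemma q_modS: assumes "x \<in> gen" shows "modulus EC (q x) = q (modS x)"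
proof -
  have "vanishing (modS (rep (q x)) - modS x)"
    using assms rep by (intro vanishing_modS_diff rep_diff gen_cauchy) simp_all
  thus ?thesis using assms rep by (simp add: EC_def q_eq_iff gen.modS)
qed

lemma abelian_group_EC: "abelian_group EC"
proof (rule abelian_groupI)
  fix a assume "a \<in> carrier EC"
  then obtain x where x: "x \<in> gen" "a = q x" by (rule EC_carrierE)
  show "\<zero>\<^bsub>EC\<^esub> \<oplus>\<^bsub>EC\<^esub> a = a" using x zero_gen by (simp add: q_zero q_add)
  have "q (- x) \<oplus>\<^bsub>EC\<^esub> q x = q 0" using x diff_gen[OF zero_gen x(1)] by (subst q_add) simp_all
  moreover have "q (- x) \<in> carrier EC" using diff_gen[OF zero_gen x(1)] by simp
  ultimately show "\<exists>b\<in>carrier EC. b \<oplus>\<^bsub>EC\<^esub> a = \<zero>\<^bsub>EC\<^esub>" using x by (auto simp: q_zero)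
  fix b assume "b \<in> carrier EC"
  then obtain y where y: "y \<in> gen" "b = q y" by (rule EC_carrierE)
  show "a \<oplus>\<^bsub>EC\<^esub> b \<in> carrier EC" "a \<oplus>\<^bsub>EC\<^esub> b = b \<oplus>\<^bsub>EC\<^esub> a"
    using x y by (simp_all add: q_add gen.add add.commute)
  fix c assume "c \<in> carrier EC"
  then obtain z where z: "z \<in> gen" "c = q z" by (rule EC_carrierE)
  show "a \<oplus>\<^bsub>EC\<^esub> b \<oplus>\<^bsub>EC\<^esub> c = a \<oplus>\<^bsub>EC\<^esub> (b \<oplus>\<^bsub>EC\<^esub> c)"
    using x y z by (simp add: q_add gen.add add.assoc)
qed (simp add: q_zero zero_gen)

lemma module_EC: "Module.module (ring_of_type_algebra :: complex ring) EC"
proof (rule moduleI)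
  show "cring (ring_of_type_algebra :: complex ring)" by (rule cring_from_type_algebra)
  fix c :: complex and a assume "a \<in> carrier EC"
  then obtain x where x: "x \<in> gen" "a = q x" by (rule EC_carrierE)
  show "c \<odot>\<^bsub>EC\<^esub> a \<in> carrier EC" using x by (simp add: q_scale gen.scale)
  show "\<one>\<^bsub>ring_of_type_algebra\<^esub> \<odot>\<^bsub>EC\<^esub> a = a" using x by (simp add: q_scale)
  show "(c \<otimes>\<^bsub>ring_of_type_algebra\<^esub> d) \<odot>\<^bsub>EC\<^esub> a = c \<odot>\<^bsub>EC\<^esub> (d \<odot>\<^bsub>EC\<^esub> a)" for d
    using x by (simp add: q_scale gen.scale)
  have "(c + d) *\<^sub>S x = c *\<^sub>S x + d *\<^sub>S x" for d by (simp add: fun_eq_iff algebra_simps)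
  thus "(c \<oplus>\<^bsub>ring_of_type_algebra\<^esub> d) \<odot>\<^bsub>EC\<^esub> a = c \<odot>\<^bsub>EC\<^esub> a \<oplus>\<^bsub>EC\<^esub> d \<odot>\<^bsub>EC\<^esub> a" for d
    using x by (simp add: q_scale gen.scale q_add)
  fix b assume "b \<in> carrier EC"
  then obtain y where y: "y \<in> gen" "b = q y" by (rule EC_carrierE)
  have "c *\<^sub>S (x + y) = c *\<^sub>S x + c *\<^sub>S y" by (simp add: fun_eq_iff algebra_simps)
  thus "c \<odot>\<^bsub>EC\<^esub> (a \<oplus>\<^bsub>EC\<^esub> b) = c \<odot>\<^bsub>EC\<^esub> a \<oplus>\<^bsub>EC\<^esub> c \<odot>\<^bsub>EC\<^esub> b"
    using x y by (simp add: q_scale gen.scale gen.add q_add)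
qed (rule abelian_group_EC)

sublocale EC: type_module EC
  by (rule type_module.intro) (rule module_EC)

lemma q_diff: assumes "x \<in> gen" "y \<in> gen" shows "q x \<ominus>\<^bsub>EC\<^esub> q y = q (x - y)"
proof -
  have "- y \<in> gen" using diff_gen[OF zero_gen assms(2)] by simp
  moreover have "\<ominus>\<^bsub>EC\<^esub> q y = q (- y)"
    using assms \<open>- y \<in> gen\<close> by (intro EC.M.minus_equality) (simp_all add: q_add q_zero)
  ultimately show ?thesis using assms by (simp add: a_minus_def q_add)
qed

lemma q_const_pos: "p \<in> pos \<Longrightarrow> q (\<lambda>_. p) \<in> positive_cone EC"
  using modS_of_pos[of "\<lambda>_. p"] by (simp add: positive_cone_def gen.const pos_S q_modS)

text \<open>Classes of positive constants and of sequences \<open>modS x\<close> are moduli, and a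
  general constant is a difference of positive ones.\<close>

lemma gen_in_hull: "x \<in> gen \<Longrightarrow> q x \<in> linear_hull EC (modulus EC ` carrier EC)"
proof (induction rule: gen.induct)
  let ?B = "modulus EC ` carrier EC"
  have B: "?B \<subseteq> carrier EC" by (auto elim!: EC_carrierE simp: q_modS gen.modS)
  {
    case (const f)
    then obtain p r where f: "f = p - r" and p: "p \<in> pos" and r: "r \<in> pos" using S_R by (auto simp: R_def)
    have "q (\<lambda>_. u) \<in> linear_hull EC ?B" if "u \<in> pos" for u
    proof -
      have "q (\<lambda>_. u) = modulus EC (q (\<lambda>_. u))" "q (\<lambda>_. u) \<in> carrier EC"
        using q_const_pos[OF that] by (auto simp: positive_cone_def)
      thus ?thesis by (intro EC.linear_hull_superset[OF B]) blast
    qed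
    moreover have "q (\<lambda>_. f) = q (\<lambda>_. p) \<oplus>\<^bsub>EC\<^esub> (- 1) \<odot>\<^bsub>EC\<^esub> q (\<lambda>_. r)"
    proof -
      have "(\<lambda>_. f) = (\<lambda>_. p) + (- 1) *\<^sub>S (\<lambda>_::nat. r)" by (simp add: fun_eq_iff f)
      thus ?thesis using p r by (simp only: q_scale q_add gen.const gen.scale pos_S)
    qed
    ultimately show ?case using p r B by (simp add: EC.linear_hull_add EC.linear_hull_scale)
  next
    case (add x y)
    show ?case using EC.linear_hull_add[OF B add.IH] unfolding q_add[OF add.hyps] .
  next
    case (scale x c)
    show ?case using EC.linear_hull_scale[OF B scale.IH] unfolding q_scale[OF scale.hyps] .
  next
    case (modS x)
    hence "q (modS x) \<in> ?B" by (auto simp: q_modS[symmetric] intro!: imageI)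
    thus ?case by (rule EC.linear_hull_superset[OF B])
  }
qed

lemma archimedean_vector_lattice_EC: "archimedean_vector_lattice EC"
proof
  fix a assume "a \<in> carrier EC"
  then obtain x where x: "x \<in> gen" "a = q x" by (rule EC_carrierE)
  show "modulus EC a \<in> carrier EC" using x by (simp add: q_modS gen.modS)
  show "modulus EC (modulus EC a) = modulus EC a"
    using x modS_modS gen_cauchy by (simp add: q_modS gen.modS)
  show "modulus EC (c \<odot>\<^bsub>EC\<^esub> a) = of_real (norm c) \<odot>\<^bsub>EC\<^esub> modulus EC a" for c
    using x modS_scale[OF gen_cauchy[OF x(1)], of c] by (simp add: q_modS q_scale gen.modS gen.scale q_eq_iff)
  fix b assume "b \<in> carrier EC"
  then obtain y where y: "y \<in> gen" "b = q y" by (rule EC_carrierE)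
  show "modulus EC (modulus EC (modulus EC a \<oplus>\<^bsub>EC\<^esub> modulus EC b) \<ominus>\<^bsub>EC\<^esub> modulus EC (a \<oplus>\<^bsub>EC\<^esub> b)) =
      modulus EC a \<oplus>\<^bsub>EC\<^esub> modulus EC b \<ominus>\<^bsub>EC\<^esub> modulus EC (a \<oplus>\<^bsub>EC\<^esub> b)"
    using x y modS_add[OF gen_cauchy[OF x(1)] gen_cauchy[OF y(1)]]
    by (simp add: q_modS q_add q_diff gen.modS gen.add diff_gen)
  assume *: "\<And>n::nat. modulus EC (modulus EC b \<ominus>\<^bsub>EC\<^esub> of_nat n \<odot>\<^bsub>EC\<^esub> modulus EC a) =
      modulus EC b \<ominus>\<^bsub>EC\<^esub> of_nat n \<odot>\<^bsub>EC\<^esub> modulus EC a"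
  have "vanishing x"
  proof (rule modS_archimedean[OF gen_cauchy[OF x(1)] gen_cauchy[OF y(1)]])
    fix n :: nat
    show "vanishing (modS (modS y - of_nat n *\<^sub>S modS x) - (modS y - of_nat n *\<^sub>S modS x))"
      using *[of n] x y by (simp add: q_modS q_scale q_diff gen.modS gen.scale diff_gen q_eq_iff)
  qed
  thus "a = \<zero>\<^bsub>EC\<^esub>" using x zero_gen by (simp add: q_zero q_eq_iff)
next
  have B: "modulus EC ` carrier EC \<subseteq> carrier EC" by (auto elim!: EC_carrierE simp: q_modS gen.modS)
  show "linear_hull EC (modulus EC ` carrier EC) = carrier EC"
  proof
    show "linear_hull EC (modulus EC ` carrier EC) \<subseteq> carrier EC"
      using B by (intro EC.linear_hull_minimal) auto
    show "carrier EC \<subseteq> linear_hull EC (modulus EC ` carrier EC)"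
      by (auto elim!: EC_carrierE intro: gen_in_hull)
  qed
qed

end

section \<open>Extension of lattice homomorphisms\<close>

locale lattice_hom = A: real_modulus_structure K S m + B: complex_modulus_structure S' m'
  for K S and m :: "('i \<Rightarrow> complex) \<Rightarrow> 'i \<Rightarrow> complex" and S' and m' :: "('j \<Rightarrow> complex) \<Rightarrow> 'j \<Rightarrow> complex" +
  fixes \<tau> :: "('i \<Rightarrow> complex) \<Rightarrow> 'j \<Rightarrow> complex"
  assumes tau_R [simp]: "x \<in> S \<Longrightarrow> \<tau> x \<in> B.R"
    and tau_add: "x \<in> S \<Longrightarrow> y \<in> S \<Longrightarrow> \<tau> (x + y) = \<tau> x + \<tau> y"
    and tau_scale: "x \<in> S \<Longrightarrow> \<tau> (complex_of_real r *\<^sub>C x) = complex_of_real r *\<^sub>C \<tau> x"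
    and tau_m: "x \<in> S \<Longrightarrow> \<tau> (m x) = m' (\<tau> x)"
begin

lemma tau_zero: "\<tau> 0 = 0"
  using tau_scale[of 0 0] by simp

lemma tau_diff: assumes "x \<in> S" "y \<in> S" shows "\<tau> (x - y) = \<tau> x - \<tau> y"
proof -
  have "\<tau> (x - y) + \<tau> y = \<tau> ((x - y) + y)" using assms by (intro tau_add[symmetric]) simp_all
  thus ?thesis by (simp only: diff_add_cancel eq_diff_eq)
qed

lemma tau_pos: assumes "x \<in> A.pos" shows "\<tau> x \<in> B.pos"
proof -
  have "m' (\<tau> x) = \<tau> x" using tau_m[of x, symmetric] assms by (simp add: A.m_eq A.pos_S)
  moreover have "\<tau> x \<in> S'" using assms by (intro B.R_S tau_R A.pos_S)
  ultimately show ?thesis by (simp add: B.pos_def)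
qed

lemma tau_mono: assumes "A.le x y" "x \<in> S" "y \<in> S" shows "B.le (\<tau> x) (\<tau> y)"
  using tau_pos[of "y - x"] assms by (simp add: A.le_def B.le_def tau_diff)

text \<open>The finite suprema are built from sums, real multiples and the modulus only.\<close>

lemma tau_ray_sup:
  assumes fg: "f \<in> S" "g \<in> S"
  shows "\<tau> (ray_sup m ts f g) = ray_sup m' ts (\<tau> f) (\<tau> g)"
proof (induction ts)
  case Nil
  have "ray_sup m [] f g = 0" "ray_sup m' [] (\<tau> f) (\<tau> g) = 0" by (simp_all add: ray_sup_def)
  thus ?case by (simp only: tau_zero)
next
  case (Cons t ts)
  have ray: "ray t f g \<in> S" "\<tau> (ray t f g) = ray t (\<tau> f) (\<tau> g)"
    using fg by (simp_all add: ray_def tau_add tau_scale)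
  have sup: "\<tau> (vsup m x y) = vsup m' (\<tau> x) (\<tau> y)" if "x \<in> S" "y \<in> S" for x y
    unfolding vsup_def using that by (subst tau_scale) (simp_all add: tau_add tau_m tau_diff)
  have "ray_sup m ts f g \<in> S" using fg by (simp add: A.R_S)
  thus ?case using sup[OF ray(1), of "ray_sup m ts f g"] Cons.IH ray(2) by (simp add: ray_sup_def)
qed

definition ctau where "ctau z = \<tau> (reV z) + \<i> *\<^sub>C \<tau> (imV z)"

lemma ctau_mem [simp]: "z \<in> A.CS \<Longrightarrow> ctau z \<in> S'"
  by (simp add: ctau_def B.R_S)

lemma ctau_real: "x \<in> S \<Longrightarrow> ctau x = \<tau> x"
  by (simp add: ctau_def tau_zero)

lemma ctau_add: "x \<in> A.CS \<Longrightarrow> y \<in> A.CS \<Longrightarrow> ctau (x + y) = ctau x + ctau y"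
  by (simp add: ctau_def tau_add vec)

lemma ctau_diff: "x \<in> A.CS \<Longrightarrow> y \<in> A.CS \<Longrightarrow> ctau (x - y) = ctau x - ctau y"
  by (simp add: ctau_def tau_diff vec)

lemma ctau_scale: assumes "x \<in> A.CS" shows "ctau (c *\<^sub>C x) = c *\<^sub>C ctau x"
proof -
  have c: "c = complex_of_real (Re c) + \<i> * complex_of_real (Im c)" by (simp add: complex_eq_iff)
  have "ctau (c *\<^sub>C x) = (complex_of_real (Re c) + \<i> * complex_of_real (Im c)) *\<^sub>C ctau x"
    using assms by (simp add: ctau_def reV_scale imV_scale tau_add tau_diff tau_scale vec)
  thus ?thesis using c by simp
qed

lemma m_ctau_le: assumes "z \<in> A.CS" shows "B.le (m' (ctau z)) (\<tau> (A.N1 z))"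
proof -
  have "B.le (m' (ctau z)) (m' (\<tau> (reV z)) + m' (\<i> *\<^sub>C \<tau> (imV z)))"
    unfolding ctau_def using assms by (intro B.m_triangle) (simp_all add: B.R_S)
  moreover have "m' (\<i> *\<^sub>C \<tau> (imV z)) = m' (\<tau> (imV z))" using assms by (intro B.m_unit) (simp_all add: B.R_S)
  ultimately show ?thesis using assms by (simp add: A.N1_def tau_add tau_m)
qed

text \<open>
  \<open>y\<close> is the limit of the images of the terms of \<open>x\<close>; this defines the extension of \<open>\<tau>\<close> without
  requiring any completeness of the target.
\<close>

definition approx where
  "approx x y \<longleftrightarrow> y \<in> S' \<and>
     (\<exists>u\<in>A.pos. \<forall>n. B.le (m' (y - ctau (x n))) (complex_of_real (eps n) *\<^sub>C \<tau> u))"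

lemma approx_const: "f \<in> S \<Longrightarrow> approx (\<lambda>_. f) (\<tau> f)"
  by (auto simp: approx_def B.R_S ctau_real tau_zero intro!: bexI[of _ 0])

lemma approx_add:
  assumes "A.cauchy x" "A.cauchy x'" "approx x y" "approx x' y'" shows "approx (x + x') (y + y')"
proof -
  obtain u u' where u: "u \<in> A.pos" "u' \<in> A.pos" and y: "y \<in> S'" "y' \<in> S'"
    and le: "\<And>n. B.le (m' (y - ctau (x n))) (complex_of_real (eps n) *\<^sub>C \<tau> u)"
      "\<And>n. B.le (m' (y' - ctau (x' n))) (complex_of_real (eps n) *\<^sub>C \<tau> u')"
    using assms unfolding approx_def by metis
  have CS: "x n \<in> A.CS" "x' n \<in> A.CS" for n using assms A.cauchy_CS by blast+
  have "B.le (m' ((y + y') - ctau ((x + x') n))) (complex_of_real (eps n) *\<^sub>C \<tau> (u + u'))" for n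
  proof -
    have eq: "(y + y') - ctau ((x + x') n) = (y - ctau (x n)) + (y' - ctau (x' n))"
      using CS by (simp add: ctau_add)
    have "B.le (m' ((y + y') - ctau ((x + x') n))) (m' (y - ctau (x n)) + m' (y' - ctau (x' n)))"
      unfolding eq using y CS by (intro B.m_triangle) simp_all
    moreover have "B.le (m' (y - ctau (x n)) + m' (y' - ctau (x' n)))
        (complex_of_real (eps n) *\<^sub>C \<tau> u + complex_of_real (eps n) *\<^sub>C \<tau> u')"
      by (intro B.le_add_mono le)
    ultimately show ?thesis
      unfolding tau_add[OF u[THEN A.pos_S]] cscale_add by (rule B.le_trans)
  qed
  thus ?thesis using y u A.pos_add[OF u] unfolding approx_def by (blast intro: B.add_mem)
qed

lemma approx_scale:
  assumes "A.cauchy x" "approx x y" shows "approx (c *\<^sub>S x) (c *\<^sub>C y)"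
proof -
  obtain u where u: "u \<in> A.pos" and y: "y \<in> S'"
    and le: "\<And>n. B.le (m' (y - ctau (x n))) (complex_of_real (eps n) *\<^sub>C \<tau> u)"
    using assms unfolding approx_def by metis
  have CS: "x n \<in> A.CS" for n using assms A.cauchy_CS by blast
  have "B.le (m' (c *\<^sub>C y - ctau ((c *\<^sub>S x) n))) (complex_of_real (eps n) *\<^sub>C \<tau> (complex_of_real (norm c) *\<^sub>C u))" for n
  proof -
    have "c *\<^sub>C y - ctau ((c *\<^sub>S x) n) = c *\<^sub>C (y - ctau (x n))"
      using CS by (simp add: ctau_scale) (simp add: vec)
    hence eq: "m' (c *\<^sub>C y - ctau ((c *\<^sub>S x) n)) = complex_of_real (norm c) *\<^sub>C m' (y - ctau (x n))"
      using y CS by (simp add: B.m_scale)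
    have "B.le (m' (c *\<^sub>C y - ctau ((c *\<^sub>S x) n))) (complex_of_real (norm c) *\<^sub>C complex_of_real (eps n) *\<^sub>C \<tau> u)"
      unfolding eq by (intro B.le_scale_mono le) simp
    thus ?thesis using u by (simp add: tau_scale A.pos_S mult.commute)
  qed
  moreover have "complex_of_real (norm c) *\<^sub>C u \<in> A.pos" using u by (intro A.pos_scale) simp_all
  moreover have "c *\<^sub>C y \<in> S'" using y by simp
  ultimately show ?thesis unfolding approx_def by blast
qed

text \<open>Compare |y| with the modulus of the n-th image by the reverse triangle inequality, then
  that modulus with its grid supremum by \<open>sigma_approx\<close>. The second error is controlled
  because the sequence is bounded and \<tau> is monotone.\<close>

lemma approx_modS:
  assumes x: "A.cauchy x" and "approx x y" shows "approx (A.modS x) (m' y)"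
proof -
  obtain u where u: "u \<in> A.pos" and y: "y \<in> S'"
    and le: "\<And>n. B.le (m' (y - ctau (x n))) (complex_of_real (eps n) *\<^sub>C \<tau> u)"
    using assms unfolding approx_def by metis
  obtain b where b: "b \<in> A.pos" "\<And>n. A.le (A.N1 (x n)) b" using A.cauchy_bounded[OF x] by blast
  have CS: "x n \<in> A.CS" for n using assms A.cauchy_CS by blast
  have "B.le (m' (m' y - ctau (A.modS x n))) (complex_of_real (eps n) *\<^sub>C \<tau> (u + b))" for n
  proof -
    have R: "\<tau> (reV (x n)) \<in> B.R" "\<tau> (imV (x n)) \<in> B.R" using CS by simp_all
    let ?s = "B.\<sigma> n (\<tau> (reV (x n))) (\<tau> (imV (x n)))"
    have s: "ctau (A.modS x n) = ?s"
      using CS by (simp add: ctau_real) (simp add: A.modS_def tau_ray_sup)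
    have sS: "?s \<in> S'" using R by (simp add: B.R_S)
    have N1: "\<tau> (A.N1 (x n)) = m' (\<tau> (reV (x n))) + m' (\<tau> (imV (x n)))"
      using CS by (simp add: A.N1_def tau_add tau_m)
    have eq: "m' y - ?s = (m' y - m' (ctau (x n))) + (m' (ctau (x n)) - ?s)" by simp
    have 1: "B.le (m' (m' y - ?s)) (m' (m' y - m' (ctau (x n))) + m' (m' (ctau (x n)) - ?s))"
      unfolding eq using y CS sS by (intro B.m_triangle B.diff_mem B.m_mem ctau_mem)
    have 2: "B.le (m' (m' y - m' (ctau (x n)))) (complex_of_real (eps n) *\<^sub>C \<tau> u)"
      using y CS by (intro B.le_trans[OF B.m_diff_le le]) simp_all
    have "B.le (m' (m' (ctau (x n)) - ?s)) (complex_of_real (eps n) *\<^sub>C \<tau> (A.N1 (x n)))"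
      using B.sigma_approx[OF R, of n] unfolding N1 ctau_def eps_def .
    moreover have "B.le (complex_of_real (eps n) *\<^sub>C \<tau> (A.N1 (x n))) (complex_of_real (eps n) *\<^sub>C \<tau> b)"
      using b CS by (intro B.le_scale_mono tau_mono) (simp_all add: A.pos_S)
    ultimately have 3: "B.le (m' (m' (ctau (x n)) - ?s)) (complex_of_real (eps n) *\<^sub>C \<tau> b)"
      by (rule B.le_trans)
    show ?thesis
      unfolding s tau_add[OF u(1)[THEN A.pos_S] b(1)[THEN A.pos_S]] cscale_add
      by (rule B.le_trans[OF 1 B.le_add_mono[OF 2 3]])
  qed
  moreover have "u + b \<in> A.pos" using u b by (intro A.pos_add)
  moreover have "m' y \<in> S'" using y by simp
  ultimately show ?thesis unfolding approx_def by blast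
qed

text \<open>Gives at once the uniqueness of the limit and its independence of the representative of
  a class: |y - y'| is at most eps n times a fixed vector.\<close>

lemma approx_unique:
  assumes "A.cauchy x" "A.cauchy x'" "A.vanishing (x - x')" "approx x y" "approx x' y'"
  shows "y = y'"
proof -
  obtain u u' where u: "u \<in> A.pos" "u' \<in> A.pos" and y: "y \<in> S'" "y' \<in> S'"
    and le: "\<And>n. B.le (m' (y - ctau (x n))) (complex_of_real (eps n) *\<^sub>C \<tau> u)"
      "\<And>n. B.le (m' (y' - ctau (x' n))) (complex_of_real (eps n) *\<^sub>C \<tau> u')"
    using assms unfolding approx_def by metis
  obtain w where w: "w \<in> A.pos" "\<And>n. A.le (A.N1 ((x - x') n)) (complex_of_real (eps n) *\<^sub>C w)"
    using assms(3) unfolding A.vanishing_def by metis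
  have CS: "x n \<in> A.CS" "x' n \<in> A.CS" for n using assms A.cauchy_CS by blast+
  let ?v = "\<tau> u + \<tau> w + \<tau> u'"
  have v: "?v \<in> B.pos" using u w by (intro B.pos_add tau_pos)
  have "B.le (m' (y - y')) (0 + complex_of_real (eps n) *\<^sub>C ?v)" for n
  proof -
    have z: "x n - x' n \<in> A.CS" using CS by simp
    have eq: "y - y' = ((y - ctau (x n)) + ctau (x n - x' n)) + - (y' - ctau (x' n))"
      using CS by (simp add: ctau_diff)
    have "B.le (m' (ctau (x n - x' n))) (\<tau> (A.N1 (x n - x' n)))" using z by (rule m_ctau_le)
    moreover have "B.le (\<tau> (A.N1 (x n - x' n))) (\<tau> (complex_of_real (eps n) *\<^sub>C w))"
      using w(2)[of n] w(1) z by (intro tau_mono) (simp_all add: A.pos_S)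
    ultimately have 2: "B.le (m' (ctau (x n - x' n))) (complex_of_real (eps n) *\<^sub>C \<tau> w)"
      using w by (auto simp: tau_scale A.pos_S intro: B.le_trans)
    have "B.le (m' (y - y')) (m' ((y - ctau (x n)) + ctau (x n - x' n)) + m' (- (y' - ctau (x' n))))"
      unfolding eq using y CS z by (intro B.m_triangle) simp_all
    moreover have "m' (- (y' - ctau (x' n))) = m' (y' - ctau (x' n))"
      using y CS by (intro B.m_uminus) simp
    ultimately have 1: "B.le (m' (y - y')) (m' ((y - ctau (x n)) + ctau (x n - x' n)) + m' (y' - ctau (x' n)))"
      by (simp only:)
    have 3: "B.le (m' ((y - ctau (x n)) + ctau (x n - x' n))) (m' (y - ctau (x n)) + m' (ctau (x n - x' n)))"
      using y CS z by (intro B.m_triangle) simp_all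
    have "B.le (m' (y - y')) ((complex_of_real (eps n) *\<^sub>C \<tau> u + complex_of_real (eps n) *\<^sub>C \<tau> w) + complex_of_real (eps n) *\<^sub>C \<tau> u')"
      by (rule B.le_trans[OF 1 B.le_add_mono[OF B.le_trans[OF 3 B.le_add_mono[OF le(1) 2]] le(2)]])
    thus ?thesis by (simp add: cscale_add)
  qed
  note le0 = this
  have "m' (y - y') \<in> B.R" using y by simp
  hence "B.le (m' (y - y')) 0" by (rule B.arch_eps[folded eps_def, OF _ B.zero_R v le0])
  moreover have "B.le 0 (m' (y - y'))"
    unfolding B.zero_le_iff by (intro B.m_pos B.diff_mem y)
  ultimately have "m' (y - y') = 0" by (rule B.le_antisym)
  hence "y - y' = 0" by (rule B.m_eq_zero[OF B.diff_mem[OF y]])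
  thus ?thesis by (simp only: right_minus_eq)
qed

end

section \<open>The universal property\<close>

lemma rho_simps [simp]:
  "add (rho E) = add E" "zero (rho E) = zero E" "modulus (rho E) = modulus E"
  "c \<odot>\<^bsub>rho E\<^esub> v = of_real c \<odot>\<^bsub>E\<^esub> v"
  by (simp_all add: rho_def)

lemma rho_carrier:
  "carrier (rho E) = {f \<ominus>\<^bsub>E\<^esub> g | f g. f \<in> positive_cone E \<and> g \<in> positive_cone E}"
  by (simp add: rho_def)

lemma vl_homI:
  assumes "\<And>f. f \<in> carrier E \<Longrightarrow> T f \<in> carrier F"
    and "\<And>f g. f \<in> carrier E \<Longrightarrow> g \<in> carrier E \<Longrightarrow> T (f \<oplus>\<^bsub>E\<^esub> g) = T f \<oplus>\<^bsub>F\<^esub> T g"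
    and "\<And>c f. f \<in> carrier E \<Longrightarrow> T (c \<odot>\<^bsub>E\<^esub> f) = c \<odot>\<^bsub>F\<^esub> T f"
    and "\<And>f. f \<in> carrier E \<Longrightarrow> T (modulus E f) = modulus F (T f)"
  shows "T \<in> vl_hom E F"
  using assms by (auto simp: vl_hom_def)

lemma vl_homD:
  assumes "T \<in> vl_hom E F" "f \<in> carrier E"
  shows "T f \<in> carrier F" "T (c \<odot>\<^bsub>E\<^esub> f) = c \<odot>\<^bsub>F\<^esub> T f" "T (modulus E f) = modulus F (T f)"
    and "g \<in> carrier E \<Longrightarrow> T (f \<oplus>\<^bsub>E\<^esub> g) = T f \<oplus>\<^bsub>F\<^esub> T g"
  using assms by (auto simp: vl_hom_def)

lemma vl_hom_comp:
  assumes "T \<in> vl_hom E F" "U \<in> vl_hom F G" shows "(\<lambda>x. U (T x)) \<in> vl_hom E G"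
  using vl_homD[OF assms(1)] vl_homD[OF assms(2)] by (intro vl_homI) simp_all

lemma vl_hom_id: "(\<lambda>x. x) \<in> vl_hom E E"
  by (rule vl_homI) simp_all

lemma vl_hom_restrict:
  assumes "archimedean_vector_lattice E" "T \<in> vl_hom E F"
  shows "restrict T (carrier E) \<in> vl_hom E F"
proof -
  interpret archimedean_vector_lattice E by fact
  show ?thesis using vl_homD[OF assms(2)] modulus_closed by (intro vl_homI) simp_all
qed

lemma vl_hom_minus:
  assumes "archimedean_vector_lattice E" "archimedean_vector_lattice F" and T: "T \<in> vl_hom E F"
    and fg: "f \<in> carrier E" "g \<in> carrier E"
  shows "T (f \<ominus>\<^bsub>E\<^esub> g) = T f \<ominus>\<^bsub>F\<^esub> T g"
proof -
  interpret E: archimedean_vector_lattice E by fact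
  interpret F: archimedean_vector_lattice F by fact
  have "f \<ominus>\<^bsub>E\<^esub> g \<oplus>\<^bsub>E\<^esub> g = f" using fg by (simp add: E.M.minus_eq E.M.a_assoc E.M.l_neg)
  hence "T (f \<ominus>\<^bsub>E\<^esub> g) \<oplus>\<^bsub>F\<^esub> T g = T f" using vl_homD(4)[OF T, of "f \<ominus>\<^bsub>E\<^esub> g" g] fg by simp
  moreover have "T (f \<ominus>\<^bsub>E\<^esub> g) \<in> carrier F" "T g \<in> carrier F" "T f \<in> carrier F" using fg vl_homD(1)[OF T] by simp_all
  ultimately show ?thesis
    by (metis F.M.minus_eq F.M.a_inv_closed F.M.a_assoc F.M.r_neg F.M.r_zero)
qed

lemma rho_carrier_subset:
  assumes "archimedean_vector_lattice E" shows "carrier (rho E) \<subseteq> carrier E"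
proof -
  interpret archimedean_vector_lattice E by fact
  show ?thesis by (auto simp: rho_carrier positive_cone_def)
qed

text \<open>Commuting with the modulus, T maps the positive cone into the positive cone, hence
  \<open>rho EC\<close> into \<open>rho F\<close>. The composite is thus again a map to which the
  universal property applies.\<close>

lemma vl_hom_comp_rho:
  fixes F :: "(complex, 'f) modulus_space"
  assumes avl: "archimedean_vector_lattice EC" "archimedean_vector_lattice F"
    and \<phi>: "\<phi> \<in> vl_hom E (rho EC)" and T: "T \<in> vl_hom EC F"
  shows "(\<lambda>f. T (\<phi> f)) \<in> vl_hom E (rho F)"
proof (rule vl_hom_comp[OF \<phi>], rule vl_homI)
  note sub = rho_carrier_subset[OF avl(1)]
  fix x assume x: "x \<in> carrier (rho EC)"
  then obtain p q where x_eq: "x = p \<ominus>\<^bsub>EC\<^esub> q" and pq: "p \<in> positive_cone EC" "q \<in> positive_cone EC"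
    by (auto simp: rho_carrier)
  hence c: "p \<in> carrier EC" "q \<in> carrier EC" by (auto simp: positive_cone_def)
  have "T r \<in> positive_cone F" if "r \<in> positive_cone EC" for r
    using vl_homD(1,3)[OF T, of r] that by (simp add: positive_cone_def)
  moreover have "T x = T p \<ominus>\<^bsub>F\<^esub> T q" unfolding x_eq by (rule vl_hom_minus[OF avl T c])
  ultimately show "T x \<in> carrier (rho F)" using pq by (auto simp: rho_carrier)
  show "T (c \<odot>\<^bsub>rho EC\<^esub> x) = c \<odot>\<^bsub>rho F\<^esub> T x" for c
    using vl_homD(2)[OF T] x sub by auto
  show "T (modulus (rho EC) x) = modulus (rho F) (T x)"
    using vl_homD(3)[OF T] x sub by auto
  fix y assume "y \<in> carrier (rho EC)"
  thus "T (x \<oplus>\<^bsub>rho EC\<^esub> y) = T x \<oplus>\<^bsub>rho F\<^esub> T y"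
    using vl_homD(4)[OF T, of x y] x sub by auto
qed

section \<open>Comparison of complexifications\<close>

lemma vl_complexification_lift:
  fixes F :: "(complex, 'f) modulus_space"
  assumes "vl_complexification TYPE('f) E EC \<phi>" "archimedean_vector_lattice F" "T \<in> vl_hom E (rho F)"
  obtains T' where "T' \<in> vl_hom EC F" "\<And>f. f \<in> carrier E \<Longrightarrow> T' (\<phi> f) = T f"
  using assms unfolding vl_complexification_def by blast

text \<open>Uniqueness in the definition is among extensional maps; restricting both maps to the
  carrier turns it into agreement on the carrier.\<close>

lemma vl_complexification_unique:
  fixes F :: "(complex, 'f) modulus_space"
  assumes EC: "vl_complexification TYPE('f) E EC \<phi>" and F: "archimedean_vector_lattice F"
    and T: "T \<in> vl_hom EC F" "T' \<in> vl_hom EC F"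
    and eq: "\<And>f. f \<in> carrier E \<Longrightarrow> T (\<phi> f) = T' (\<phi> f)" and x: "x \<in> carrier EC"
  shows "T x = T' x"
proof -
  have avl: "archimedean_vector_lattice EC" and \<phi>: "\<phi> \<in> vl_hom E (rho EC)"
    using EC by (auto simp: vl_complexification_def)
  have "(\<lambda>f. T (\<phi> f)) \<in> vl_hom E (rho F)" by (rule vl_hom_comp_rho[OF avl F \<phi> T(1)])
  hence "\<exists>!U. U \<in> vl_hom EC F \<inter> extensional (carrier EC) \<and> (\<forall>f\<in>carrier E. U (\<phi> f) = T (\<phi> f))"
    using EC F by (auto simp: vl_complexification_def)
  moreover have "\<phi> f \<in> carrier EC" if "f \<in> carrier E" for f
    using vl_homD(1)[OF \<phi> that] rho_carrier_subset[OF avl] by auto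
  hence "restrict U (carrier EC) \<in> vl_hom EC F \<inter> extensional (carrier EC) \<and>
      (\<forall>f\<in>carrier E. restrict U (carrier EC) (\<phi> f) = T (\<phi> f))"
    if "U \<in> vl_hom EC F" "\<forall>f\<in>carrier E. U (\<phi> f) = T (\<phi> f)" for U
    using that vl_hom_restrict[OF avl] by auto
  ultimately have "restrict T (carrier EC) = restrict T' (carrier EC)"
    using T eq by (metis (no_types, lifting))
  thus ?thesis using x by (metis restrict_apply')
qed

text \<open>Each space is tested against the other to obtain the comparison maps, and against itself
  to recognise the round trips as identities. Hence the four hypotheses.\<close>

lemma vl_complexification_compare:
  fixes EC :: "(complex, 'b) modulus_space" and EC' :: "(complex, 'c) modulus_space"
  assumes EC: "vl_complexification TYPE('b) E EC \<phi>" "vl_complexification TYPE('c) E EC \<phi>"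
    and EC': "vl_complexification TYPE('b) E EC' \<phi>'" "vl_complexification TYPE('c) E EC' \<phi>'"
  obtains \<psi> \<chi> where "\<psi> \<in> vl_hom EC EC'" "\<chi> \<in> vl_hom EC' EC"
    and "\<And>f. f \<in> carrier E \<Longrightarrow> \<psi> (\<phi> f) = \<phi>' f" "\<And>f. f \<in> carrier E \<Longrightarrow> \<chi> (\<phi>' f) = \<phi> f"
    and "\<And>x. x \<in> carrier EC \<Longrightarrow> \<chi> (\<psi> x) = x" "\<And>y. y \<in> carrier EC' \<Longrightarrow> \<psi> (\<chi> y) = y"
proof -
  have avl: "archimedean_vector_lattice EC" "archimedean_vector_lattice EC'"
    and \<phi>: "\<phi> \<in> vl_hom E (rho EC)" "\<phi>' \<in> vl_hom E (rho EC')"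
    using EC EC' by (auto simp: vl_complexification_def)
  obtain \<psi> where \<psi>: "\<psi> \<in> vl_hom EC EC'" "\<And>f. f \<in> carrier E \<Longrightarrow> \<psi> (\<phi> f) = \<phi>' f"
    using vl_complexification_lift[OF EC(2) avl(2) \<phi>(2)] by blast
  obtain \<chi> where \<chi>: "\<chi> \<in> vl_hom EC' EC" "\<And>f. f \<in> carrier E \<Longrightarrow> \<chi> (\<phi>' f) = \<phi> f"
    using vl_complexification_lift[OF EC'(1) avl(1) \<phi>(1)] by blast
  have "\<chi> (\<psi> x) = x" if "x \<in> carrier EC" for x
    using vl_complexification_unique[OF EC(1) avl(1) vl_hom_comp[OF \<psi>(1) \<chi>(1)] vl_hom_id _ that]
    by (simp add: \<psi> \<chi>)
  moreover have "\<psi> (\<chi> y) = y" if "y \<in> carrier EC'" for y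
    using vl_complexification_unique[OF EC'(2) avl(2) vl_hom_comp[OF \<chi>(1) \<psi>(1)] vl_hom_id _ that]
    by (simp add: \<psi> \<chi>)
  ultimately show ?thesis using that \<psi> \<chi> by blast
qed

text \<open>The comparison maps between \<open>EC0\<close> and \<open>EC\<close> use only test
  spaces of type \<open>'b\<close>, the type of both. Composing with them carries existence and
  uniqueness for \<open>'f\<close> from \<open>EC0\<close> to \<open>EC\<close>.\<close>

lemma vl_complexification_transfer:
  fixes EC0 EC :: "(complex, 'b) modulus_space"
  assumes EC0: "vl_complexification TYPE('b) E EC0 \<phi>0" "vl_complexification TYPE('f) E EC0 \<phi>0"
    and EC: "vl_complexification TYPE('b) E EC \<phi>"
  shows "vl_complexification TYPE('f) E EC \<phi>"
proof -
  obtain \<psi> \<chi> where \<psi>: "\<psi> \<in> vl_hom EC0 EC" "\<And>f. f \<in> carrier E \<Longrightarrow> \<psi> (\<phi>0 f) = \<phi> f"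
    and \<chi>: "\<chi> \<in> vl_hom EC EC0" "\<And>f. f \<in> carrier E \<Longrightarrow> \<chi> (\<phi> f) = \<phi>0 f"
    and inv: "\<And>y. y \<in> carrier EC \<Longrightarrow> \<psi> (\<chi> y) = y"
    by (rule vl_complexification_compare[OF EC0(1) EC0(1) EC EC]) (rule that)
  have avl: "archimedean_vector_lattice EC" and \<phi>: "\<phi> \<in> vl_hom E (rho EC)" "inj_on \<phi> (carrier E)"
    using EC by (auto simp: vl_complexification_def)
  have \<phi>_mem: "\<phi> f \<in> carrier EC" if "f \<in> carrier E" for f
    using vl_homD(1)[OF \<phi>(1) that] rho_carrier_subset[OF avl] by auto
  have "\<exists>!T'. T' \<in> vl_hom EC F \<inter> extensional (carrier EC) \<and> (\<forall>f\<in>carrier E. T' (\<phi> f) = T f)"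
    if F: "archimedean_vector_lattice F" and T: "T \<in> vl_hom E (rho F)" for F :: "(complex, 'f) modulus_space" and T
  proof (rule ex_ex1I)
    obtain T0 where T0: "T0 \<in> vl_hom EC0 F" "\<And>f. f \<in> carrier E \<Longrightarrow> T0 (\<phi>0 f) = T f"
      using vl_complexification_lift[OF EC0(2) F T] by blast
    show "\<exists>T'. T' \<in> vl_hom EC F \<inter> extensional (carrier EC) \<and> (\<forall>f\<in>carrier E. T' (\<phi> f) = T f)"
      using vl_hom_restrict[OF avl vl_hom_comp[OF \<chi>(1) T0(1)]] T0(2) \<chi>(2) \<phi>_mem
      by (intro exI[of _ "restrict (\<lambda>x. T0 (\<chi> x)) (carrier EC)"]) auto
  next
    fix U V
    assume U: "U \<in> vl_hom EC F \<inter> extensional (carrier EC) \<and> (\<forall>f\<in>carrier E. U (\<phi> f) = T f)"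
      and V: "V \<in> vl_hom EC F \<inter> extensional (carrier EC) \<and> (\<forall>f\<in>carrier E. V (\<phi> f) = T f)"
    have "U x = V x" if "x \<in> carrier EC" for x
    proof -
      have "U (\<psi> z) = V (\<psi> z)" if "z \<in> carrier EC0" for z
        using U V vl_complexification_unique[OF EC0(2) F vl_hom_comp[OF \<psi>(1)] vl_hom_comp[OF \<psi>(1)] _ that, of U V]
        by (simp add: \<psi>(2))
      thus ?thesis using inv[OF that] vl_homD(1)[OF \<chi>(1) that] by metis
    qed
    thus "U = V" using U V by (auto intro: extensionalityI)
  qed
  thus ?thesis using avl \<phi> unfolding vl_complexification_def by blast
qed

section \<open>The universal property of the constructed space\<close>

locale real_embedded_lattice = embedded_lattice E \<iota> complex_of_real
  for E :: "(real, 'a) modulus_space" (structure) and \<iota> :: "'a \<Rightarrow> 'i \<Rightarrow> complex" +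
  assumes iota_real: "\<And>v i. Im (\<iota> v i) = 0"
begin

sublocale real_modulus_structure "range complex_of_real" S im
  by unfold_locales (use real_structure iota_real in \<open>auto simp: S_def\<close>)

end

locale complexification = real_embedded_lattice E \<iota>
  for E :: "(real, 'a) modulus_space" (structure) and \<iota> :: "'a \<Rightarrow> 'i \<Rightarrow> complex" +
  fixes q :: "(nat \<Rightarrow> 'i \<Rightarrow> complex) \<Rightarrow> 'b"
  assumes q_iff: "x \<in> gen \<Longrightarrow> y \<in> gen \<Longrightarrow> q x = q y \<longleftrightarrow> vanishing (x - y)"
begin

sublocale gen_quotient "range complex_of_real" S im q
  by unfold_locales (rule q_iff)

definition \<phi> where "\<phi> f = q (\<lambda>_. \<iota> f)"

lemma const_gen: "f \<in> carrier E \<Longrightarrow> (\<lambda>_. \<iota> f) \<in> gen"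
  by (rule gen.const) simp

lemma phi_hom: "\<phi> \<in> vl_hom E (rho EC)"
proof (rule vl_homI)
  fix f assume f: "f \<in> carrier E"
  have "\<iota> f \<in> R" using f by simp
  then obtain p r where eq: "\<iota> f = p - r" and pr: "p \<in> pos" "r \<in> pos" by (auto simp: R_def)
  have "(\<lambda>_::nat. \<iota> f) = (\<lambda>_. p) - (\<lambda>_. r)" by (simp add: fun_eq_iff eq)
  hence "\<phi> f = q (\<lambda>_. p) \<ominus>\<^bsub>EC\<^esub> q (\<lambda>_. r)"
    unfolding \<phi>_def using pr by (simp only: q_diff gen.const pos_S)
  thus "\<phi> f \<in> carrier (rho EC)" using q_const_pos pr by (auto simp: rho_carrier)
  show "\<phi> (c \<odot> f) = c \<odot>\<^bsub>rho EC\<^esub> \<phi> f" for c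
  proof -
    have "(\<lambda>_::nat. \<iota> (c \<odot> f)) = complex_of_real c *\<^sub>S (\<lambda>_. \<iota> f)" using f by (simp add: seq_scale_def iota_scale)
    thus ?thesis unfolding \<phi>_def rho_simps using f by (simp only: q_scale const_gen of_real_eq_id id_apply)
  qed
  show "\<phi> (modulus E f) = modulus (rho EC) (\<phi> f)"
  proof -
    have "vanishing (modS (\<lambda>_. \<iota> f) - (\<lambda>_. \<iota> (modulus E f)))"
      using modS_const[OF iota_S[OF f]] f by (simp only: im_iota)
    hence "q (modS (\<lambda>_. \<iota> f)) = q (\<lambda>_. \<iota> (modulus E f))"
      using f by (simp only: q_eq_iff const_gen modulus_closed gen.modS)
    thus ?thesis unfolding \<phi>_def rho_simps using f by (simp only: q_modS const_gen)
  qed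
  fix g assume g: "g \<in> carrier E"
  have "(\<lambda>_::nat. \<iota> (f \<oplus> g)) = (\<lambda>_. \<iota> f) + (\<lambda>_. \<iota> g)" using f g by (simp add: fun_eq_iff iota_add)
  thus "\<phi> (f \<oplus> g) = \<phi> f \<oplus>\<^bsub>rho EC\<^esub> \<phi> g" unfolding \<phi>_def rho_simps using f g by (simp only: q_add const_gen)
qed

lemma phi_inj: "inj_on \<phi> (carrier E)"
proof (rule inj_onI)
  fix f g assume fg: "f \<in> carrier E" "g \<in> carrier E" "\<phi> f = \<phi> g"
  hence "vanishing ((\<lambda>_. \<iota> f) - (\<lambda>_. \<iota> g))" unfolding \<phi>_def by (simp only: q_eq_iff const_gen)
  moreover have "(\<lambda>_::nat. \<iota> f) - (\<lambda>_. \<iota> g) = (\<lambda>_. \<iota> f - \<iota> g)" by (simp add: fun_eq_iff)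
  ultimately have "\<iota> f - \<iota> g = 0" using fg by (intro vanishing_const) simp_all
  thus "f = g" using fg iota_eq_iff by (simp only: right_minus_eq)
qed

text \<open>Each rule that generates sequences is an operation preserved by homomorphisms.\<close>

lemma hom_eq_on_gen:
  assumes T: "T \<in> vl_hom EC F" "U \<in> vl_hom EC F" and eq: "\<And>f. f \<in> carrier E \<Longrightarrow> T (\<phi> f) = U (\<phi> f)"
    and x: "x \<in> gen"
  shows "T (q x) = U (q x)"
  using x
proof induction
  case (const f)
  then obtain v where v: "v \<in> carrier E" "f = \<iota> v" by (auto simp: S_def)
  show ?case using eq[OF v(1)] unfolding \<phi>_def v(2) .
next
  case (add x y)
  have "T (q x \<oplus>\<^bsub>EC\<^esub> q y) = U (q x \<oplus>\<^bsub>EC\<^esub> q y)"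
    using add.IH vl_homD(4)[OF T(1) q_EC q_EC] vl_homD(4)[OF T(2) q_EC q_EC] add.hyps by (simp only:)
  thus ?case unfolding q_add[OF add.hyps] .
next
  case (scale x c)
  have "T (c \<odot>\<^bsub>EC\<^esub> q x) = U (c \<odot>\<^bsub>EC\<^esub> q x)"
    using scale.IH vl_homD(2)[OF T(1) q_EC] vl_homD(2)[OF T(2) q_EC] scale.hyps by (simp only:)
  thus ?case unfolding q_scale[OF scale.hyps] .
next
  case (modS x)
  have "T (modulus EC (q x)) = U (modulus EC (q x))"
    using modS.IH vl_homD(3)[OF T(1) q_EC] vl_homD(3)[OF T(2) q_EC] modS.hyps by (simp only:)
  thus ?case unfolding q_modS[OF modS.hyps] .
qed

lemma extension_exists:
  fixes F :: "(complex, 'f) modulus_space"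
  assumes F: "archimedean_vector_lattice F" and T: "T \<in> vl_hom E (rho F)"
  obtains T' where "T' \<in> vl_hom EC F" "\<And>f. f \<in> carrier E \<Longrightarrow> T' (\<phi> f) = T f"
proof -
  obtain j :: "'f \<Rightarrow> 'f \<Rightarrow> complex" where j: "embedded_lattice F j (\<lambda>c. c)"
    using complex_embedding[OF F] by blast
  interpret J: embedded_lattice F j "\<lambda>c. c" by (rule j)
  interpret JC: complex_modulus_structure J.S J.im by (rule J.complex_structure) simp
  define \<tau> where "\<tau> x = j (T (the_inv_into (carrier E) \<iota> x))" for x
  have T_mem: "T f \<in> carrier F" "j (T f) \<in> J.R" if "f \<in> carrier E" for f
    using vl_homD(1)[OF T that] rho_carrier_subset[OF F] J.R_eq by auto
  have tau: "\<tau> (\<iota> f) = j (T f)" if "f \<in> carrier E" for f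
    using that by (simp add: \<tau>_def the_inv_into_f_f[OF inj])
  interpret H: lattice_hom "range complex_of_real" S im J.S J.im \<tau>
  proof
    fix x assume "x \<in> S"
    then obtain f where f: "x = \<iota> f" "f \<in> carrier E" by (auto simp: S_def)
    show "\<tau> x \<in> J.R" using f T_mem by (simp only: tau)
    show "\<tau> (complex_of_real r *\<^sub>C x) = complex_of_real r *\<^sub>C \<tau> x" for r
    proof -
      have "complex_of_real r *\<^sub>C x = \<iota> (r \<odot> f)" using f by (simp only: iota_scale)
      moreover have "r \<odot> f \<in> carrier E" "T (r \<odot> f) = complex_of_real r \<odot>\<^bsub>F\<^esub> T f"
        using f vl_homD(2)[OF T f(2), of r] by simp_all
      ultimately show ?thesis using f T_mem by (simp only: tau J.iota_scale)
    qed
    show "\<tau> (im x) = J.im (\<tau> x)"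
      using f T_mem vl_homD(3)[OF T f(2)] by (simp only: tau im_iota modulus_closed J.im_iota rho_simps)
    fix y assume "y \<in> S"
    then obtain g where g: "y = \<iota> g" "g \<in> carrier E" by (auto simp: S_def)
    have "x + y = \<iota> (f \<oplus> g)" using f g by (simp only: iota_add)
    moreover have "f \<oplus> g \<in> carrier E" "T (f \<oplus> g) = T f \<oplus>\<^bsub>F\<^esub> T g"
      using f g vl_homD(4)[OF T f(2) g(2)] by simp_all
    ultimately show "\<tau> (x + y) = \<tau> x + \<tau> y" using f g T_mem by (simp only: tau J.iota_add)
  qed
  \<comment> \<open>Each limit is exhibited in F by the operation of F that matches the generating
    rule.\<close>
  have ex: "\<exists>y\<in>carrier F. H.approx x (j y)" if "x \<in> gen" for x
    using that
  proof induction
    case (const f)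
    then obtain v where v: "f = \<iota> v" "v \<in> carrier E" by (auto simp: S_def)
    have "H.approx (\<lambda>_. f) (j (T v))" using H.approx_const[OF const] v by (simp only: tau)
    thus ?case using T_mem[OF v(2)] by blast
  next
    case (add x y)
    then obtain a b where ab: "a \<in> carrier F" "b \<in> carrier F" "H.approx x (j a)" "H.approx y (j b)" by blast
    have "H.approx (x + y) (j (a \<oplus>\<^bsub>F\<^esub> b))"
      using H.approx_add[OF gen_cauchy gen_cauchy ab(3,4)] add.hyps ab by (simp only: J.iota_add)
    moreover have "a \<oplus>\<^bsub>F\<^esub> b \<in> carrier F" using ab by simp
    ultimately show ?case by blast
  next
    case (scale x c)
    then obtain a where a: "a \<in> carrier F" "H.approx x (j a)" by blast
    have "H.approx (c *\<^sub>S x) (j (c \<odot>\<^bsub>F\<^esub> a))"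
      using H.approx_scale[OF gen_cauchy a(2)] scale.hyps a by (simp only: J.iota_scale)
    moreover have "c \<odot>\<^bsub>F\<^esub> a \<in> carrier F" using a by simp
    ultimately show ?case by blast
  next
    case (modS x)
    then obtain a where a: "a \<in> carrier F" "H.approx x (j a)" by blast
    have "H.approx (modS x) (j (modulus F a))"
      using H.approx_modS[OF gen_cauchy a(2)] modS.hyps a by (simp only: J.im_iota)
    thus ?case using J.modulus_closed[OF a(1)] by blast
  qed
  \<comment> \<open>A value is attached to a class through any of its representatives;
    \<open>H.approx_unique\<close> makes this relation a function.\<close>
  define ext where "ext a y \<longleftrightarrow> y \<in> carrier F \<and> (\<exists>x\<in>gen. q x = a \<and> H.approx x (j y))" for a y
  have ext_unique: "y = z" if yz: "ext a y" "ext a z" for a y z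
  proof -
    obtain x x' where x: "x \<in> gen" "x' \<in> gen" "q x = q x'" "H.approx x (j y)" "H.approx x' (j z)"
      using yz unfolding ext_def by metis
    hence "vanishing (x - x')" by (simp only: q_eq_iff)
    hence "j y = j z" using H.approx_unique[OF gen_cauchy gen_cauchy _ x(4,5)] x by blast
    thus ?thesis using yz J.iota_eq_iff by (auto simp: ext_def)
  qed
  define T' where "T' a = (THE y. ext a y)" for a
  have T'_eq: "T' (q x) = y" if "x \<in> gen" "y \<in> carrier F" "H.approx x (j y)" for x y
  proof -
    have "ext (q x) y" using that by (auto simp: ext_def)
    thus ?thesis unfolding T'_def using ext_unique by blast
  qed
  have T'_approx: "T' (q x) \<in> carrier F \<and> H.approx x (j (T' (q x)))" if x: "x \<in> gen" for x
  proof -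
    obtain y where y: "y \<in> carrier F" "H.approx x (j y)" using ex[OF x] by blast
    show ?thesis using y T'_eq[OF x y] by simp
  qed
  show ?thesis
  proof (rule that[of T'])
    show "T' (\<phi> f) = T f" if f: "f \<in> carrier E" for f
      unfolding \<phi>_def using H.approx_const[OF iota_S[OF f]] f T_mem[OF f]
      by (intro T'_eq const_gen) (simp_all only: tau)
    show "T' \<in> vl_hom EC F"
    proof (rule vl_homI)
      fix a assume "a \<in> carrier EC"
      then obtain x where x: "x \<in> gen" "a = q x" by (rule EC_carrierE)
      note Tx = T'_approx[OF x(1)]
      show "T' a \<in> carrier F" using x Tx by simp
      show "T' (c \<odot>\<^bsub>EC\<^esub> a) = c \<odot>\<^bsub>F\<^esub> T' a" for c
        unfolding x(2) q_scale[OF x(1)]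
      proof (rule T'_eq)
        show "H.approx (c *\<^sub>S x) (j (c \<odot>\<^bsub>F\<^esub> T' (q x)))"
          using H.approx_scale[OF gen_cauchy[OF x(1)] conjunct2[OF Tx]] Tx by (simp only: J.iota_scale)
      qed (use x Tx gen.scale in simp_all)
      show "T' (modulus EC a) = modulus F (T' a)"
        unfolding x(2) q_modS[OF x(1)]
      proof (rule T'_eq)
        show "H.approx (modS x) (j (modulus F (T' (q x))))"
          using H.approx_modS[OF gen_cauchy[OF x(1)] conjunct2[OF Tx]] Tx by (simp only: J.im_iota)
      qed (use x Tx gen.modS J.modulus_closed in simp_all)
      fix b assume "b \<in> carrier EC"
      then obtain y where y: "y \<in> gen" "b = q y" by (rule EC_carrierE)
      note Ty = T'_approx[OF y(1)]
      show "T' (a \<oplus>\<^bsub>EC\<^esub> b) = T' a \<oplus>\<^bsub>F\<^esub> T' b"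
        unfolding x(2) y(2) q_add[OF x(1) y(1)]
      proof (rule T'_eq)
        show "H.approx (x + y) (j (T' (q x) \<oplus>\<^bsub>F\<^esub> T' (q y)))"
          using H.approx_add[OF gen_cauchy[OF x(1)] gen_cauchy[OF y(1)] conjunct2[OF Tx] conjunct2[OF Ty]] Tx Ty
          by (simp only: J.iota_add)
        show "x + y \<in> gen" using x y by (intro gen.add)
      qed (use x y Tx Ty in simp_all)
    qed
  qed
qed

lemma vl_complexification_EC: "vl_complexification TYPE('f) E EC \<phi>"
proof -
  have avl: "archimedean_vector_lattice EC" by (rule archimedean_vector_lattice_EC)
  have phi_mem: "\<phi> f \<in> carrier EC" if "f \<in> carrier E" for f
    using that const_gen by (simp add: \<phi>_def)
  have "\<exists>!T'. T' \<in> vl_hom EC F \<inter> extensional (carrier EC) \<and> (\<forall>f\<in>carrier E. T' (\<phi> f) = T f)"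
    if F: "archimedean_vector_lattice F" and T: "T \<in> vl_hom E (rho F)" for F :: "(complex, 'f) modulus_space" and T
  proof (rule ex_ex1I)
    obtain T' where "T' \<in> vl_hom EC F" "\<And>f. f \<in> carrier E \<Longrightarrow> T' (\<phi> f) = T f"
      using extension_exists[OF F T] by blast
    thus "\<exists>T'. T' \<in> vl_hom EC F \<inter> extensional (carrier EC) \<and> (\<forall>f\<in>carrier E. T' (\<phi> f) = T f)"
      using vl_hom_restrict[OF avl] phi_mem by (intro exI[of _ "restrict T' (carrier EC)"]) auto
  next
    fix U V
    assume UV: "U \<in> vl_hom EC F \<inter> extensional (carrier EC) \<and> (\<forall>f\<in>carrier E. U (\<phi> f) = T f)"
      "V \<in> vl_hom EC F \<inter> extensional (carrier EC) \<and> (\<forall>f\<in>carrier E. V (\<phi> f) = T f)"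
    have "U (q x) = V (q x)" if "x \<in> gen" for x
      using UV that by (intro hom_eq_on_gen[of U F V]) auto
    hence "U a = V a" if "a \<in> carrier EC" for a using that by (auto elim: EC_carrierE)
    thus "U = V" using UV by (auto intro: extensionalityI)
  qed
  thus ?thesis using avl phi_hom phi_inj unfolding vl_complexification_def by blast
qed

end

lemma vl_complexification_exists:
  fixes E :: "(real, 'a) modulus_space"
  assumes "archimedean_vector_lattice E"
  obtains EC :: "(complex, 'a) modulus_space" and \<phi>
  where "vl_complexification TYPE('a) E EC \<phi>" "vl_complexification TYPE('f) E EC \<phi>"
proof -
  obtain \<iota> :: "'a \<Rightarrow> 'a \<Rightarrow> complex" where \<iota>: "embedded_lattice E \<iota> complex_of_real" "\<And>v i. Im (\<iota> v i) = 0"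
    using real_embedding[OF assms] by blast
  interpret real_embedded_lattice E \<iota>
    by (intro real_embedded_lattice.intro real_embedded_lattice_axioms.intro \<iota>)
  have "lepoll S (carrier E)" unfolding S_def by (rule image_lepoll)
  then obtain q :: "(nat \<Rightarrow> 'a \<Rightarrow> complex) \<Rightarrow> 'a"
    where q: "\<And>x y. x \<in> gen \<Longrightarrow> y \<in> gen \<Longrightarrow> q x = q y \<longleftrightarrow> vanishing (x - y)"
    by (rule quotient_map) (rule that)
  interpret complexification E \<iota> q
    by unfold_locales (rule q)
  \<comment> \<open>\<open>EC\<close> and \<open>\<phi>\<close> do not depend on the test type, so
    the same pair is universal for \<open>'a\<close> and for \<open>'f\<close>.\<close>
  show ?thesis by (rule that[OF vl_complexification_EC vl_complexification_EC])
qed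

theorem theorem3p3:
  fixes E :: "(real, 'a) modulus_space"
  assumes "archimedean_vector_lattice E"
  shows
    "(\<exists>(EC :: (complex, 'a) modulus_space) \<phi>. vl_complexification TYPE('a) E EC \<phi>) \<and>
     (\<forall>(EC :: (complex, 'a) modulus_space) \<phi>.
        vl_complexification TYPE('a) E EC \<phi> \<longrightarrow> vl_complexification TYPE('f) E EC \<phi>) \<and>
     (\<forall>(EC :: (complex, 'b) modulus_space) \<phi> (EC' :: (complex, 'c) modulus_space) \<phi>'.
        vl_complexification TYPE('b) E EC \<phi> \<and> vl_complexification TYPE('c) E EC \<phi> \<and>
        vl_complexification TYPE('b) E EC' \<phi>' \<and> vl_complexification TYPE('c) E EC' \<phi>' \<longrightarrow>
        (\<exists>\<psi> \<in> vl_iso EC EC'. \<forall>f\<in>carrier E. \<psi> (\<phi> f) = \<phi>' f))"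
proof (intro conjI allI impI)
  obtain EC0 :: "(complex, 'a) modulus_space" and \<phi>0 where
    EC0: "vl_complexification TYPE('a) E EC0 \<phi>0" "vl_complexification TYPE('f) E EC0 \<phi>0"
    using vl_complexification_exists[OF assms] by blast
  show "\<exists>(EC :: (complex, 'a) modulus_space) \<phi>. vl_complexification TYPE('a) E EC \<phi>"
    using EC0(1) by blast
  show "vl_complexification TYPE('f) E EC \<phi>" if "vl_complexification TYPE('a) E EC \<phi>"
    for EC :: "(complex, 'a) modulus_space" and \<phi>
    using EC0 that by (rule vl_complexification_transfer)
next
  fix EC :: "(complex, 'b) modulus_space" and \<phi> and EC' :: "(complex, 'c) modulus_space" and \<phi>'
  assume *: "vl_complexification TYPE('b) E EC \<phi> \<and> vl_complexification TYPE('c) E EC \<phi> \<and>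
        vl_complexification TYPE('b) E EC' \<phi>' \<and> vl_complexification TYPE('c) E EC' \<phi>'"
  obtain \<psi> \<chi> where \<psi>: "\<psi> \<in> vl_hom EC EC'" "\<And>f. f \<in> carrier E \<Longrightarrow> \<psi> (\<phi> f) = \<phi>' f"
    and \<chi>: "\<chi> \<in> vl_hom EC' EC"
    and inv: "\<And>x. x \<in> carrier EC \<Longrightarrow> \<chi> (\<psi> x) = x" "\<And>y. y \<in> carrier EC' \<Longrightarrow> \<psi> (\<chi> y) = y"
    by (rule vl_complexification_compare[of E EC \<phi> EC' \<phi>']) (use * in \<open>simp_all add: that\<close>)
  have "bij_betw \<psi> (carrier EC) (carrier EC')"
    by (rule bij_betwI[of _ _ _ \<chi>]) (use vl_homD(1)[OF \<psi>(1)] vl_homD(1)[OF \<chi>] inv in auto)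
  thus "\<exists>\<psi>\<in>vl_iso EC EC'. \<forall>f\<in>carrier E. \<psi> (\<phi> f) = \<phi>' f"
    using \<psi> by (auto simp: vl_iso_def)
qed

end
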